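(* Let $0<H<1$, $m\ge1$, $G=c_mH_m$ with $c_m\neq 0$ and $H^*(m)\ne1/2$. The estimator $C_{\varepsilon,\delta}$ admits the following decomposition into orthogonal Wiener chaoses: $$C_{\varepsilon,\delta}=c_m^2T_0+\sum_{r=0}^{m-1}\left(\frac{c_m\,m!}{(m-r)!\sqrt{r!}}\right)^2T_{2m-2r},$$ where the index $2m-2r$ records the order of the Wiener chaos to which $T_{2m-2r}$ belongs, and for $0\le r\le m-1$ $$T_{2m-2r}=N^{2H'-1}\alpha(\varepsilon,H^*(m))^2\,I_{2m-2r}\left(\sum_{k=0}^{N-1}\int_{k\delta}^{(k+1)\delta}(\tau_sK^\varepsilon)^{\otimes m}ds\otimes_r\int_{k\delta}^{(k+1)\delta}(\tau_sK^\varepsilon)^{\otimes m}ds\right),$$ and $c_m^2T_0=\mathbb{E}[C_{\varepsilon,\delta}]$.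
   Context: $W$ is a two-sided standard Brownian motion and $I_n$ denotes the $n$-fold multiple Wiener–Itô integral with respect to $W$, acting on $L^2(\mathbb{R}^n)$ (with $I_n(f)=I_n(\mathrm{Sym} f)$); the $n$-th Wiener chaos is the range of $I_n$. For $f\in L^2(\mathbb{R}^p)$, $g\in L^2(\mathbb{R}^q)$ symmetric and $0\le r\le p\wedge q$, the contraction is $(f\otimes_rg)(x,y)=\int_{\mathbb{R}^r}f(x,s)g(y,s)\,ds$ with $x\in\mathbb{R}^{p-r},y\in\mathbb{R}^{q-r}$; $f^{\otimes n}(x_1,\dots,x_n)=f(x_1)\cdots f(x_n)$; $(\tau_tf)(u)=f(u-t)$. Hermite polynomials: $H_n(x)=(-1)^n e^{x^2/2}\frac{d^n}{dx^n}e^{-x^2/2}$. For $\varepsilon>0$, $Y^\varepsilon$ is the unique stationary solution of $dY^\varepsilon_t=-\frac1\varepsilon Y^\varepsilon_t\,dt+\frac{\sigma}{\varepsilon^H}\,dB^H_t$, with $\sigma^2=2/\Gamma(2H+1)$ (so $\mathbb{E}[(Y^\varepsilon_t)^2]=1$), where $B^H$ is the fractional Brownian motion of Hurst parameter $H$ built from $W$ through the Mandelbrot–Van Ness representation. The kernel $K^\varepsilon\in L^2(\mathbb{R})$, $\|K^\varepsilon\|_{L^2}=1$, is the one for which $Y^\varepsilon_t=\int_{\mathbb{R}}(\tau_tK^\varepsilon)(s)\,dW_s$ for all $t$. Set $H^*(m)=(H-1)m+1$, $H'=H^*(m)\vee\frac12$, $\alpha(\varepsilon,H^*(m))=\varepsilon^{H^*(m)-1}$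 if $H^*(m)>1/2$ and $\varepsilon^{-1/2}$ if $H^*(m)<1/2$, $X^\varepsilon_t=X^\varepsilon_0+\alpha(\varepsilon,H^*(m))\int_0^tG(Y^\varepsilon_s)\,ds$. For a step $\delta>0$ and $N\in\mathbb N$ observations, $C_{\varepsilon,\delta}=N^{2H'-1}\sum_{i=0}^{N-1}(X^\varepsilon_{(i+1)\delta}-X^\varepsilon_{i\delta})^2$. *)

theory Defs
  imports "HOL-Probability.Probability"
begin

section \<open>Brownian motion and multiple Wiener--Ito integrals\<close>

definition two_sided_brownian_motion :: "'w measure \<Rightarrow> (real \<Rightarrow> 'w \<Rightarrow> real) \<Rightarrow> bool" where
  "two_sided_brownian_motion M W \<longleftrightarrow>
     (\<forall>t. W t \<in> borel_measurable M) \<and>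
     (AE \<omega> in M. W 0 \<omega> = 0) \<and>
     (AE \<omega> in M. continuous_on UNIV (\<lambda>t. W t \<omega>)) \<and>
     (\<forall>s t. s < t \<longrightarrow>
        distributed M lborel (\<lambda>\<omega>. W t \<omega> - W s \<omega>) (\<lambda>x. ennreal (normal_density 0 (sqrt (t - s)) x))) \<and>
     (\<forall>(n::nat) (t::nat \<Rightarrow> real). (\<forall>i<n. t i < t (Suc i)) \<longrightarrow>
        prob_space.indep_vars M (\<lambda>_. borel) (\<lambda>i \<omega>. W (t (Suc i)) \<omega> - W (t i) \<omega>) {..<n})"

text \<open>The space $R^n$ is modelled by the product measure over the index set \<open>{..<n}\<close>; elements of
  $L^2(R^n)$ are represented by square-integrable Borel functions.\<close>

definition Rn :: "nat \<Rightarrow> (nat \<Rightarrow> real) measure" where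
  "Rn n = (\<Pi>\<^sub>M i\<in>{..<n}. lborel)"

definition L2 :: "'a measure \<Rightarrow> ('a \<Rightarrow> real) set" where
  "L2 M = {f \<in> borel_measurable M. integrable M (\<lambda>x. (f x)\<^sup>2)}"

text \<open>A list of triples \<open>(c, a, b)\<close> encodes the elementary function which is the sum of the functions
  \<open>c\<close> times the indicator of the box with sides $(a_i, b_i]$. The sides of each box are pairwise
  disjoint, so that elementary functions vanish on the diagonals.\<close>

type_synonym elementary = "(real \<times> (nat \<Rightarrow> real) \<times> (nat \<Rightarrow> real)) list"

definition off_diagonal :: "nat \<Rightarrow> elementary \<Rightarrow> bool" where
  "off_diagonal n es \<longleftrightarrow> (\<forall>(c, a, b) \<in> set es.
     (\<forall>i<n. a i < b i) \<and>
     (\<forall>i<n. \<forall>j<n. i \<noteq> j \<longrightarrow> {a i<..b i} \<inter> {a j<..b j} = {}))"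

definition elementary_fun :: "nat \<Rightarrow> elementary \<Rightarrow> (nat \<Rightarrow> real) \<Rightarrow> real" where
  "elementary_fun n es x = (\<Sum>(c, a, b)\<leftarrow>es. c * (\<Prod>i<n. indicator {a i<..b i} (x i)))"

definition elementary_integral ::
    "(real \<Rightarrow> 'w \<Rightarrow> real) \<Rightarrow> nat \<Rightarrow> elementary \<Rightarrow> 'w \<Rightarrow> real" where
  "elementary_integral W n es \<omega> = (\<Sum>(c, a, b)\<leftarrow>es. c * (\<Prod>i<n. W (b i) \<omega> - W (a i) \<omega>))"

text \<open>Ito's construction: the integral of a (not necessarily symmetric) function in $L^2(R^n)$ is
  the $L^2$-limit of the integrals of approximating elementary functions. It is determined up to
  almost sure equality, and $I_n(f) = I_n(\mathrm{Sym} f)$, since the elementary integral is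
  invariant under permutations of the sides of a box.\<close>

definition is_multiple_integral ::
    "'w measure \<Rightarrow> (real \<Rightarrow> 'w \<Rightarrow> real) \<Rightarrow> nat \<Rightarrow> ((nat \<Rightarrow> real) \<Rightarrow> real) \<Rightarrow> ('w \<Rightarrow> real) \<Rightarrow> bool" where
  "is_multiple_integral M W n f Z \<longleftrightarrow> f \<in> L2 (Rn n) \<and> Z \<in> L2 M \<and>
     (\<exists>es :: nat \<Rightarrow> elementary. (\<forall>k. off_diagonal n (es k)) \<and>
        (\<lambda>k. LINT x|Rn n. (elementary_fun n (es k) x - f x)\<^sup>2) \<longlonglongrightarrow> 0 \<and>
        (\<lambda>k. LINT \<omega>|M. (elementary_integral W n (es k) \<omega> - Z \<omega>)\<^sup>2) \<longlonglongrightarrow> 0)"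

definition multiple_integral ::
    "'w measure \<Rightarrow> (real \<Rightarrow> 'w \<Rightarrow> real) \<Rightarrow> nat \<Rightarrow> ((nat \<Rightarrow> real) \<Rightarrow> real) \<Rightarrow> 'w \<Rightarrow> real" where
  "multiple_integral M W n f = (SOME Z. is_multiple_integral M W n f Z)"

definition wiener_integral ::
    "'w measure \<Rightarrow> (real \<Rightarrow> 'w \<Rightarrow> real) \<Rightarrow> (real \<Rightarrow> real) \<Rightarrow> 'w \<Rightarrow> real" where
  "wiener_integral M W f = multiple_integral M W 1 (\<lambda>x. f (x 0))"

definition wiener_chaos :: "'w measure \<Rightarrow> (real \<Rightarrow> 'w \<Rightarrow> real) \<Rightarrow> nat \<Rightarrow> ('w \<Rightarrow> real) set" where
  "wiener_chaos M W n = {Z \<in> borel_measurable M.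
     \<exists>f \<in> L2 (Rn n). AE \<omega> in M. Z \<omega> = multiple_integral M W n f \<omega>}"

text \<open>For \<open>f\<close> on $R^p$, \<open>g\<close> on $R^q$ and \<open>r \<le> min p q\<close>, a point \<open>z\<close> of $R^{p+q-2r}$ is split into
  its first \<open>p - r\<close> coordinates and its last \<open>q - r\<close> coordinates.\<close>

definition contraction :: "nat \<Rightarrow> nat \<Rightarrow> nat \<Rightarrow> ((nat \<Rightarrow> real) \<Rightarrow> real) \<Rightarrow> ((nat \<Rightarrow> real) \<Rightarrow> real)
    \<Rightarrow> (nat \<Rightarrow> real) \<Rightarrow> real" where
  "contraction p q r f g z = (LINT s|Rn r.
      f (\<lambda>i\<in>{..<p}. if i < p - r then z i else s (i - (p - r))) *
      g (\<lambda>i\<in>{..<q}. if i < q - r then z (p - r + i) else s (i - (q - r))))"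

definition tensor_power :: "nat \<Rightarrow> (real \<Rightarrow> real) \<Rightarrow> (nat \<Rightarrow> real) \<Rightarrow> real" where
  "tensor_power n f x = (\<Prod>i<n. f (x i))"

definition shift :: "real \<Rightarrow> (real \<Rightarrow> real) \<Rightarrow> real \<Rightarrow> real" where
  "shift t f u = f (u - t)"

definition hermite :: "nat \<Rightarrow> real \<Rightarrow> real" where
  "hermite n x = (-1) ^ n * exp (x\<^sup>2 / 2) * (deriv ^^ n) (\<lambda>y. exp (- (y\<^sup>2 / 2))) x"


section \<open>The fractional Ornstein--Uhlenbeck process\<close>

definition pos_powr :: "real \<Rightarrow> real \<Rightarrow> real" where
  "pos_powr x a = (if x > 0 then x powr a else 0)"

definition mvn_kernel :: "real \<Rightarrow> real \<Rightarrow> real \<Rightarrow> real" where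
  "mvn_kernel H t s = pos_powr (t - s) (H - 1/2) - pos_powr (- s) (H - 1/2)"

text \<open>The Mandelbrot--Van Ness representation, normalised so that the variance at time 1 is 1.\<close>

definition mvn_fractional_brownian_motion ::
    "'w measure \<Rightarrow> (real \<Rightarrow> 'w \<Rightarrow> real) \<Rightarrow> real \<Rightarrow> (real \<Rightarrow> 'w \<Rightarrow> real) \<Rightarrow> bool" where
  "mvn_fractional_brownian_motion M W H B \<longleftrightarrow>
     (\<forall>t. B t \<in> borel_measurable M) \<and>
     (AE \<omega> in M. continuous_on UNIV (\<lambda>t. B t \<omega>)) \<and>
     (\<forall>t. AE \<omega> in M. B t \<omega> =
        wiener_integral M W
          (\<lambda>s. mvn_kernel H t s / sqrt (LINT u|lborel. (mvn_kernel H 1 u)\<^sup>2)) \<omega>)"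

definition stationary_process :: "'w measure \<Rightarrow> (real \<Rightarrow> 'w \<Rightarrow> real) \<Rightarrow> bool" where
  "stationary_process M Y \<longleftrightarrow> (\<forall>(n::nat) (t::nat \<Rightarrow> real) (h::real).
     distr M (\<Pi>\<^sub>M i\<in>{..<n}. borel) (\<lambda>\<omega>. \<lambda>i\<in>{..<n}. Y (t i + h) \<omega>) =
     distr M (\<Pi>\<^sub>M i\<in>{..<n}. borel) (\<lambda>\<omega>. \<lambda>i\<in>{..<n}. Y (t i) \<omega>))"

definition stationary_fOU ::
    "'w measure \<Rightarrow> real \<Rightarrow> real \<Rightarrow> (real \<Rightarrow> 'w \<Rightarrow> real) \<Rightarrow> (real \<Rightarrow> 'w \<Rightarrow> real) \<Rightarrow> bool" where
  "stationary_fOU M H \<epsilon> B Y \<longleftrightarrow>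
     (\<forall>t. Y t \<in> borel_measurable M) \<and>
     (AE \<omega> in M. continuous_on UNIV (\<lambda>t. Y t \<omega>)) \<and>
     stationary_process M Y \<and>
     (AE \<omega> in M. \<forall>s t. s \<le> t \<longrightarrow>
        Y t \<omega> - Y s \<omega> = - (1 / \<epsilon>) * (LBINT u=s..t. Y u \<omega>)
          + sqrt (2 / Gamma (2 * H + 1)) / \<epsilon> powr H * (B t \<omega> - B s \<omega>))"


section \<open>The estimator\<close>

definition Hstar :: "real \<Rightarrow> nat \<Rightarrow> real" where
  "Hstar H m = (H - 1) * real m + 1"

definition Hprime :: "real \<Rightarrow> nat \<Rightarrow> real" where
  "Hprime H m = max (Hstar H m) (1/2)"

text \<open>The scaling at the critical value \<open>h = 1/2\<close> is never used.\<close>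

definition alpha :: "real \<Rightarrow> real \<Rightarrow> real" where
  "alpha \<epsilon> h = (if h > 1/2 then \<epsilon> powr (h - 1) else \<epsilon> powr (- 1/2))"

definition quad_var_estimator ::
    "real \<Rightarrow> nat \<Rightarrow> real \<Rightarrow> (real \<Rightarrow> 'w \<Rightarrow> real) \<Rightarrow> 'w \<Rightarrow> real" where
  "quad_var_estimator h N \<delta> X \<omega> = real N powr (2 * h - 1) *
     (\<Sum>i<N. (X (real (i + 1) * \<delta>) \<omega> - X (real i * \<delta>) \<omega>)\<^sup>2)"

text \<open>The integral over \<open>s\<close> is taken pointwise in \<open>x\<close>; for \<open>K\<close> in $L^2(R)$ it converges for almost every
  \<open>x\<close> by Minkowski's inequality and represents the $L^2(R^m)$-valued integral.\<close>

definition averaged_kernel ::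
    "(real \<Rightarrow> real) \<Rightarrow> nat \<Rightarrow> real \<Rightarrow> real \<Rightarrow> (nat \<Rightarrow> real) \<Rightarrow> real" where
  "averaged_kernel K m a b x = (LBINT s=a..b. tensor_power m (shift s K) x)"

end

theory Submission
  imports Defs
begin

text \<open>
  The increment of \<open>X\<close> over an observation interval is a constant times the time integral of
  \<open>hermite m (Y s)\<close>, so its square is a double time integral of \<open>hermite m (Y s) * hermite m (Y t)\<close>.
  If \<open>h\<close> and \<open>g\<close> are unit vectors of $L^2(R)$ with inner product \<open>\<rho>\<close>, the product of the Hermite
  polynomials of $I_1(h)$ and $I_1(g)$ is the sum over \<open>r \<le> m\<close> of
  $r! {m \choose r}^2 \rho^r I_{2m-2r}(h^{\otimes (m-r)} \otimes g^{\otimes (m-r)})$, and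
  $r! {m \choose r}^2$ is the square of the coefficient in the decomposition. With \<open>h\<close> and \<open>g\<close> the
  translates of \<open>K\<close> by \<open>s\<close> and \<open>t\<close>, integrating over \<open>s\<close> and \<open>t\<close> inside the multiple integral gives
  the \<open>r\<close>-th contraction of the averaged kernel with itself. The term \<open>r = m\<close> is a constant and the
  others are centred, so this constant is the expectation of the estimator.

  The multiple integral rests on \<open>elementary_integral_isometry\<close>: on a grid that resolves two elementary
  functions their integrals are polynomials in independent increments, each of degree at most one in
  every increment, and the expectation of the product can be read off cell by cell. It gives uniqueness,
  continuity and the orthogonality of chaoses of different order; together with the density of the
  elementary functions (\<open>L2_approximable\<close>) and completeness it gives existence for every kernel.

  The link with Hermite polynomials is \<open>is_integral_tensor_power\<close>. For a step function \<open>h\<close> on a fine grid, the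
  Hermite polynomial of $I_1(h)$ differs from the elementary integral of the off-diagonal part of
  $h^{\otimes n}$ by a variable whose second moment is at most \<open>n!\<close> times the integral of the square of
  $h^{\otimes n}$ over the cubes that meet a diagonal, and this integral tends to zero with the mesh.
  The case of two functions (\<open>is_integral_mixed\<close>) follows by polarisation: apply the case of one
  function to \<open>l h + g\<close> for all natural numbers \<open>l\<close> and compare coefficients.

  The multiple integral is exchanged with the time integrals in \<open>is_integral_average\<close>, and
  \<open>contraction_averaged_kernel\<close> recognises the resulting kernel as a contraction.\<close>

section \<open>Square-integrable functions\<close>

abbreviation L2_tendsto :: "'a measure \<Rightarrow> (nat \<Rightarrow> 'a \<Rightarrow> real) \<Rightarrow> ('a \<Rightarrow> real) \<Rightarrow> bool" where
  "L2_tendsto N F f \<equiv> (\<lambda>k. LINT x|N. (F k x - f x)\<^sup>2) \<longlonglongrightarrow> 0"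

lemma L2_measurable: "f \<in> L2 N \<Longrightarrow> f \<in> borel_measurable N"
  by (simp add: L2_def)

lemma L2_square_integrable: "f \<in> L2 N \<Longrightarrow> integrable N (\<lambda>x. (f x)\<^sup>2)"
  by (simp add: L2_def)

lemma L2_I: "f \<in> borel_measurable N \<Longrightarrow> integrable N (\<lambda>x. (f x)\<^sup>2) \<Longrightarrow> f \<in> L2 N"
  by (simp add: L2_def)

lemma L2_mult_integrable:
  assumes "f \<in> L2 N" "g \<in> L2 N"
  shows "integrable N (\<lambda>x. f x * g x)"
proof (rule Bochner_Integration.integrable_bound)
  show "integrable N (\<lambda>x. (f x)\<^sup>2 + (g x)\<^sup>2)"
    using assms by (intro Bochner_Integration.integrable_add L2_square_integrable)
  show "(\<lambda>x. f x * g x) \<in> borel_measurable N"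
    using assms by (auto intro!: borel_measurable_times dest: L2_measurable)
  show "AE x in N. norm (f x * g x) \<le> norm ((f x)\<^sup>2 + (g x)\<^sup>2)"
  proof (intro AE_I2)
    fix x
    have "2 * (\<bar>f x\<bar> * \<bar>g x\<bar>) \<le> (f x)\<^sup>2 + (g x)\<^sup>2"
      using sum_squares_bound[of "\<bar>f x\<bar>" "\<bar>g x\<bar>"] by (simp add: mult.assoc)
    moreover have "0 \<le> \<bar>f x\<bar> * \<bar>g x\<bar>"
      by simp
    ultimately have "\<bar>f x\<bar> * \<bar>g x\<bar> \<le> (f x)\<^sup>2 + (g x)\<^sup>2"
      by linarith
    then show "norm (f x * g x) \<le> norm ((f x)\<^sup>2 + (g x)\<^sup>2)"
      by (simp add: abs_mult)
  qed
qed

lemma L2_zero: "(\<lambda>x. 0) \<in> L2 N"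
  by (simp add: L2_def)

lemma L2_cmult: "f \<in> L2 N \<Longrightarrow> (\<lambda>x. c * f x) \<in> L2 N"
  by (auto simp: L2_def power_mult_distrib)

lemma L2_add:
  assumes "f \<in> L2 N" "g \<in> L2 N"
  shows "(\<lambda>x. f x + g x) \<in> L2 N"
proof (rule L2_I)
  show "(\<lambda>x. f x + g x) \<in> borel_measurable N"
    using assms by (auto intro!: borel_measurable_add dest: L2_measurable)
  have "integrable N (\<lambda>x. (f x)\<^sup>2 + (g x)\<^sup>2 + 2 * (f x * g x))"
    using assms by (intro Bochner_Integration.integrable_add L2_square_integrable
        integrable_mult_right L2_mult_integrable)
  then show "integrable N (\<lambda>x. (f x + g x)\<^sup>2)"
    by (simp add: power2_sum mult.assoc)
qed

lemma L2_diff: "f \<in> L2 N \<Longrightarrow> g \<in> L2 N \<Longrightarrow> (\<lambda>x. f x - g x) \<in> L2 N"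
  using L2_add[of f N "\<lambda>x. (-1) * g x"] L2_cmult[of g N "-1"] by simp

lemma L2_sum: "(\<And>i. i \<in> A \<Longrightarrow> f i \<in> L2 N) \<Longrightarrow> (\<lambda>x. \<Sum>i\<in>A. f i x) \<in> L2 N"
  by (induction A rule: infinite_finite_induct) (auto intro: L2_zero L2_add)

lemma L2_bound:
  assumes "g \<in> L2 N" "f \<in> borel_measurable N" "AE x in N. \<bar>f x\<bar> \<le> \<bar>g x\<bar>"
  shows "f \<in> L2 N"
proof (rule L2_I)
  show "integrable N (\<lambda>x. (f x)\<^sup>2)"
  proof (rule Bochner_Integration.integrable_bound)
    show "integrable N (\<lambda>x. (g x)\<^sup>2)"
      using assms by (intro L2_square_integrable)
    show "AE x in N. norm ((f x)\<^sup>2) \<le> norm ((g x)\<^sup>2)"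
      using assms(3) by eventually_elim (simp add: abs_le_square_iff)
  qed (use assms in measurable)
qed fact

lemma L2_cong_AE:
  assumes "f \<in> L2 N" "g \<in> borel_measurable N" "AE x in N. f x = g x"
  shows "g \<in> L2 N"
  by (rule L2_bound[OF assms(1,2)]) (use assms(3) in eventually_elim, simp)

lemma L2_diff_norm:
  assumes "f \<in> L2 N" "g \<in> L2 N"
  shows "(LINT x|N. (f x - g x)\<^sup>2) = (LINT x|N. (f x)\<^sup>2) - 2 * (LINT x|N. f x * g x) + (LINT x|N. (g x)\<^sup>2)"
proof -
  have "(LINT x|N. (f x - g x)\<^sup>2) = (LINT x|N. ((f x)\<^sup>2 - 2 * (f x * g x)) + (g x)\<^sup>2)"
    by (simp add: power2_diff algebra_simps)
  also have "\<dots> = (LINT x|N. (f x)\<^sup>2 - 2 * (f x * g x)) + (LINT x|N. (g x)\<^sup>2)"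
    using assms by (intro Bochner_Integration.integral_add Bochner_Integration.integrable_diff
        L2_square_integrable integrable_mult_right L2_mult_integrable)
  also have "(LINT x|N. (f x)\<^sup>2 - 2 * (f x * g x)) = (LINT x|N. (f x)\<^sup>2) - (LINT x|N. 2 * (f x * g x))"
    using assms by (intro Bochner_Integration.integral_diff L2_square_integrable
        integrable_mult_right L2_mult_integrable)
  finally show ?thesis by simp
qed

lemma L2_zero_AE:
  assumes "f \<in> L2 N" "(LINT x|N. (f x)\<^sup>2) = 0"
  shows "AE x in N. f x = 0"
  using integral_nonneg_eq_0_iff_AE[of N "\<lambda>x. (f x)\<^sup>2"] assms L2_square_integrable[OF assms(1)] by auto

lemma L2_Cauchy_Schwarz:
  assumes f: "f \<in> L2 N" and g: "g \<in> L2 N"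
  shows "(LINT x|N. f x * g x)\<^sup>2 \<le> (LINT x|N. (f x)\<^sup>2) * (LINT x|N. (g x)\<^sup>2)"
proof -
  define a b c where "a = (LINT x|N. (f x)\<^sup>2)" and "b = (LINT x|N. f x * g x)"
    and "c = (LINT x|N. (g x)\<^sup>2)"
  have q: "0 \<le> a - 2 * l * b + l\<^sup>2 * c" for l
  proof -
    have "0 \<le> (LINT x|N. (f x - l * g x)\<^sup>2)" by simp
    also have "\<dots> = a - 2 * (LINT x|N. f x * (l * g x)) + (LINT x|N. (l * g x)\<^sup>2)"
      unfolding a_def by (rule L2_diff_norm[OF f L2_cmult[OF g]])
    also have "(LINT x|N. f x * (l * g x)) = l * b"
      unfolding b_def by (subst integral_mult_right_zero[symmetric]) (simp add: mult.left_commute)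
    also have "(LINT x|N. (l * g x)\<^sup>2) = l\<^sup>2 * c"
      unfolding c_def by (simp add: power_mult_distrib)
    finally show ?thesis by simp
  qed
  have "c \<ge> 0" "a \<ge> 0" unfolding c_def a_def by simp_all
  show ?thesis
  proof (cases "c = 0")
    case True
    then have "AE x in N. g x = 0" using L2_zero_AE[OF g] c_def by simp
    then have "b = (LINT x|N. 0)"
      unfolding b_def by (intro integral_cong_AE) (use f g in \<open>auto dest: L2_measurable intro!: borel_measurable_times\<close>)
    then show ?thesis using True unfolding a_def[symmetric] b_def[symmetric] c_def[symmetric] by simp
  next
    case False
    with \<open>c \<ge> 0\<close> have "c > 0" by simp
    from q[of "b / c"] have "0 \<le> a - b\<^sup>2 / c"
      using \<open>c > 0\<close> by (simp add: power2_eq_square field_simps)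
    then show ?thesis using \<open>c > 0\<close>
      unfolding a_def[symmetric] b_def[symmetric] c_def[symmetric] by (simp add: field_simps)
  qed
qed

lemma L2_inner_tendsto_0:
  assumes "\<And>k. F k \<in> L2 N" "\<And>k. G k \<in> L2 N"
    and "(\<lambda>k. LINT x|N. (F k x)\<^sup>2) \<longlonglongrightarrow> 0" "Bseq (\<lambda>k. LINT x|N. (G k x)\<^sup>2)"
  shows "(\<lambda>k. LINT x|N. F k x * G k x) \<longlonglongrightarrow> 0"
proof -
  have "(\<lambda>k. (LINT x|N. (F k x)\<^sup>2) * (LINT x|N. (G k x)\<^sup>2)) \<longlonglongrightarrow> 0"
    using assms(3,4) by (intro lim_null_mult_right_bounded[where B="SOME B. \<forall>k. norm (LINT x|N. (G k x)\<^sup>2) \<le> B"])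
      (auto simp: Bseq_def intro!: always_eventually elim: someI2)
  then have "(\<lambda>k. (LINT x|N. F k x * G k x)\<^sup>2) \<longlonglongrightarrow> 0"
    by (rule Lim_null_comparison[rotated]) (use L2_Cauchy_Schwarz[OF assms(1,2)] in auto)
  then show ?thesis by simp
qed

lemma L2_inner_tendsto:
  assumes F: "\<And>k. F k \<in> L2 N" "f \<in> L2 N" "L2_tendsto N F f"
    and G: "\<And>k. G k \<in> L2 N" "g \<in> L2 N" "L2_tendsto N G g"
  shows "(\<lambda>k. LINT x|N. F k x * G k x) \<longlonglongrightarrow> (LINT x|N. f x * g x)"
proof -
  have B: "Bseq (\<lambda>k. LINT x|N. (G k x - g x)\<^sup>2)"
    using G(3) convergent_imp_Bseq convergentI by blast
  have 1: "(\<lambda>k. LINT x|N. (F k x - f x) * (G k x - g x)) \<longlonglongrightarrow> 0"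
    using F G B by (intro L2_inner_tendsto_0 L2_diff) auto
  have 2: "(\<lambda>k. LINT x|N. (F k x - f x) * g x) \<longlonglongrightarrow> 0"
    using F G by (intro L2_inner_tendsto_0 L2_diff) (auto simp: Bseq_def intro!: exI[of _ "1 + \<bar>LINT x|N. (g x)\<^sup>2\<bar>"])
  have 3: "(\<lambda>k. LINT x|N. (G k x - g x) * f x) \<longlonglongrightarrow> 0"
    using F G by (intro L2_inner_tendsto_0 L2_diff) (auto simp: Bseq_def intro!: exI[of _ "1 + \<bar>LINT x|N. (f x)\<^sup>2\<bar>"])
  have eq: "(LINT x|N. F k x * G k x) = (LINT x|N. (F k x - f x) * (G k x - g x)) +
      (LINT x|N. (F k x - f x) * g x) + (LINT x|N. (G k x - g x) * f x) + (LINT x|N. f x * g x)" for k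
  proof -
    have i: "integrable N (\<lambda>x. (F k x - f x) * (G k x - g x))" "integrable N (\<lambda>x. (F k x - f x) * g x)"
      "integrable N (\<lambda>x. (G k x - g x) * f x)" "integrable N (\<lambda>x. f x * g x)"
      using F G by (auto intro!: L2_mult_integrable L2_diff)
    have "(LINT x|N. F k x * G k x) = (LINT x|N. ((((F k x - f x) * (G k x - g x)) +
      (F k x - f x) * g x) + (G k x - g x) * f x) + f x * g x)"
      by (simp add: algebra_simps)
    then show ?thesis using i by (simp only: Bochner_Integration.integral_add Bochner_Integration.integrable_add)
  qed
  show ?thesis unfolding eq using tendsto_add[OF tendsto_add[OF tendsto_add[OF 1 2] 3] tendsto_const] by simp
qed

lemma L2_const_tendsto: "L2_tendsto N (\<lambda>k. f) f"
  by simp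

lemma L2_norm_tendsto:
  assumes F: "\<And>k. F k \<in> L2 N" "f \<in> L2 N" "L2_tendsto N F f"
  shows "(\<lambda>k. LINT x|N. (F k x)\<^sup>2) \<longlonglongrightarrow> (LINT x|N. (f x)\<^sup>2)"
  using L2_inner_tendsto[OF F F] by (simp add: power2_eq_square)

text \<open>A substitute for the triangle inequality that avoids square roots.\<close>

lemma L2_dist_triangle:
  assumes "f \<in> L2 N" "g \<in> L2 N" "h \<in> L2 N"
  shows "(LINT x|N. (f x - h x)\<^sup>2) \<le> 2 * (LINT x|N. (f x - g x)\<^sup>2) + 2 * (LINT x|N. (g x - h x)\<^sup>2)"
proof -
  have i: "integrable N (\<lambda>x. (f x - g x)\<^sup>2)" "integrable N (\<lambda>x. (g x - h x)\<^sup>2)" "integrable N (\<lambda>x. (f x - h x)\<^sup>2)"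
    using assms by (auto intro!: L2_square_integrable L2_diff)
  have "(LINT x|N. (f x - h x)\<^sup>2) \<le> (LINT x|N. 2 * (f x - g x)\<^sup>2 + 2 * (g x - h x)\<^sup>2)"
  proof (rule integral_mono)
    fix x
    have "(f x - h x)\<^sup>2 + ((f x - g x) - (g x - h x))\<^sup>2 = 2 * (f x - g x)\<^sup>2 + 2 * (g x - h x)\<^sup>2"
      by (simp add: power2_eq_square algebra_simps)
    then show "(f x - h x)\<^sup>2 \<le> 2 * (f x - g x)\<^sup>2 + 2 * (g x - h x)\<^sup>2"
      using zero_le_power2[of "(f x - g x) - (g x - h x)"] by linarith
  qed (use i in auto)
  then show ?thesis using i by simp
qed

lemma L2_tendsto_trans:
  assumes "\<And>k. F k \<in> L2 N" "\<And>k. G k \<in> L2 N" "h \<in> L2 N"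
    and "(\<lambda>k. LINT x|N. (F k x - G k x)\<^sup>2) \<longlonglongrightarrow> 0" "L2_tendsto N G h"
  shows "L2_tendsto N F h"
proof (rule tendsto_sandwich[OF _ _ tendsto_const])
  show "\<forall>\<^sub>F k in sequentially. (LINT x|N. (F k x - h x)\<^sup>2) \<le>
      2 * (LINT x|N. (F k x - G k x)\<^sup>2) + 2 * (LINT x|N. (G k x - h x)\<^sup>2)"
    using assms by (auto intro!: always_eventually L2_dist_triangle)
  show "(\<lambda>k. 2 * (LINT x|N. (F k x - G k x)\<^sup>2) + 2 * (LINT x|N. (G k x - h x)\<^sup>2)) \<longlonglongrightarrow> 0"
    using tendsto_add[OF tendsto_mult_right_zero[OF assms(4)] tendsto_mult_right_zero[OF assms(5)]] by simp
qed auto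

lemma L2_tendsto_add:
  assumes "\<And>k. F k \<in> L2 N" "f \<in> L2 N" "L2_tendsto N F f"
    and "\<And>k. G k \<in> L2 N" "g \<in> L2 N" "L2_tendsto N G g"
  shows "L2_tendsto N (\<lambda>k x. F k x + G k x) (\<lambda>x. f x + g x)"
proof (rule L2_tendsto_trans[where G="\<lambda>k x. f x + G k x"])
  show "(\<lambda>k. LINT x|N. (F k x + G k x - (f x + G k x))\<^sup>2) \<longlonglongrightarrow> 0"
    using assms(3) by simp
  show "L2_tendsto N (\<lambda>k x. f x + G k x) (\<lambda>x. f x + g x)"
    using assms(6) by simp
qed (use assms in \<open>auto intro: L2_add\<close>)

lemma L2_tendsto_cmult:
  assumes "L2_tendsto N F f"
  shows "L2_tendsto N (\<lambda>k x. c * F k x) (\<lambda>x. c * f x)"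
proof -
  have "(c * F k x - c * f x)\<^sup>2 = c\<^sup>2 * (F k x - f x)\<^sup>2" for k x
    by (simp add: power_mult_distrib flip: right_diff_distrib)
  then show ?thesis using tendsto_mult_right_zero[OF assms, of "c\<^sup>2"] by simp
qed

lemma L2_tendsto_AE_subseq:
  assumes "\<And>k. F k \<in> L2 N" "f \<in> L2 N" "L2_tendsto N F f"
  shows "\<exists>r. strict_mono r \<and> (AE x in N. (\<lambda>k. F (r k) x) \<longlonglongrightarrow> f x)"
proof -
  have "\<exists>r::nat\<Rightarrow>nat. strict_mono r \<and> (AE x in N. (\<lambda>k. (F (r k) x - f x)\<^sup>2) \<longlonglongrightarrow> 0)"
    using assms by (intro tendsto_L1_AE_subseq L2_square_integrable L2_diff) auto
  then obtain r :: "nat \<Rightarrow> nat" where r: "strict_mono r" "AE x in N. (\<lambda>k. (F (r k) x - f x)\<^sup>2) \<longlonglongrightarrow> 0"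
    by blast
  from r(2) have "AE x in N. (\<lambda>k. F (r k) x) \<longlonglongrightarrow> f x"
    by eventually_elim (simp add: LIM_zero_iff)
  with r(1) show ?thesis by blast
qed

lemma L2_dominated_convergence:
  assumes "g \<in> L2 N" "\<And>k. F k \<in> borel_measurable N" "f \<in> borel_measurable N"
    and "AE x in N. (\<lambda>k. F k x) \<longlonglongrightarrow> f x" "\<And>k. AE x in N. \<bar>F k x\<bar> \<le> \<bar>g x\<bar>"
  shows "f \<in> L2 N" and "L2_tendsto N F f"
proof -
  have "AE x in N. \<forall>k. \<bar>F k x\<bar> \<le> \<bar>g x\<bar>"
    using assms(5) by (simp add: AE_all_countable)
  with assms(4) have f: "AE x in N. \<bar>f x\<bar> \<le> \<bar>g x\<bar>"
  proof eventually_elim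
    case (elim x)
    then show ?case by (intro LIMSEQ_le_const2[OF tendsto_rabs[OF elim(1)]]) auto
  qed
  then show fL: "f \<in> L2 N"
    by (rule L2_bound[OF assms(1,3)])
  have "(\<lambda>k. LINT x|N. (F k x - f x)\<^sup>2) \<longlonglongrightarrow> (LINT x|N. 0)"
  proof (rule integral_dominated_convergence[where w="\<lambda>x. (2 * g x)\<^sup>2"])
    show "integrable N (\<lambda>x. (2 * g x)\<^sup>2)"
      using assms(1) by (intro L2_square_integrable L2_cmult)
    show "AE x in N. (\<lambda>k. (F k x - f x)\<^sup>2) \<longlonglongrightarrow> 0"
      using assms(4) by eventually_elim (auto intro!: tendsto_eq_intros simp: LIM_zero_iff)
    fix k
    show "AE x in N. norm ((F k x - f x)\<^sup>2) \<le> (2 * g x)\<^sup>2"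
      using assms(5)[of k] f
    proof eventually_elim
      case (elim x)
      then have "\<bar>F k x - f x\<bar> \<le> \<bar>2 * g x\<bar>" by (simp add: abs_mult)
      then show ?case by (simp add: abs_le_square_iff)
    qed
  qed (use assms in measurable)
  then show "L2_tendsto N F f" by simp
qed

text \<open>Weighting the \<open>j\<close>-th square by \<open>2 ^ j\<close> keeps the series of integrals summable; hence almost everywhere
  the weighted squares are summable, and \<open>D j\<close> is dominated by them up to a geometric series.\<close>

lemma AE_summable_of_geometric_squares:
  fixes D :: "nat \<Rightarrow> 'a \<Rightarrow> real"
  assumes D: "\<And>j. D j \<in> L2 N" and small: "\<And>j. (LINT x|N. (D j x)\<^sup>2) \<le> (1/4) ^ j"
  shows "AE x in N. summable (\<lambda>j. D j x)"
proof -
  have [measurable]: "D j \<in> borel_measurable N" for j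
    using D by (rule L2_measurable)
  have le: "(\<integral>\<^sup>+x. ennreal (2 ^ j * (D j x)\<^sup>2) \<partial>N) \<le> ennreal ((1/2) ^ j)" for j
  proof -
    have "(\<integral>\<^sup>+x. ennreal (2 ^ j * (D j x)\<^sup>2) \<partial>N) = ennreal (LINT x|N. 2 ^ j * (D j x)\<^sup>2)"
      by (rule nn_integral_eq_integral) (use L2_square_integrable[OF D] in auto)
    also have "\<dots> \<le> ennreal (2 ^ j * (1/4) ^ j)"
      using small[of j] by (intro ennreal_leI) (simp add: mult_left_mono)
    also have "(2::real) ^ j * (1/4) ^ j = (1/2) ^ j"
      by (simp flip: power_mult_distrib)
    finally show ?thesis .
  qed
  have "(\<integral>\<^sup>+x. (\<Sum>j. ennreal (2 ^ j * (D j x)\<^sup>2)) \<partial>N) = (\<Sum>j. \<integral>\<^sup>+x. ennreal (2 ^ j * (D j x)\<^sup>2) \<partial>N)"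
    by (rule nn_integral_suminf) measurable
  also have "\<dots> \<le> (\<Sum>j. ennreal ((1/2) ^ j))"
    by (intro suminf_le le) auto
  also have "\<dots> < \<infinity>"
    by (subst suminf_ennreal_eq[of _ 2]) (auto intro: geometric_sums simp: sums_iff suminf_geometric)
  finally have "AE x in N. (\<Sum>j. ennreal (2 ^ j * (D j x)\<^sup>2)) \<noteq> \<infinity>"
    by (intro nn_integral_PInf_AE) auto
  then show ?thesis
  proof eventually_elim
    case (elim x)
    then have s: "summable (\<lambda>j. 2 ^ j * (D j x)\<^sup>2)"
      by (intro summable_suminf_not_top) auto
    have "summable (\<lambda>j. (2 ^ j * (D j x)\<^sup>2 + (1/2) ^ j))"
      by (intro summable_add s summable_geometric) auto
    then show ?case
    proof (rule summable_comparison_test'[where N=0])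
      fix j :: nat
      define p where "p = (2::real) ^ j"
      have p: "p \<ge> 1" unfolding p_def by simp
      have "0 \<le> (p * \<bar>D j x\<bar> - 1)\<^sup>2" by simp
      then have "2 * (p * \<bar>D j x\<bar>) \<le> p\<^sup>2 * \<bar>D j x\<bar>\<^sup>2 + 1"
        by (simp add: power2_diff power_mult_distrib)
      moreover have "0 \<le> p * \<bar>D j x\<bar>" using p by simp
      ultimately have "p * \<bar>D j x\<bar> \<le> p\<^sup>2 * \<bar>D j x\<bar>\<^sup>2 + 1" by linarith
      then have "\<bar>D j x\<bar> \<le> p * (D j x)\<^sup>2 + 1 / p"
        using p by (simp add: field_simps power2_eq_square)
      then show "norm (D j x) \<le> 2 ^ j * (D j x)\<^sup>2 + (1/2) ^ j"
        by (simp add: p_def power_one_over)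
    qed
  qed
qed

text \<open>A fast subsequence converges almost everywhere by telescoping, and Fatou's lemma carries the Cauchy
  bounds over to the limit.\<close>

lemma L2_complete:
  fixes F :: "nat \<Rightarrow> 'a \<Rightarrow> real"
  assumes F: "\<And>k. F k \<in> L2 N"
    and Cauchy: "\<And>e. e > 0 \<Longrightarrow> \<exists>k0. \<forall>k\<ge>k0. \<forall>l\<ge>k0. (LINT x|N. (F k x - F l x)\<^sup>2) \<le> e"
  shows "\<exists>f \<in> L2 N. L2_tendsto N F f"
proof -
  have [measurable]: "F k \<in> borel_measurable N" for k
    using F by (rule L2_measurable)
  have "\<exists>k0. \<forall>j. \<forall>k\<ge>k0 j. \<forall>l\<ge>k0 j. (LINT x|N. (F k x - F l x)\<^sup>2) \<le> (1/4) ^ j"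
    by (intro choice allI Cauchy) simp
  then obtain k0 where k0: "\<And>j k l. k \<ge> k0 j \<Longrightarrow> l \<ge> k0 j \<Longrightarrow> (LINT x|N. (F k x - F l x)\<^sup>2) \<le> (1/4) ^ j"
    by blast
  define r where "r j = (\<Sum>i\<le>j. k0 i)" for j
  have r_ge: "k0 j \<le> r j" for j unfolding r_def by (rule member_le_sum) auto
  have r_mono: "r j \<le> r (Suc j)" for j unfolding r_def by simp
  define D where "D j x = F (r (Suc j)) x - F (r j) x" for j x
  have "AE x in N. summable (\<lambda>j. D j x)"
  proof (rule AE_summable_of_geometric_squares)
    show "D j \<in> L2 N" for j unfolding D_def using F by (intro L2_diff)
    show "(LINT x|N. (D j x)\<^sup>2) \<le> (1/4) ^ j" for j
      unfolding D_def by (rule k0) (use r_ge[of j] r_mono[of j] in auto)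
  qed
  then have conv: "AE x in N. convergent (\<lambda>j. F (r j) x)"
  proof eventually_elim
    case (elim x)
    then have "convergent (\<lambda>n. \<Sum>j<n. D j x)" by (simp add: summable_iff_convergent)
    also have "(\<lambda>n. \<Sum>j<n. D j x) = (\<lambda>n. F (r n) x - F (r 0) x)"
      unfolding D_def by (rule ext) (rule sum_lessThan_telescope)
    finally have "convergent (\<lambda>n. (F (r n) x - F (r 0) x) + F (r 0) x)"
      by (intro convergent_add convergent_const)
    then show ?case by simp
  qed
  define f where "f x = lim (\<lambda>j. F (r j) x)" for x
  have [measurable]: "f \<in> borel_measurable N" unfolding f_def by measurable
  have lim: "AE x in N. (\<lambda>j. F (r j) x) \<longlonglongrightarrow> f x"
    using conv by eventually_elim (simp add: f_def convergent_LIMSEQ_iff)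
  have fatou: "(\<integral>\<^sup>+x. ennreal ((F k x - f x)\<^sup>2) \<partial>N) \<le> ennreal ((1/4) ^ j)" if "k \<ge> k0 j" for j k
  proof -
    have "(\<integral>\<^sup>+x. ennreal ((F k x - f x)\<^sup>2) \<partial>N) = (\<integral>\<^sup>+x. liminf (\<lambda>i. ennreal ((F k x - F (r i) x)\<^sup>2)) \<partial>N)"
    proof (rule nn_integral_cong_AE)
      show "AE x in N. ennreal ((F k x - f x)\<^sup>2) = liminf (\<lambda>i. ennreal ((F k x - F (r i) x)\<^sup>2))"
        using lim
      proof eventually_elim
        case (elim x)
        then have "(\<lambda>i. ennreal ((F k x - F (r i) x)\<^sup>2)) \<longlonglongrightarrow> ennreal ((F k x - f x)\<^sup>2)"
          by (intro tendsto_ennrealI tendsto_intros)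
        then show ?case by (rule lim_imp_Liminf[symmetric, rotated]) simp
      qed
    qed
    also have "\<dots> \<le> liminf (\<lambda>i. \<integral>\<^sup>+x. ennreal ((F k x - F (r i) x)\<^sup>2) \<partial>N)"
      by (rule nn_integral_liminf) measurable
    also have "\<dots> \<le> ennreal ((1/4) ^ j)"
    proof (rule Liminf_le)
      have "r j \<le> r i" if "j \<le> i" for i using that r_mono by (rule lift_Suc_mono_le[rotated])
      then have ge: "r i \<ge> k0 j" if "i \<ge> j" for i using r_ge[of j] that order_trans by blast
      have "(\<integral>\<^sup>+x. ennreal ((F k x - F (r i) x)\<^sup>2) \<partial>N) \<le> ennreal ((1/4) ^ j)" if "i \<ge> j" for i
        using k0[OF \<open>k \<ge> k0 j\<close> ge[OF that]] F
        by (subst nn_integral_eq_integral) (auto intro!: ennreal_leI L2_square_integrable L2_diff)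
      then show "\<forall>\<^sub>F i in sequentially. (\<integral>\<^sup>+x. ennreal ((F k x - F (r i) x)\<^sup>2) \<partial>N) \<le> ennreal ((1/4) ^ j)"
        by (auto simp: eventually_sequentially)
    qed simp
    finally show ?thesis .
  qed
  have dL: "(\<lambda>x. F k x - f x) \<in> L2 N" if "k \<ge> k0 j" for j k
  proof (rule L2_I)
    show "integrable N (\<lambda>x. (F k x - f x)\<^sup>2)"
      using fatou[OF that] by (intro integrableI_bounded) (auto simp: le_less_trans)
  qed measurable
  have fL: "f \<in> L2 N"
    using L2_diff[OF F[of "k0 0"] dL[of 0 "k0 0"]] by simp
  have "L2_tendsto N F f"
  proof (rule LIMSEQ_I)
    fix e :: real assume "e > 0"
    then obtain j where j: "(1/4::real) ^ j < e"
      using real_arch_pow_inv[of e "1/4"] by auto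
    have "norm ((LINT x|N. (F k x - f x)\<^sup>2) - 0) < e" if "k \<ge> k0 j" for k
    proof -
      have "ennreal (LINT x|N. (F k x - f x)\<^sup>2) \<le> ennreal ((1/4) ^ j)"
        using fatou[OF that] dL[OF that]
        by (subst nn_integral_eq_integral[symmetric]) (auto intro: L2_square_integrable)
      then have "(LINT x|N. (F k x - f x)\<^sup>2) \<le> (1/4) ^ j"
        by (subst (asm) ennreal_le_iff) auto
      then show ?thesis using j by simp
    qed
    then show "\<exists>k0. \<forall>k\<ge>k0. norm ((LINT x|N. (F k x - f x)\<^sup>2) - 0) < e" by blast
  qed
  with fL show ?thesis by blast
qed

section \<open>The space $R^n$\<close>

interpretation Rn_prod: product_sigma_finite "\<lambda>_::nat. lborel :: real measure"
  by standard

lemma sigma_finite_Rn: "sigma_finite_measure (Rn n)"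
  unfolding Rn_def by (rule Rn_prod.sigma_finite) simp

lemma space_Rn: "space (Rn n) = {..<n} \<rightarrow>\<^sub>E UNIV"
  by (simp add: Rn_def space_PiM)

lemma sets_Rn [measurable_cong]: "sets (Rn n) = sets (\<Pi>\<^sub>M i\<in>{..<n}. (borel :: real measure))"
  unfolding Rn_def by (rule sets_PiM_cong) auto

lemma measurable_Rn_component [measurable]: "i < n \<Longrightarrow> (\<lambda>x. x i) \<in> borel_measurable (Rn n)"
  unfolding measurable_cong_sets[OF sets_Rn refl] by (rule measurable_component_singleton) simp

lemma measurable_Rn_restrict:
  assumes "\<And>i. i < n \<Longrightarrow> (\<lambda>x. X x i) \<in> borel_measurable N"
  shows "(\<lambda>x. \<lambda>i\<in>{..<n}. X x i) \<in> measurable N (Rn n)"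
  unfolding measurable_cong_sets[OF refl sets_Rn]
  using assms by (intro measurable_restrict) auto

lemma measurable_Rn_prod:
  assumes "\<And>i. i < n \<Longrightarrow> f i \<in> borel_measurable lborel"
  shows "(\<lambda>x. \<Prod>i<n. f i (x i) :: real) \<in> borel_measurable (Rn n)"
proof (rule borel_measurable_prod)
  fix i assume "i \<in> {..<n}"
  then show "(\<lambda>x. f i (x i)) \<in> borel_measurable (Rn n)"
    using assms[of i] by (intro measurable_compose[OF measurable_Rn_component, of i n "f i"]) auto
qed

lemma Rn_prod_integrable:
  fixes f :: "nat \<Rightarrow> real \<Rightarrow> real"
  assumes "\<And>i. i < n \<Longrightarrow> integrable lborel (f i)"
  shows "integrable (Rn n) (\<lambda>x. \<Prod>i<n. f i (x i))"
  unfolding Rn_def using assms by (intro Rn_prod.product_integrable_prod) auto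

lemma Rn_prod_integral:
  fixes f :: "nat \<Rightarrow> real \<Rightarrow> real"
  assumes "\<And>i. i < n \<Longrightarrow> integrable lborel (f i)"
  shows "(LINT x|Rn n. (\<Prod>i<n. f i (x i))) = (\<Prod>i<n. LINT u|lborel. f i u)"
  unfolding Rn_def using assms by (intro Rn_prod.product_integral_prod) auto

lemma Rn_prod_L2:
  assumes "\<And>i. i < n \<Longrightarrow> f i \<in> L2 lborel"
  shows "(\<lambda>x. \<Prod>i<n. f i (x i)) \<in> L2 (Rn n)"
proof (rule L2_I)
  show "integrable (Rn n) (\<lambda>x. (\<Prod>i<n. f i (x i))\<^sup>2)"
    using Rn_prod_integrable[of n "\<lambda>i u. (f i u)\<^sup>2"] assms by (simp add: L2_square_integrable prod_power_distrib)
qed (use assms in \<open>auto intro!: measurable_Rn_prod dest: L2_measurable\<close>)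

lemma Rn_prod_inner:
  assumes "\<And>i. i < n \<Longrightarrow> f i \<in> L2 lborel" "\<And>i. i < n \<Longrightarrow> g i \<in> L2 lborel"
  shows "(LINT x|Rn n. (\<Prod>i<n. f i (x i)) * (\<Prod>i<n. g i (x i))) = (\<Prod>i<n. LINT u|lborel. f i u * g i u)"
  unfolding prod.distrib[symmetric] using assms by (intro Rn_prod_integral L2_mult_integrable)

lemma distr_Rn_permute:
  assumes p: "\<sigma> permutes {..<n}"
  shows "distr (Rn n) (Rn n) (\<lambda>x. x \<circ> \<sigma>) = Rn n"
    and "(\<lambda>x. x \<circ> \<sigma>) \<in> measurable (Rn n) (Rn n)"
proof -
  have ext: "x \<circ> \<sigma> = (\<lambda>i\<in>{..<n}. x (\<sigma> i))" if "x \<in> space (Rn n)" for x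
    using that p by (auto simp: space_Rn fun_eq_iff restrict_def permutes_not_in PiE_def extensional_def)
  have lt: "\<sigma> i < n \<longleftrightarrow> i < n" for i
    using permutes_in_image[OF p, of i] by simp
  have "(\<lambda>x. \<lambda>i\<in>{..<n}. x (\<sigma> i)) \<in> measurable (Rn n) (Rn n)"
    by (rule measurable_Rn_restrict) (use lt in auto)
  then show m: "(\<lambda>x. x \<circ> \<sigma>) \<in> measurable (Rn n) (Rn n)"
    by (subst measurable_cong[OF ext])
  show "distr (Rn n) (Rn n) (\<lambda>x. x \<circ> \<sigma>) = Rn n"
    unfolding Rn_def
  proof (rule Rn_prod.PiM_eqI)
    fix A :: "nat \<Rightarrow> real set" assume A: "\<And>i. i \<in> {..<n} \<Longrightarrow> A i \<in> sets lborel"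
    have "emeasure (distr (Rn n) (Rn n) (\<lambda>x. x \<circ> \<sigma>)) (Pi\<^sub>E {..<n} A) =
        emeasure (Rn n) ((\<lambda>x. x \<circ> \<sigma>) -` Pi\<^sub>E {..<n} A \<inter> space (Rn n))"
    proof (rule emeasure_distr[OF m])
      show "Pi\<^sub>E {..<n} A \<in> sets (Rn n)" unfolding Rn_def using A by (intro sets_PiM_I_finite) auto
    qed
    also have "(\<lambda>x. x \<circ> \<sigma>) -` Pi\<^sub>E {..<n} A \<inter> space (Rn n) = Pi\<^sub>E {..<n} (A \<circ> inv \<sigma>)"
    proof (intro set_eqI iffI)
      fix x assume "x \<in> (\<lambda>x. x \<circ> \<sigma>) -` Pi\<^sub>E {..<n} A \<inter> space (Rn n)"
      then have x: "x \<in> extensional {..<n}" "\<And>i. i < n \<Longrightarrow> x (\<sigma> i) \<in> A i"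
        by (auto simp: space_Rn PiE_def)
      have "x i \<in> A (inv \<sigma> i)" if "i < n" for i
      proof -
        have "inv \<sigma> i < n" using permutes_in_image[OF permutes_inv[OF p], of i] that by simp
        from x(2)[OF this] show ?thesis by (simp add: permutes_inverses[OF p])
      qed
      then show "x \<in> Pi\<^sub>E {..<n} (A \<circ> inv \<sigma>)" using x(1) by (auto simp: PiE_def)
    next
      fix x assume x: "x \<in> Pi\<^sub>E {..<n} (A \<circ> inv \<sigma>)"
      have "x (\<sigma> i) \<in> A i" if "i < n" for i
        using PiE_mem[OF x, of "\<sigma> i"] lt[of i] that by (simp add: permutes_inverses[OF p])
      moreover have "x \<circ> \<sigma> \<in> extensional {..<n}"
        using x lt by (auto simp: PiE_def extensional_def)
      ultimately show "x \<in> (\<lambda>x. x \<circ> \<sigma>) -` Pi\<^sub>E {..<n} A \<inter> space (Rn n)"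
        using x by (auto simp: space_Rn PiE_def)
    qed
    also have "emeasure (Rn n) \<dots> = (\<Prod>i<n. emeasure lborel ((A \<circ> inv \<sigma>) i))"
      unfolding Rn_def
    proof (rule Rn_prod.emeasure_PiM)
      fix i assume "i \<in> {..<n}"
      then show "(A \<circ> inv \<sigma>) i \<in> sets lborel"
        using A permutes_in_image[OF permutes_inv[OF p], of i] by simp
    qed simp
    also have "\<dots> = (\<Prod>i<n. emeasure lborel (A i))"
      using prod.permute[OF permutes_inv[OF p], of "\<lambda>i. emeasure lborel (A i)"] by (simp add: o_def)
    finally show "emeasure (distr (Pi\<^sub>M {..<n} (\<lambda>i. lborel)) (Pi\<^sub>M {..<n} (\<lambda>i. lborel)) (\<lambda>x. x \<circ> \<sigma>)) (Pi\<^sub>E {..<n} A) =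
        (\<Prod>i<n. emeasure lborel (A i))"
      unfolding Rn_def .
  qed auto
qed

lemma L2_permute:
  assumes p: "\<sigma> permutes {..<n}" and f: "f \<in> L2 (Rn n)"
  shows "(\<lambda>x. f (x \<circ> \<sigma>)) \<in> L2 (Rn n)"
proof (rule L2_I)
  note m = distr_Rn_permute[OF p]
  show "(\<lambda>x. f (x \<circ> \<sigma>)) \<in> borel_measurable (Rn n)"
    using measurable_compose[OF m(2) L2_measurable[OF f]] .
  show "integrable (Rn n) (\<lambda>x. (f (x \<circ> \<sigma>))\<^sup>2)"
    using integrable_distr_eq[OF m(2), of "\<lambda>x. (f x)\<^sup>2"] L2_square_integrable[OF f] L2_measurable[OF f]
    by (simp add: m(1))
qed

lemma integral_permute:
  fixes f :: "(nat \<Rightarrow> real) \<Rightarrow> real"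
  assumes p: "\<sigma> permutes {..<n}" and f: "f \<in> borel_measurable (Rn n)"
  shows "(LINT x|Rn n. f (x \<circ> \<sigma>)) = (LINT x|Rn n. f x)"
  using integral_distr[OF distr_Rn_permute(2)[OF p] f] by (simp add: distr_Rn_permute(1)[OF p])

text \<open>When all coordinates but \<open>i\<close> are fixed, the condition \<open>x i = x j\<close> leaves a single point.\<close>

lemma AE_Rn_distinct: "AE x in Rn n. inj_on x {..<n}"
proof -
  have "AE x in Rn n. x i \<noteq> x j" if "i < n" "j < n" "i \<noteq> j" for i j
  proof -
    define J where "J = {..<n} - {i}"
    have J: "finite J" "i \<notin> J" "{..<n} = insert i J" "j \<in> J" using that by (auto simp: J_def)
    have [measurable]: "(\<lambda>x. x i) \<in> borel_measurable (Rn n)" "(\<lambda>x. x j) \<in> borel_measurable (Rn n)"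
      using that by (simp_all add: measurable_Rn_component)
    have [measurable]: "{x \<in> space (Rn n). x i = x j} \<in> sets (Rn n)"
      by (rule borel_measurable_eq) measurable
    have ind: "(indicator {x \<in> space (Rn n). x i = x j} :: _ \<Rightarrow> ennreal) \<in> borel_measurable (Rn n)"
      by (rule borel_measurable_indicator) fact
    have "(\<integral>\<^sup>+x. indicator {x \<in> space (Rn n). x i = x j} x \<partial>Rn n) =
        (\<integral>\<^sup>+x. (\<integral>\<^sup>+y. indicator {x \<in> space (Rn n). x i = x j} (x(i := y)) \<partial>lborel) \<partial>(Pi\<^sub>M J (\<lambda>_. lborel)))"
      unfolding Rn_def J(3)
    by (rule Rn_prod.product_nn_integral_insert[OF J(1,2) ind[unfolded Rn_def J(3)]])
    also have "\<dots> = (\<integral>\<^sup>+x. 0 \<partial>(Pi\<^sub>M J (\<lambda>_. lborel :: real measure)))"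
    proof (rule nn_integral_cong)
      fix x :: "nat \<Rightarrow> real"
      have "(\<integral>\<^sup>+y. indicator {x \<in> space (Rn n). x i = x j} (x(i := y)) \<partial>lborel) \<le>
          (\<integral>\<^sup>+y. indicator {x j} y \<partial>lborel)"
        using that by (intro nn_integral_mono) (auto simp: indicator_def)
      also have "\<dots> = 0" by simp
      finally show "(\<integral>\<^sup>+y. indicator {x \<in> space (Rn n). x i = x j} (x(i := y)) \<partial>lborel) = 0"
        by simp
    qed
    finally have "emeasure (Rn n) {x \<in> space (Rn n). x i = x j} = 0"
      by simp
    then have "{x \<in> space (Rn n). x i = x j} \<in> null_sets (Rn n)" by auto
    then show ?thesis by (rule AE_I') auto
  qed
  then have "AE x in Rn n. \<forall>i\<in>{..<n}. \<forall>j\<in>{..<n}. i \<noteq> j \<longrightarrow> x i \<noteq> x j"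
    by (intro AE_finite_allI) (auto simp: imp_conv_disj)
  then show ?thesis by eventually_elim (auto simp: inj_on_def)
qed

section \<open>Grids\<close>

definition is_grid :: "(nat \<Rightarrow> real) \<Rightarrow> nat \<Rightarrow> bool" where
  "is_grid t L \<longleftrightarrow> (\<forall>l<L. t l < t (Suc l))"

abbreviation grid_cell :: "(nat \<Rightarrow> real) \<Rightarrow> nat \<Rightarrow> real set" where
  "grid_cell t l \<equiv> {t l<..t (Suc l)}"

lemma grid_strict_mono:
  assumes "is_grid t L" "p < q" "q \<le> L"
  shows "t p < t q"
  using assms(2,3)
proof (induction q)
  case (Suc q)
  have "t q < t (Suc q)" using assms(1) Suc.prems by (simp add: is_grid_def)
  then show ?case using Suc by (cases "p = q") auto
qed simp

lemma grid_less_iff: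
  assumes "is_grid t L" "p \<le> L" "q \<le> L"
  shows "t p < t q \<longleftrightarrow> p < q"
  using grid_strict_mono[OF assms(1), of p q] grid_strict_mono[OF assms(1), of q p] assms(2,3)
  by (cases p q rule: linorder_cases) auto

lemma grid_mono: "is_grid t L \<Longrightarrow> p \<le> q \<Longrightarrow> q \<le> L \<Longrightarrow> t p \<le> t q"
  using grid_strict_mono[of t L p q] by (cases "p = q") auto

text \<open>The indicator of \<open>{a<..b}\<close> is the difference of the indicators of \<open>{..b}\<close> and \<open>{..a}\<close>, so the sum telescopes.\<close>

lemma grid_indicator:
  assumes "is_grid t L" "p \<le> q" "q \<le> L"
  shows "indicator {t p<..t q} x = (\<Sum>l\<in>{p..<q}. indicator (grid_cell t l) x :: real)"
proof -
  have "indicator {a<..b} x = of_bool (x \<le> b) - (of_bool (x \<le> a) :: real)" if "a \<le> b" for a b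
    using that by (auto simp: indicator_def)
  note eq = this
  have "indicator {t p<..t q} x = of_bool (x \<le> t q) - (of_bool (x \<le> t p) :: real)"
    by (rule eq, rule grid_mono) (use assms in auto)
  also have "\<dots> = (\<Sum>l\<in>{p..<q}. of_bool (x \<le> t (Suc l)) - (of_bool (x \<le> t l) :: real))"
    using assms(2) by (rule sum_Suc_diff'[symmetric])
  also have "\<dots> = (\<Sum>l\<in>{p..<q}. indicator (grid_cell t l) x)"
    by (intro sum.cong refl eq[symmetric] grid_mono[OF assms(1)]) (use assms(3) in auto)
  finally show ?thesis .
qed

text \<open>Enumerate \<open>E\<close> together with all multiples of \<open>d\<close> in a large interval: a cell longer than \<open>d\<close> would
  contain such a multiple in its interior.\<close>

lemma grid_exists:
  fixes E :: "real set"
  assumes E: "finite E" and d: "d > 0"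
  shows "\<exists>t L. is_grid t L \<and> E \<subseteq> t ` {..L} \<and> (\<forall>l<L. t (Suc l) - t l \<le> d)"
proof -
  have "\<exists>J::nat. \<forall>e\<in>E. \<bar>e\<bar> \<le> J * d"
  proof -
    obtain B where B: "\<And>e. e \<in> E \<Longrightarrow> \<bar>e\<bar> \<le> B"
      using finite_imp_bounded[OF E] by (auto simp: bounded_iff)
    obtain J :: nat where "B / d \<le> J" using real_arch_simple by blast
    then have "B \<le> J * d" using d by (simp add: field_simps)
    then have "\<bar>e\<bar> \<le> J * d" if "e \<in> E" for e using B[OF that] by linarith
    then show ?thesis by blast
  qed
  then obtain J :: nat where J: "\<And>e. e \<in> E \<Longrightarrow> \<bar>e\<bar> \<le> J * d" by blast
  define E' where "E' = E \<union> (\<lambda>i. real i * d - J * d) ` {..2 * J}"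
  define xs where "xs = sorted_list_of_set E'"
  have fin: "finite E'" using E by (simp add: E'_def)
  have set_xs: "set xs = E'" unfolding xs_def by (rule set_sorted_list_of_set[OF fin])
  have ne: "E' \<noteq> {}" by (auto simp: E'_def)
  then have len: "length xs > 0" using set_xs by auto
  have mono: "xs ! i < xs ! j" if "i < j" "j < length xs" for i j
    using sorted_wrt_nth_less[of "(<)" xs i j] that strict_sorted_list_of_set[of E'] by (simp add: xs_def)
  define t where "t l = xs ! l" for l
  define L where "L = length xs - 1"
  have "is_grid t L" unfolding is_grid_def t_def L_def using mono by auto
  moreover have "E \<subseteq> t ` {..L}"
  proof
    fix e assume "e \<in> E"
    then have "e \<in> set xs" by (simp add: set_xs E'_def)
    then obtain i where "i < length xs" "xs ! i = e" by (auto simp: in_set_conv_nth)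
    then show "e \<in> t ` {..L}" by (auto simp: t_def L_def image_iff intro!: bexI[of _ i])
  qed
  moreover have "t (Suc l) - t l \<le> d" if "l < L" for l
  proof (rule ccontr)
    assume "\<not> t (Suc l) - t l \<le> d"
    then have gap: "t l + d < t (Suc l)" by simp
    have bnd: "\<bar>e\<bar> \<le> J * d" if "e \<in> E'" for e
    proof -
      have "\<bar>real i * d - J * d\<bar> \<le> J * d" if "i \<le> 2 * J" for i
      proof -
        have "real i * d \<le> 2 * J * d" using that d by simp
        moreover have "0 \<le> real i * d" using d by simp
        ultimately show ?thesis by (simp add: abs_le_iff algebra_simps)
      qed
      then show ?thesis using \<open>e \<in> E'\<close> J by (auto simp: E'_def)
    qed
    have mem: "t l \<in> E'" "t (Suc l) \<in> E'"
      unfolding t_def set_xs[symmetric] using that by (auto simp: L_def)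
    define i where "i = nat (\<lfloor>(t l + J * d) / d\<rfloor> + 1)"
    have q0: "0 \<le> (t l + J * d) / d" using bnd[OF mem(1)] d by (simp add: abs_le_iff)
    then have fl: "0 \<le> \<lfloor>(t l + J * d) / d\<rfloor>" by simp
    have i_eq: "real i = of_int \<lfloor>(t l + J * d) / d\<rfloor> + 1"
      unfolding i_def using fl by simp
    have "(t l + J * d) / d < real i" "real i \<le> (t l + J * d) / d + 1"
      unfolding i_eq by linarith+
    then have v: "t l < real i * d - J * d" "real i * d - J * d \<le> t l + d"
      using d by (simp_all add: field_simps)
    have "real i * d < 2 * J * d"
      using v(2) gap bnd[OF mem(2)] by (simp add: abs_le_iff)
    then have "i \<le> 2 * J" using d by simp
    then have "real i * d - J * d \<in> set xs" unfolding set_xs E'_def by auto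
    then obtain k where k: "k < length xs" "t k = real i * d - J * d"
      by (auto simp: in_set_conv_nth t_def)
    have "t l < t k" "t k < t (Suc l)" using v gap k(2) by simp_all
    moreover have "is_grid t L" by fact
    ultimately have "l < k" "k < Suc l"
      using grid_less_iff[of t L l k] grid_less_iff[of t L k "Suc l"] that k(1) by (auto simp: L_def)
    then show False by simp
  qed
  ultimately show ?thesis by blast
qed

section \<open>Increments of Brownian motion\<close>

locale brownian = prob_space M for M :: "'w measure" +
  fixes W :: "real \<Rightarrow> 'w \<Rightarrow> real"
  assumes brownian: "two_sided_brownian_motion M W"
begin

lemma W_measurable [measurable]: "W t \<in> borel_measurable M"
  using brownian by (simp add: two_sided_brownian_motion_def)

definition incr :: "(nat \<Rightarrow> real) \<Rightarrow> nat \<Rightarrow> 'w \<Rightarrow> real" where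
  "incr t l \<omega> = W (t (Suc l)) \<omega> - W (t l) \<omega>"

lemma incr_measurable [measurable]: "incr t l \<in> borel_measurable M"
  unfolding incr_def[abs_def] by measurable

lemma incr_telescope: "p \<le> q \<Longrightarrow> W (t q) \<omega> - W (t p) \<omega> = (\<Sum>l\<in>{p..<q}. incr t l \<omega>)"
  unfolding incr_def by (rule sum_Suc_diff'[symmetric])

lemma incr_distributed:
  assumes "is_grid t L" "l < L"
  shows "distributed M lborel (incr t l) (\<lambda>x. ennreal (normal_density 0 (sqrt (t (Suc l) - t l)) x))"
  using brownian assms unfolding incr_def[abs_def] two_sided_brownian_motion_def is_grid_def by blast

lemma incr_indep:
  assumes "is_grid t L"
  shows "indep_vars (\<lambda>_. borel) (incr t) {..<L}"
  using brownian assms unfolding incr_def[abs_def] two_sided_brownian_motion_def is_grid_def by blast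

lemma incr_pow_integrable:
  assumes "is_grid t L" "l < L"
  shows "integrable M (\<lambda>\<omega>. incr t l \<omega> ^ k)"
proof -
  have "sqrt (t (Suc l) - t l) > 0" using assms by (simp add: is_grid_def)
  from integrable_normal_moment[OF this, of 0 k] show ?thesis
    using distributed_integrable[OF incr_distributed[OF assms], of "\<lambda>x. x ^ k"] by simp
qed

lemma incr_expectation:
  assumes "is_grid t L" "l < L"
  shows "expectation (incr t l) = 0" "expectation (\<lambda>\<omega>. (incr t l \<omega>)\<^sup>2) = t (Suc l) - t l"
proof -
  have v: "t (Suc l) - t l > 0" using assms by (simp add: is_grid_def)
  then have s: "sqrt (t (Suc l) - t l) > 0" by simp
  show "expectation (incr t l) = 0"
    using distributed_integral[OF incr_distributed[OF assms], of "\<lambda>x. x"]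
      integral_normal_moment_odd[OF s, of 0 0] by simp
  show "expectation (\<lambda>\<omega>. (incr t l \<omega>)\<^sup>2) = t (Suc l) - t l"
    using distributed_integral[OF incr_distributed[OF assms], of "\<lambda>x. x\<^sup>2"]
      integral_normal_moment_even[OF s, of 0 1] v by simp
qed

lemma incr_indep_expectation:
  fixes g :: "nat \<Rightarrow> real \<Rightarrow> real"
  assumes t: "is_grid t L" and g: "\<And>l. l < L \<Longrightarrow> g l \<in> borel_measurable borel"
    and int: "\<And>l. l < L \<Longrightarrow> integrable M (\<lambda>\<omega>. g l (incr t l \<omega>))"
  shows "expectation (\<lambda>\<omega>. \<Prod>l<L. g l (incr t l \<omega>)) = (\<Prod>l<L. expectation (\<lambda>\<omega>. g l (incr t l \<omega>)))"
    and "integrable M (\<lambda>\<omega>. \<Prod>l<L. g l (incr t l \<omega>))"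
proof -
  have "indep_vars (\<lambda>_. borel) (\<lambda>l \<omega>. g l (incr t l \<omega>)) {..<L}"
    using incr_indep[OF t] by (rule indep_vars_compose2) (use g in auto)
  from indep_vars_lebesgue_integral[OF _ this] indep_vars_integrable[OF _ this] int
  show "expectation (\<lambda>\<omega>. \<Prod>l<L. g l (incr t l \<omega>)) = (\<Prod>l<L. expectation (\<lambda>\<omega>. g l (incr t l \<omega>)))"
    and "integrable M (\<lambda>\<omega>. \<Prod>l<L. g l (incr t l \<omega>))" by auto
qed

lemma prod_eq_prod_if:
  fixes f :: "nat \<Rightarrow> 'c::comm_monoid_mult"
  assumes "P \<subseteq> {..<L}"
  shows "(\<Prod>l\<in>P. f l) = (\<Prod>l<L. if l \<in> P then f l else 1)"
proof -
  have "{..<L} \<inter> P = P" using assms by auto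
  then show ?thesis by (subst prod.inter_restrict[symmetric]) auto
qed

text \<open>An increment that occurs in only one of the two products contributes its mean zero, one that occurs in
  both contributes its variance.\<close>

lemma incr_prod_expectation:
  assumes t: "is_grid t L" and P: "P \<subseteq> {..<L}" and Q: "Q \<subseteq> {..<L}"
  shows "expectation (\<lambda>\<omega>. (\<Prod>l\<in>P. incr t l \<omega>) * (\<Prod>l\<in>Q. incr t l \<omega>)) =
      (if P = Q then \<Prod>l\<in>P. t (Suc l) - t l else 0)" (is ?E)
    and "integrable M (\<lambda>\<omega>. (\<Prod>l\<in>P. incr t l \<omega>) * (\<Prod>l\<in>Q. incr t l \<omega>))" (is ?I)
proof -
  define g :: "nat \<Rightarrow> real \<Rightarrow> real" where
    "g l = (\<lambda>x. x ^ ((if l \<in> P then 1 else 0) + (if l \<in> Q then 1 else 0)))" for l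
  have eq: "(\<Prod>l\<in>P. incr t l \<omega>) * (\<Prod>l\<in>Q. incr t l \<omega>) = (\<Prod>l<L. g l (incr t l \<omega>))" for \<omega>
    unfolding prod_eq_prod_if[OF P] prod_eq_prod_if[OF Q] prod.distrib[symmetric] g_def
    by (intro prod.cong) (auto simp: power2_eq_square)
  have int: "integrable M (\<lambda>\<omega>. g l (incr t l \<omega>))" if "l < L" for l
    unfolding g_def by (rule incr_pow_integrable[OF t that])
  have m: "g l \<in> borel_measurable borel" for l unfolding g_def by simp
  show ?I unfolding eq by (rule incr_indep_expectation(2)[OF t m int])
  have E: "expectation (\<lambda>\<omega>. g l (incr t l \<omega>)) =
      (if l \<in> P \<and> l \<in> Q then t (Suc l) - t l else if l \<in> P \<or> l \<in> Q then 0 else 1)" if "l < L" for l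
    using incr_expectation[OF t that] unfolding g_def
    by (auto simp: numeral_2_eq_2[symmetric] prob_space)
  have "expectation (\<lambda>\<omega>. (\<Prod>l\<in>P. incr t l \<omega>) * (\<Prod>l\<in>Q. incr t l \<omega>)) =
      (\<Prod>l<L. expectation (\<lambda>\<omega>. g l (incr t l \<omega>)))"
    unfolding eq by (rule incr_indep_expectation(1)[OF t m int])
  also have "\<dots> = (\<Prod>l<L. if l \<in> P \<and> l \<in> Q then t (Suc l) - t l else if l \<in> P \<or> l \<in> Q then 0 else 1)"
    by (intro prod.cong refl E) auto
  also have "\<dots> = (if P = Q then \<Prod>l\<in>P. t (Suc l) - t l else 0)"
  proof (cases "P = Q")
    case True
    then show ?thesis unfolding prod_eq_prod_if[OF P] by (auto intro!: prod.cong)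
  next
    case False
    then obtain l where "l \<in> P \<and> l \<notin> Q \<or> l \<in> Q \<and> l \<notin> P" by blast
    then show ?thesis using False P Q by (auto intro!: bexI[of _ l])
  qed
  finally show ?E .
qed

end

section \<open>Elementary functions on a grid\<close>

text \<open>Injective index functions select the cubes that do not meet a diagonal.\<close>

definition grid_inj :: "nat \<Rightarrow> nat \<Rightarrow> (nat \<Rightarrow> nat) set" where
  "grid_inj n L = {f \<in> {..<n} \<rightarrow>\<^sub>E {..<L}. inj_on f {..<n}}"

definition cube :: "(nat \<Rightarrow> real) \<Rightarrow> nat \<Rightarrow> (nat \<Rightarrow> nat) \<Rightarrow> (nat \<Rightarrow> real) \<Rightarrow> real" where
  "cube t n f x = (\<Prod>i<n. indicator (grid_cell t (f i)) (x i))"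

lemma finite_grid_inj [simp]: "finite (grid_inj n L)"
  unfolding grid_inj_def by (rule finite_subset[of _ "{..<n} \<rightarrow>\<^sub>E {..<L}"]) (auto intro: finite_PiE)

lemma elementary_fun_Cons:
  "elementary_fun n ((c, a, b) # es) x = c * (\<Prod>i<n. indicator {a i<..b i} (x i)) + elementary_fun n es x"
  by (simp add: elementary_fun_def)

lemma elementary_integral_Cons:
  "elementary_integral W n ((c, a, b) # es) \<omega> = c * (\<Prod>i<n. W (b i) \<omega> - W (a i) \<omega>) + elementary_integral W n es \<omega>"
  by (simp add: elementary_integral_def)

lemma indicator_L2:
  fixes A :: "'a set"
  assumes "A \<in> sets N" "emeasure N A < \<infinity>"
  shows "indicator A \<in> L2 N"
proof (rule L2_I)
  have "(\<lambda>x. (indicator A x :: real)\<^sup>2) = indicator A"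
    by (auto simp: fun_eq_iff indicator_def)
  then show "integrable N (\<lambda>x. (indicator A x :: real)\<^sup>2)"
    using assms by simp
qed (use assms in auto)

lemma indicator_Ioc_L2: "indicator {a<..b::real} \<in> L2 lborel"
  by (rule indicator_L2) (use emeasure_bounded_finite[of "{a<..b}"] in \<open>simp_all add: less_top\<close>)

lemma cube_L2: "cube t n f \<in> L2 (Rn n)"
  unfolding cube_def[abs_def] by (rule Rn_prod_L2) (rule indicator_Ioc_L2)

lemma elementary_fun_L2: "elementary_fun n es \<in> L2 (Rn n)"
proof (induction es)
  case Nil
  then show ?case by (simp add: elementary_fun_def[abs_def] L2_zero)
next
  case (Cons e es)
  obtain c a b where e: "e = (c, a, b)" by (cases e)
  have "(\<lambda>x. (\<Prod>i<n. indicator {a i<..b i} (x i)) :: real) \<in> L2 (Rn n)"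
    by (rule Rn_prod_L2) (rule indicator_Ioc_L2)
  from L2_add[OF L2_cmult[OF this, of c] Cons] show ?case
    unfolding e elementary_fun_Cons[abs_def] .
qed

text \<open>A box whose sides are unions of grid cells splits into cubes, and the product of the increments
  over its sides splits in the same way; disjointness of the sides makes the index functions injective.\<close>

lemma box_grid_expansion:
  assumes t: "is_grid t L"
    and ab: "\<And>i. i < n \<Longrightarrow> a i < b i" "\<And>i. i < n \<Longrightarrow> a i \<in> t ` {..L}" "\<And>i. i < n \<Longrightarrow> b i \<in> t ` {..L}"
    and disj: "\<And>i j. i < n \<Longrightarrow> j < n \<Longrightarrow> i \<noteq> j \<Longrightarrow> {a i<..b i} \<inter> {a j<..b j} = {}"
  shows "\<exists>S p q. S \<subseteq> grid_inj n L \<and>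
    (\<forall>F :: nat \<Rightarrow> nat \<Rightarrow> real. (\<Prod>i<n. \<Sum>l\<in>{p i..<q i}. F i l) = (\<Sum>f\<in>S. \<Prod>i<n. F i (f i))) \<and>
    (\<forall>i<n. a i = t (p i) \<and> b i = t (q i) \<and> p i \<le> q i \<and> q i \<le> L)"
proof -
  have "\<exists>k. k \<le> L \<and> a i = t k" if "i < n" for i using ab(2)[OF that] by auto
  then obtain p where p: "\<And>i. i < n \<Longrightarrow> p i \<le> L \<and> a i = t (p i)" by metis
  have "\<exists>k. k \<le> L \<and> b i = t k" if "i < n" for i using ab(3)[OF that] by auto
  then obtain q where q: "\<And>i. i < n \<Longrightarrow> q i \<le> L \<and> b i = t (q i)" by metis
  have pq: "p i < q i" if "i < n" for i
    using grid_less_iff[OF t, of "p i" "q i"] p[OF that] q[OF that] ab(1)[OF that] by auto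
  define S where "S = (\<Pi>\<^sub>E i\<in>{..<n}. {p i..<q i})"
  have "inj_on f {..<n}" if f: "f \<in> S" for f
  proof (rule inj_onI, rule ccontr)
    fix i j assume ij: "i \<in> {..<n}" "j \<in> {..<n}" "f i = f j" "i \<noteq> j"
    have "t (Suc (f i)) \<in> {a i<..b i}" if "i < n" for i
    proof -
      have "p i \<le> f i" "f i < q i" using f that by (auto simp: S_def PiE_def Pi_def)
      then show ?thesis using p[OF that] q[OF that]
        grid_strict_mono[OF t, of "p i" "Suc (f i)"] grid_mono[OF t, of "Suc (f i)" "q i"] by auto
    qed
    from this[of i] this[of j] disj[of i j] ij show False by auto
  qed
  moreover have "f i < L" if "f \<in> S" "i < n" for f i
  proof -
    have "f i \<in> {p i..<q i}" using that by (auto simp: S_def PiE_def Pi_def)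
    then show ?thesis using q[OF that(2)] by simp
  qed
  ultimately have sub: "S \<subseteq> grid_inj n L"
    by (auto simp: grid_inj_def S_def PiE_def)
  have exp: "(\<Prod>i<n. \<Sum>l\<in>{p i..<q i}. F i l) = (\<Sum>f\<in>S. \<Prod>i<n. F i (f i))" for F :: "nat \<Rightarrow> nat \<Rightarrow> real"
    unfolding S_def by (rule prod_sum_PiE) auto
  have "a i = t (p i) \<and> b i = t (q i) \<and> p i \<le> q i \<and> q i \<le> L" if "i < n" for i
    using p[OF that] q[OF that] pq[OF that] by simp
  then show ?thesis using sub exp
    by - (rule exI[of _ S], rule exI[of _ p], rule exI[of _ q], intro conjI allI impI, auto)
qed

definition endpoints :: "nat \<Rightarrow> elementary \<Rightarrow> real set" where
  "endpoints n es = (\<Union>(c, a, b)\<in>set es. a ` {..<n} \<union> b ` {..<n})"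

lemma finite_endpoints: "finite (endpoints n es)"
  by (auto simp: endpoints_def)

text \<open>The function and its integral have the same coefficients with respect to the cubes of the grid. This
  makes the integral a linear function of the elementary function, whatever boxes represent it.\<close>

lemma (in brownian) elementary_grid_expansion:
  assumes t: "is_grid t L" and od: "off_diagonal n es" and E: "endpoints n es \<subseteq> t ` {..L}"
  shows "\<exists>v. (\<forall>x. elementary_fun n es x = (\<Sum>f\<in>grid_inj n L. v f * cube t n f x)) \<and>
             (\<forall>\<omega>. elementary_integral W n es \<omega> = (\<Sum>f\<in>grid_inj n L. v f * (\<Prod>i<n. incr t (f i) \<omega>)))"
  using od E
proof (induction es)
  case Nil
  then show ?case
    by (intro exI[of _ "\<lambda>_. 0"]) (simp add: elementary_fun_def elementary_integral_def)
next
  case (Cons e es)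
  obtain c a b where e: "e = (c, a, b)" by (cases e)
  from Cons.prems have "off_diagonal n es" "endpoints n es \<subseteq> t ` {..L}"
    by (auto simp: off_diagonal_def endpoints_def)
  from Cons.IH[OF this] obtain v where
    v: "\<And>x. elementary_fun n es x = (\<Sum>f\<in>grid_inj n L. v f * cube t n f x)"
      "\<And>\<omega>. elementary_integral W n es \<omega> = (\<Sum>f\<in>grid_inj n L. v f * (\<Prod>i<n. incr t (f i) \<omega>))"
    by blast
  have ab: "a i < b i" "a i \<in> t ` {..L}" "b i \<in> t ` {..L}" if "i < n" for i
    using Cons.prems that by (auto simp: e off_diagonal_def endpoints_def)
  have disj: "{a i<..b i} \<inter> {a j<..b j} = {}" if "i < n" "j < n" "i \<noteq> j" for i j
    using Cons.prems that by (auto simp: e off_diagonal_def)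
  obtain S p q where S: "S \<subseteq> grid_inj n L"
    and exp': "\<forall>F :: nat \<Rightarrow> nat \<Rightarrow> real. (\<Prod>i<n. \<Sum>l\<in>{p i..<q i}. F i l) = (\<Sum>f\<in>S. \<Prod>i<n. F i (f i))"
    and pq: "\<forall>i<n. a i = t (p i) \<and> b i = t (q i) \<and> p i \<le> q i \<and> q i \<le> L"
    using box_grid_expansion[where n = n and a = a and b = b, OF t ab disj] by auto
  note exp = exp'[rule_format]
  have ext: "(\<Sum>f\<in>S. c * G f) = (\<Sum>f\<in>grid_inj n L. (if f \<in> S then c else 0) * G f)" for G :: "_ \<Rightarrow> real"
    using S by (intro sum.mono_neutral_cong_left) auto
  have 1: "(\<Prod>i<n. indicator {a i<..b i} (x i)) = (\<Sum>f\<in>S. cube t n f x)" for x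
  proof -
    have "(\<Prod>i<n. indicator {a i<..b i} (x i)) = (\<Prod>i<n. \<Sum>l\<in>{p i..<q i}. indicator (grid_cell t l) (x i) :: real)"
      using pq by (intro prod.cong) (auto simp: grid_indicator[OF t])
    then show ?thesis unfolding exp cube_def .
  qed
  have 2: "(\<Prod>i<n. W (b i) \<omega> - W (a i) \<omega>) = (\<Sum>f\<in>S. \<Prod>i<n. incr t (f i) \<omega>)" for \<omega>
  proof -
    have "(\<Prod>i<n. W (b i) \<omega> - W (a i) \<omega>) = (\<Prod>i<n. \<Sum>l\<in>{p i..<q i}. incr t l \<omega>)"
      using pq by (intro prod.cong) (auto simp: incr_telescope)
    then show ?thesis unfolding exp .
  qed
  show ?case
    unfolding e elementary_fun_Cons elementary_integral_Cons v 1 2 sum_distrib_left ext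
    by (intro exI[of _ "\<lambda>f. (if f \<in> S then c else 0) + v f"] conjI allI)
      (simp_all only: distrib_right sum.distrib)
qed

section \<open>The isometry for elementary functions\<close>

text \<open>The inner product of the symmetrisations, up to the factor \<open>fact n\<close>.\<close>

definition sym_inner :: "nat \<Rightarrow> ((nat \<Rightarrow> real) \<Rightarrow> real) \<Rightarrow> ((nat \<Rightarrow> real) \<Rightarrow> real) \<Rightarrow> real" where
  "sym_inner n f g = (\<Sum>\<sigma> | \<sigma> permutes {..<n}. LINT x|Rn n. f x * g (x \<circ> \<sigma>))"

lemma sym_inner_sum:
  assumes "finite A" "finite B" "\<And>i. i \<in> A \<Longrightarrow> f i \<in> L2 (Rn n)" "\<And>j. j \<in> B \<Longrightarrow> g j \<in> L2 (Rn n)"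
  shows "sym_inner n (\<lambda>x. \<Sum>i\<in>A. u i * f i x) (\<lambda>x. \<Sum>j\<in>B. v j * g j x) =
      (\<Sum>i\<in>A. \<Sum>j\<in>B. u i * v j * sym_inner n (f i) (g j))"
proof -
  have "(LINT x|Rn n. (\<Sum>i\<in>A. u i * f i x) * (\<Sum>j\<in>B. v j * g j (x \<circ> \<sigma>))) =
      (\<Sum>i\<in>A. \<Sum>j\<in>B. u i * v j * (LINT x|Rn n. f i x * g j (x \<circ> \<sigma>)))" if "\<sigma> permutes {..<n}" for \<sigma>
  proof -
    have int: "integrable (Rn n) (\<lambda>x. f i x * g j (x \<circ> \<sigma>))" if "i \<in> A" "j \<in> B" for i j
      using assms that \<open>\<sigma> permutes {..<n}\<close> by (intro L2_mult_integrable L2_permute)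
    have "(LINT x|Rn n. (\<Sum>i\<in>A. u i * f i x) * (\<Sum>j\<in>B. v j * g j (x \<circ> \<sigma>))) =
        (LINT x|Rn n. (\<Sum>i\<in>A. \<Sum>j\<in>B. (u i * v j) * (f i x * g j (x \<circ> \<sigma>))))"
      by (simp add: sum_product mult_ac)
    also have "\<dots> = (\<Sum>i\<in>A. LINT x|Rn n. (\<Sum>j\<in>B. (u i * v j) * (f i x * g j (x \<circ> \<sigma>))))"
      by (intro Bochner_Integration.integral_sum Bochner_Integration.integrable_sum integrable_mult_right int)
    also have "\<dots> = (\<Sum>i\<in>A. \<Sum>j\<in>B. LINT x|Rn n. (u i * v j) * (f i x * g j (x \<circ> \<sigma>)))"
      by (intro sum.cong refl Bochner_Integration.integral_sum integrable_mult_right int)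
    finally show ?thesis by simp
  qed
  then have "sym_inner n (\<lambda>x. \<Sum>i\<in>A. u i * f i x) (\<lambda>x. \<Sum>j\<in>B. v j * g j x) =
      (\<Sum>\<sigma> | \<sigma> permutes {..<n}. \<Sum>i\<in>A. \<Sum>j\<in>B. u i * v j * (LINT x|Rn n. f i x * g j (x \<circ> \<sigma>)))"
    unfolding sym_inner_def by (intro sum.cong) auto
  also have "\<dots> = (\<Sum>i\<in>A. \<Sum>\<sigma> | \<sigma> permutes {..<n}. \<Sum>j\<in>B. u i * v j * (LINT x|Rn n. f i x * g j (x \<circ> \<sigma>)))"
    by (rule sum.swap)
  also have "\<dots> = (\<Sum>i\<in>A. \<Sum>j\<in>B. \<Sum>\<sigma> | \<sigma> permutes {..<n}. u i * v j * (LINT x|Rn n. f i x * g j (x \<circ> \<sigma>)))"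
    by (intro sum.cong refl sum.swap)
  finally show ?thesis
    by (simp add: sym_inner_def sum_distrib_left)
qed

lemma grid_cell_inner:
  assumes "is_grid t L" "k < L" "l < L"
  shows "(LINT u|lborel. indicator (grid_cell t k) u * indicator (grid_cell t l) u) =
    (if k = l then t (Suc l) - t l else 0 :: real)"
proof -
  have le: "t l \<le> t (Suc l)" using assms by (simp add: is_grid_def less_imp_le)
  have "(LINT u|lborel. indicator (grid_cell t k) u * indicator (grid_cell t l) u) =
      (LINT u|lborel. (if k = l then indicator (grid_cell t l) u else 0 :: real))"
  proof (rule Bochner_Integration.integral_cong[OF refl])
    fix u
    have "\<not> (u \<in> grid_cell t k \<and> u \<in> grid_cell t l)" if "k < l" "l < L" for k l
      using grid_mono[OF assms(1), of "Suc k" l] that by auto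
    from this[of k l] this[of l k] assms(2,3)
    show "indicator (grid_cell t k) u * indicator (grid_cell t l) u =
        (if k = l then indicator (grid_cell t l) u else 0 :: real)"
      by (cases k l rule: linorder_cases) (auto simp: indicator_def)
  qed
  then show ?thesis using le by simp
qed

text \<open>A permutation contributes only if it matches the cell of each coordinate of one cube with a cell of the
  other. As the index functions are injective, exactly one permutation does so if the cubes use the
  same cells, and none otherwise.\<close>

lemma sym_inner_cube:
  assumes t: "is_grid t L" and f: "f \<in> grid_inj n L" and g: "g \<in> grid_inj n L"
  shows "sym_inner n (cube t n f) (cube t n g) =
    (if f ` {..<n} = g ` {..<n} then \<Prod>l\<in>f ` {..<n}. t (Suc l) - t l else 0)"
proof -
  have fL: "\<And>i. i < n \<Longrightarrow> f i < L" and finj: "inj_on f {..<n}"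
    using f by (auto simp: grid_inj_def)
  have gL: "\<And>i. i < n \<Longrightarrow> g i < L" and ginj: "inj_on g {..<n}"
    using g by (auto simp: grid_inj_def)
  define V where "V = (\<Prod>i<n. t (Suc (f i)) - t (f i))"
  have one: "(LINT x|Rn n. cube t n f x * cube t n g (x \<circ> inv \<tau>)) =
      (if \<forall>i<n. f i = g (\<tau> i) then V else 0)" if p: "\<tau> permutes {..<n}" for \<tau>
  proof -
    have lt: "\<tau> i < n" if "i < n" for i using permutes_in_image[OF p, of i] that by simp
    have "cube t n g (x \<circ> inv \<tau>) = (\<Prod>i<n. indicator (grid_cell t (g (\<tau> i))) (x i))" for x
      unfolding cube_def
      using prod.permute[OF p, of "\<lambda>i. indicator (grid_cell t (g i)) ((x \<circ> inv \<tau>) i) :: real"]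
      by (simp add: o_def permutes_inverses[OF p])
    then have "(LINT x|Rn n. cube t n f x * cube t n g (x \<circ> inv \<tau>)) =
        (LINT x|Rn n. (\<Prod>i<n. indicator (grid_cell t (f i)) (x i)) * (\<Prod>i<n. indicator (grid_cell t (g (\<tau> i))) (x i)))"
      by (simp add: cube_def)
    also have "\<dots> = (\<Prod>i<n. LINT u|lborel. indicator (grid_cell t (f i)) u * indicator (grid_cell t (g (\<tau> i))) u)"
      by (intro Rn_prod_inner indicator_Ioc_L2)
    also have "\<dots> = (\<Prod>i<n. if f i = g (\<tau> i) then t (Suc (f i)) - t (f i) else 0)"
      by (intro prod.cong refl) (use fL gL lt in \<open>auto simp: grid_cell_inner[OF t]\<close>)
    also have "\<dots> = (if \<forall>i<n. f i = g (\<tau> i) then V else 0)"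
      by (auto simp: V_def intro!: prod.cong)
    finally show ?thesis .
  qed
  have "sym_inner n (cube t n f) (cube t n g) =
      (\<Sum>\<tau> | \<tau> permutes {..<n}. LINT x|Rn n. cube t n f x * cube t n g (x \<circ> inv \<tau>))"
    unfolding sym_inner_def by (rule sum_permutations_inverse)
  also have "\<dots> = (\<Sum>\<tau> | \<tau> permutes {..<n}. if \<forall>i<n. f i = g (\<tau> i) then V else 0)"
    by (intro sum.cong refl one) auto
  also have "\<dots> = (if f ` {..<n} = g ` {..<n} then V else 0)"
  proof (cases "f ` {..<n} = g ` {..<n}")
    case True
    define \<tau> where "\<tau> i = (if i < n then the_inv_into {..<n} g (f i) else i)" for i
    have gt: "g (\<tau> i) = f i \<and> \<tau> i < n" if "i < n" for i
    proof -
      have "f i \<in> g ` {..<n}" using True that by auto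
      then show ?thesis using that f_the_inv_into_f[OF ginj] the_inv_into_into[OF ginj, of "f i" "{..<n}"]
        by (auto simp: \<tau>_def)
    qed
    have "inj_on \<tau> {..<n}"
      by (rule inj_onI) (metis gt finj inj_on_eq_iff lessThan_iff)
    moreover have "\<tau> ` {..<n} \<subseteq> {..<n}" using gt by auto
    ultimately have "bij_betw \<tau> {..<n} {..<n}"
      by (simp add: bij_betw_def endo_inj_surj)
    then have p: "\<tau> permutes {..<n}"
      by (rule bij_imp_permutes) (simp add: \<tau>_def)
    have uniq: "\<tau>' = \<tau>" if p': "\<tau>' permutes {..<n}" and "\<forall>i<n. f i = g (\<tau>' i)" for \<tau>'
    proof
      fix i show "\<tau>' i = \<tau> i"
      proof (cases "i < n")
        case True
        then have "\<tau>' i < n" using permutes_in_image[OF p', of i] by simp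
        then show ?thesis using True gt[OF True] that(2) ginj by (auto simp: inj_on_def)
      next
        case False
        then show ?thesis using permutes_not_in[OF p', of i] by (simp add: \<tau>_def)
      qed
    qed
    have "(\<Sum>\<tau> | \<tau> permutes {..<n}. if \<forall>i<n. f i = g (\<tau> i) then V else 0) =
        (\<Sum>\<tau>'\<in>{\<tau>}. V)"
    proof (rule sum.mono_neutral_cong_right)
      show "finite {\<tau>. \<tau> permutes {..<n}}" by (rule finite_permutations) simp
      show "\<forall>i\<in>{\<tau>. \<tau> permutes {..<n}} - {\<tau>}. (if \<forall>i'<n. f i' = g (i i') then V else 0) = 0"
        using uniq by auto
      show "(if \<forall>i<n. f i = g (x i) then V else 0) = V" if "x \<in> {\<tau>}" for x
        using that gt by auto
    qed (use p in auto)
    then show ?thesis using True by simp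
  next
    case False
    have "\<not> (\<forall>i<n. f i = g (\<tau> i))" if p: "\<tau> permutes {..<n}" for \<tau>
    proof
      assume "\<forall>i<n. f i = g (\<tau> i)"
      then have "f ` {..<n} = g ` (\<tau> ` {..<n})" by (force simp: image_iff)
      with False show False by (simp add: permutes_image[OF p])
    qed
    then have "(\<Sum>\<tau> | \<tau> permutes {..<n}. if \<forall>i<n. f i = g (\<tau> i) then V else 0) = 0"
      by (intro sum.neutral ballI if_not_P) simp
    then show ?thesis unfolding if_not_P[OF False] .
  qed
  also have "V = (\<Prod>l\<in>f ` {..<n}. t (Suc l) - t l)"
    unfolding V_def by (simp add: prod.reindex[OF finj])
  finally show ?thesis .
qed

context brownian
begin

lemma cube_integral_expectation:
  assumes t: "is_grid t L" and f: "f \<in> grid_inj n L" and g: "g \<in> grid_inj n' L"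
  shows "integrable M (\<lambda>\<omega>. (\<Prod>i<n. incr t (f i) \<omega>) * (\<Prod>i<n'. incr t (g i) \<omega>))"
    and "expectation (\<lambda>\<omega>. (\<Prod>i<n. incr t (f i) \<omega>) * (\<Prod>i<n'. incr t (g i) \<omega>)) =
      (if n = n' then sym_inner n (cube t n f) (cube t n g) else 0)"
proof -
  have fr: "(\<Prod>i<n. incr t (f i) \<omega>) = (\<Prod>l\<in>f ` {..<n}. incr t l \<omega>)" for \<omega>
    using f by (simp add: prod.reindex grid_inj_def)
  have gr: "(\<Prod>i<n'. incr t (g i) \<omega>) = (\<Prod>l\<in>g ` {..<n'}. incr t l \<omega>)" for \<omega>
    using g by (simp add: prod.reindex grid_inj_def)
  have P: "f ` {..<n} \<subseteq> {..<L}" and Q: "g ` {..<n'} \<subseteq> {..<L}"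
    using f g by (auto simp: grid_inj_def)
  show "integrable M (\<lambda>\<omega>. (\<Prod>i<n. incr t (f i) \<omega>) * (\<Prod>i<n'. incr t (g i) \<omega>))"
    unfolding fr gr by (rule incr_prod_expectation(2)[OF t P Q])
  have card: "f ` {..<n} \<noteq> g ` {..<n'}" if "n \<noteq> n'"
  proof
    assume "f ` {..<n} = g ` {..<n'}"
    moreover have "card (f ` {..<n}) = n" "card (g ` {..<n'}) = n'"
      using f g by (simp_all add: card_image grid_inj_def)
    ultimately show False using that by simp
  qed
  show "expectation (\<lambda>\<omega>. (\<Prod>i<n. incr t (f i) \<omega>) * (\<Prod>i<n'. incr t (g i) \<omega>)) =
      (if n = n' then sym_inner n (cube t n f) (cube t n g) else 0)"
  proof (cases "n = n'")
    case True
    with g have g: "g \<in> grid_inj n L" by simp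
    show ?thesis unfolding fr gr incr_prod_expectation(1)[OF t P Q] sym_inner_cube[OF t f g]
      using True by simp
  next
    case False
    show ?thesis unfolding fr gr incr_prod_expectation(1)[OF t P Q] using card[OF False] False by simp
  qed
qed

text \<open>On a common grid this reduces to cubes, where both sides compare the sets of cells; cubes of different
  dimension use sets of cells of different cardinality, hence are orthogonal.\<close>

lemma elementary_integral_isometry:
  assumes es: "off_diagonal n es" and es': "off_diagonal n' es'"
  shows "integrable M (\<lambda>\<omega>. elementary_integral W n es \<omega> * elementary_integral W n' es' \<omega>)"
    and "expectation (\<lambda>\<omega>. elementary_integral W n es \<omega> * elementary_integral W n' es' \<omega>) =
      (if n = n' then sym_inner n (elementary_fun n es) (elementary_fun n es') else 0)"
proof -
  obtain t L where t: "is_grid t L" and E: "endpoints n es \<union> endpoints n' es' \<subseteq> t ` {..L}"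
    using grid_exists[of "endpoints n es \<union> endpoints n' es'" 1] finite_endpoints by auto
  obtain u where u: "\<And>x. elementary_fun n es x = (\<Sum>f\<in>grid_inj n L. u f * cube t n f x)"
    "\<And>\<omega>. elementary_integral W n es \<omega> = (\<Sum>f\<in>grid_inj n L. u f * (\<Prod>i<n. incr t (f i) \<omega>))"
    using elementary_grid_expansion[OF t es] E by auto
  obtain v where v: "\<And>x. elementary_fun n' es' x = (\<Sum>f\<in>grid_inj n' L. v f * cube t n' f x)"
    "\<And>\<omega>. elementary_integral W n' es' \<omega> = (\<Sum>f\<in>grid_inj n' L. v f * (\<Prod>i<n'. incr t (f i) \<omega>))"
    using elementary_grid_expansion[OF t es'] E by auto
  have eq: "elementary_integral W n es \<omega> * elementary_integral W n' es' \<omega> =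
      (\<Sum>f\<in>grid_inj n L. \<Sum>g\<in>grid_inj n' L.
        (u f * v g) * ((\<Prod>i<n. incr t (f i) \<omega>) * (\<Prod>i<n'. incr t (g i) \<omega>)))" for \<omega>
    unfolding u v by (simp add: sum_product mult_ac)
  note int = cube_integral_expectation(1)[OF t]
  show "integrable M (\<lambda>\<omega>. elementary_integral W n es \<omega> * elementary_integral W n' es' \<omega>)"
    unfolding eq by (intro Bochner_Integration.integrable_sum integrable_mult_right int)
  have "expectation (\<lambda>\<omega>. elementary_integral W n es \<omega> * elementary_integral W n' es' \<omega>) =
      (\<Sum>f\<in>grid_inj n L. expectation (\<lambda>\<omega>. \<Sum>g\<in>grid_inj n' L.
        (u f * v g) * ((\<Prod>i<n. incr t (f i) \<omega>) * (\<Prod>i<n'. incr t (g i) \<omega>))))"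
    unfolding eq
    by (intro Bochner_Integration.integral_sum Bochner_Integration.integrable_sum integrable_mult_right int)
  also have "\<dots> = (\<Sum>f\<in>grid_inj n L. \<Sum>g\<in>grid_inj n' L. expectation (\<lambda>\<omega>.
        (u f * v g) * ((\<Prod>i<n. incr t (f i) \<omega>) * (\<Prod>i<n'. incr t (g i) \<omega>))))"
    by (intro sum.cong refl Bochner_Integration.integral_sum integrable_mult_right int)
  also have "\<dots> = (\<Sum>f\<in>grid_inj n L. \<Sum>g\<in>grid_inj n' L.
        (u f * v g) * (if n = n' then sym_inner n (cube t n f) (cube t n g) else 0))"
    by (intro sum.cong refl) (simp add: cube_integral_expectation(2)[OF t])
  also have "\<dots> = (if n = n' then sym_inner n (elementary_fun n es) (elementary_fun n es') else 0)"
  proof (cases "n = n'")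
    case True
    have eu: "elementary_fun n es = (\<lambda>x. \<Sum>f\<in>grid_inj n L. u f * cube t n f x)"
      by (rule ext) (rule u(1))
    have ev: "elementary_fun n es' = (\<lambda>x. \<Sum>f\<in>grid_inj n L. v f * cube t n f x)"
      by (rule ext) (simp only: True v(1))
    have "sym_inner n (elementary_fun n es) (elementary_fun n es') =
        (\<Sum>f\<in>grid_inj n L. \<Sum>g\<in>grid_inj n L. u f * v g * sym_inner n (cube t n f) (cube t n g))"
      unfolding eu ev by (intro sym_inner_sum cube_L2 finite_grid_inj)
    then show ?thesis by (simp only: True if_True refl)
  qed simp
  finally show "expectation (\<lambda>\<omega>. elementary_integral W n es \<omega> * elementary_integral W n' es' \<omega>) =
      (if n = n' then sym_inner n (elementary_fun n es) (elementary_fun n es') else 0)" .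
qed

end

section \<open>Density of the elementary functions\<close>

text \<open>Functions that are constant on the cells and vanish elsewhere. The value on a cell is read off at its
  right endpoint, which belongs to the cell.\<close>

definition grid_step :: "(nat \<Rightarrow> real) \<Rightarrow> nat \<Rightarrow> (real \<Rightarrow> real) \<Rightarrow> bool" where
  "grid_step t L h \<longleftrightarrow> (\<forall>l<L. \<forall>u\<in>grid_cell t l. h u = h (t (Suc l))) \<and>
     (\<forall>u. (\<forall>l<L. u \<notin> grid_cell t l) \<longrightarrow> h u = 0)"

lemma grid_cells_disjoint:
  assumes "is_grid t L" "k < L" "l < L" "u \<in> grid_cell t k" "u \<in> grid_cell t l"
  shows "k = l"
proof -
  have "\<not> (u \<in> grid_cell t k \<and> u \<in> grid_cell t l)" if "k < l" "l < L" for k l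
    using grid_mono[OF assms(1), of "Suc k" l] that by auto
  from this[of k l] this[of l k] assms(2-) show ?thesis by (cases k l rule: linorder_cases) auto
qed

lemma grid_step_sum:
  assumes t: "is_grid t L" and h: "grid_step t L h"
  shows "h u = (\<Sum>l<L. h (t (Suc l)) * indicator (grid_cell t l) u)"
proof (cases "\<exists>l<L. u \<in> grid_cell t l")
  case True
  then obtain l where l: "l < L" "u \<in> grid_cell t l" by blast
  have "(\<Sum>k<L. h (t (Suc k)) * indicator (grid_cell t k) u) = (\<Sum>k\<in>{l}. h (t (Suc k)) * indicator (grid_cell t k) u)"
  proof (intro sum.mono_neutral_right ballI)
    fix k assume k: "k \<in> {..<L} - {l}"
    then have "u \<notin> grid_cell t k"
      using grid_cells_disjoint[OF t _ l(1) _ l(2), of k] by blast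
    then show "h (t (Suc k)) * indicator (grid_cell t k) u = 0" by simp
  qed (use l in auto)
  also have "\<dots> = h (t (Suc l))" using l(2) by simp
  also have "\<dots> = h u" using h[unfolded grid_step_def, THEN conjunct1, rule_format, OF l] by (rule sym)
  finally show ?thesis ..
next
  case False
  then have "h u = 0" using h unfolding grid_step_def by blast
  moreover have "(\<Sum>l<L. h (t (Suc l)) * indicator (grid_cell t l) u) = 0"
    using False by (intro sum.neutral) (auto simp: indicator_def)
  ultimately show ?thesis by simp
qed

lemma grid_step_abs: "grid_step t L h \<Longrightarrow> grid_step t L (\<lambda>u. \<bar>h u\<bar>)"
  unfolding grid_step_def by (metis abs_zero)

lemma grid_step_add: "grid_step t L h \<Longrightarrow> grid_step t L g \<Longrightarrow> grid_step t L (\<lambda>u. h u + g u)"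
  unfolding grid_step_def by (metis add_0)

lemma grid_step_cmult: "grid_step t L h \<Longrightarrow> grid_step t L (\<lambda>u. c * h u)"
  unfolding grid_step_def by (metis mult_zero_right)

lemma grid_step_indicator:
  assumes t: "is_grid t L" and a: "a \<in> t ` {..L}" and b: "b \<in> t ` {..L}"
  shows "grid_step t L (indicator {a<..b})"
proof -
  obtain p q where p: "p \<le> L" "a = t p" and q: "q \<le> L" "b = t q" using a b by auto
  have "u \<in> {a<..b} \<longleftrightarrow> p \<le> l \<and> l < q" if l: "l < L" and u: "u \<in> grid_cell t l" for l u
  proof -
    have "a < u \<longleftrightarrow> p \<le> l"
      using grid_mono[OF t, of p l] grid_mono[OF t, of "Suc l" p] p l u by (cases "p \<le> l") auto
    moreover have "u \<le> b \<longleftrightarrow> l < q"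
      using grid_mono[OF t, of q l] grid_mono[OF t, of "Suc l" q] q l u by (cases "l < q") auto
    ultimately show ?thesis by simp
  qed
  note iff = this
  have "t (Suc l) \<in> grid_cell t l" if "l < L" for l using t that by (simp add: is_grid_def)
  then have 1: "indicator {a<..b} u = (indicator {a<..b} (t (Suc l)) :: real)"
    if "l < L" "u \<in> grid_cell t l" for l u
    using iff[OF that] iff[OF that(1), of "t (Suc l)"] that by (simp add: indicator_def)
  have 2: "(indicator {a<..b} u :: real) = 0" if none: "\<forall>l<L. u \<notin> grid_cell t l" for u
  proof (cases "p \<le> q")
    case True
    have "indicator {t p<..t q} u = (\<Sum>l\<in>{p..<q}. indicator (grid_cell t l) u :: real)"
      using True q by (intro grid_indicator[OF t])
    also have "\<dots> = 0" using none q by (intro sum.neutral) (auto simp: indicator_def)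
    finally show ?thesis by (simp add: p q)
  next
    case False
    then have "t q \<le> t p" using grid_mono[OF t, of q p] p by simp
    then show ?thesis by (simp add: p q indicator_def)
  qed
  show ?thesis unfolding grid_step_def using 1 2 by blast
qed

text \<open>Dropping the cubes which meet a diagonal from the grid expansion of a tensor product.\<close>

definition off_diagonal_part ::
    "(nat \<Rightarrow> real) \<Rightarrow> nat \<Rightarrow> nat \<Rightarrow> (nat \<Rightarrow> real \<Rightarrow> real) \<Rightarrow> (nat \<Rightarrow> real) \<Rightarrow> real" where
  "off_diagonal_part t L n h x =
     (\<Sum>f\<in>grid_inj n L. (\<Prod>i<n. h i (t (Suc (f i)))) * cube t n f x)"

lemma off_diagonal_part_L2: "off_diagonal_part t L n h \<in> L2 (Rn n)"
  unfolding off_diagonal_part_def[abs_def] by (intro L2_sum L2_cmult cube_L2)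

lemma tensor_grid_expansion:
  assumes t: "is_grid t L" and h: "\<And>i. i < n \<Longrightarrow> grid_step t L (h i)"
  shows "(\<Prod>i<n. h i (x i)) = (\<Sum>f\<in>{..<n} \<rightarrow>\<^sub>E {..<L}. (\<Prod>i<n. h i (t (Suc (f i)))) * cube t n f x)"
proof -
  have "(\<Prod>i<n. h i (x i)) = (\<Prod>i<n. \<Sum>l<L. h i (t (Suc l)) * indicator (grid_cell t l) (x i))"
    by (intro prod.cong refl grid_step_sum[OF t] h) simp
  also have "\<dots> = (\<Sum>f\<in>{..<n} \<rightarrow>\<^sub>E {..<L}. \<Prod>i<n. h i (t (Suc (f i))) * indicator (grid_cell t (f i)) (x i))"
    by (rule prod_sum_PiE) auto
  finally show ?thesis by (simp add: prod.distrib cube_def)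
qed

lemma off_diagonal_part_bound:
  assumes t: "is_grid t L" and h: "\<And>i. i < n \<Longrightarrow> grid_step t L (h i)"
  shows "\<bar>off_diagonal_part t L n h x\<bar> \<le> \<bar>\<Prod>i<n. h i (x i)\<bar>"
proof -
  have c: "cube t n f x \<ge> 0" for f by (simp add: cube_def prod_nonneg)
  have "\<bar>off_diagonal_part t L n h x\<bar> \<le> (\<Sum>f\<in>grid_inj n L. \<bar>(\<Prod>i<n. h i (t (Suc (f i)))) * cube t n f x\<bar>)"
    unfolding off_diagonal_part_def by (rule sum_abs)
  also have "\<dots> = (\<Sum>f\<in>grid_inj n L. (\<Prod>i<n. \<bar>h i (t (Suc (f i)))\<bar>) * cube t n f x)"
    using c by (simp add: abs_mult abs_prod)
  also have "\<dots> \<le> (\<Sum>f\<in>{..<n} \<rightarrow>\<^sub>E {..<L}. (\<Prod>i<n. \<bar>h i (t (Suc (f i)))\<bar>) * cube t n f x)"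
    using c by (intro sum_mono2 finite_PiE) (auto simp: grid_inj_def prod_nonneg)
  also have "\<dots> = (\<Prod>i<n. \<bar>h i (x i)\<bar>)"
    by (rule tensor_grid_expansion[OF t grid_step_abs[OF h], symmetric])
  finally show ?thesis by (simp add: abs_prod)
qed

lemma off_diagonal_part_eq:
  assumes t: "is_grid t L" and h: "\<And>i. i < n \<Longrightarrow> grid_step t L (h i)"
    and mesh: "\<And>l. l < L \<Longrightarrow> t (Suc l) - t l \<le> d"
    and gap: "\<And>i j. i < n \<Longrightarrow> j < n \<Longrightarrow> i \<noteq> j \<Longrightarrow> d \<le> \<bar>x i - x j\<bar>"
  shows "off_diagonal_part t L n h x = (\<Prod>i<n. h i (x i))"
proof -
  have "cube t n f x = 0" if f: "f \<in> {..<n} \<rightarrow>\<^sub>E {..<L}" "\<not> inj_on f {..<n}" for f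
  proof -
    obtain i j where ij: "i < n" "j < n" "i \<noteq> j" "f i = f j" using f(2) by (auto simp: inj_on_def)
    have "f i < L" using f(1) ij by auto
    then have "\<not> (x i \<in> grid_cell t (f i) \<and> x j \<in> grid_cell t (f j))"
      using mesh[of "f i"] gap[OF ij(1-3)] ij(4) by auto
    then obtain a where "a < n" "x a \<notin> grid_cell t (f a)" using ij by blast
    then show ?thesis unfolding cube_def by (intro prod_zero bexI[of _ a]) auto
  qed
  then have "off_diagonal_part t L n h x =
      (\<Sum>f\<in>{..<n} \<rightarrow>\<^sub>E {..<L}. (\<Prod>i<n. h i (t (Suc (f i)))) * cube t n f x)"
    unfolding off_diagonal_part_def grid_inj_def
    by (intro sum.mono_neutral_left finite_PiE) auto
  also have "\<dots> = (\<Prod>i<n. h i (x i))"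
    by (rule tensor_grid_expansion[OF t h, symmetric])
  finally show ?thesis .
qed

text \<open>At a point with distinct coordinates, a mesh below the smallest gap puts the coordinates into different
  cells, so the off-diagonal part is exact there; it is dominated by the tensor product itself.\<close>

lemma tensor_off_diagonal_limit:
  assumes h: "\<And>i. i < n \<Longrightarrow> h i \<in> L2 lborel"
    and t: "\<And>k. is_grid (t k) (L k)" and mesh: "\<And>k l. l < L k \<Longrightarrow> t k (Suc l) - t k l \<le> 1 / Suc k"
    and step: "\<And>k i. i < n \<Longrightarrow> grid_step (t k) (L k) (h i)"
  shows "L2_tendsto (Rn n) (\<lambda>k. off_diagonal_part (t k) (L k) n h) (\<lambda>x. \<Prod>i<n. h i (x i))"
proof (rule L2_dominated_convergence(2)[where g="\<lambda>x. \<Prod>i<n. h i (x i)"])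
  show L: "(\<lambda>x. \<Prod>i<n. h i (x i)) \<in> L2 (Rn n)" by (rule Rn_prod_L2[OF h])
  then show "(\<lambda>x. \<Prod>i<n. h i (x i)) \<in> borel_measurable (Rn n)" by (rule L2_measurable)
  show "off_diagonal_part (t k) (L k) n h \<in> borel_measurable (Rn n)" for k
    by (rule L2_measurable[OF off_diagonal_part_L2])
  show "AE x in Rn n. \<bar>off_diagonal_part (t k) (L k) n h x\<bar> \<le> \<bar>\<Prod>i<n. h i (x i)\<bar>" for k
    by (intro AE_I2 off_diagonal_part_bound t step)
  show "AE x in Rn n. (\<lambda>k. off_diagonal_part (t k) (L k) n h x) \<longlonglongrightarrow> (\<Prod>i<n. h i (x i))"
    using AE_Rn_distinct
  proof eventually_elim
    case (elim x)
    define D where "D = insert 1 ((\<lambda>(i, j). \<bar>x i - x j\<bar>) ` {(i, j). i < n \<and> j < n \<and> i \<noteq> j})"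
    have fin: "finite {(i, j). i < n \<and> j < n \<and> i \<noteq> j}"
      by (rule finite_subset[of _ "{..<n} \<times> {..<n}"]) auto
    then have D: "finite D" "D \<noteq> {}" by (auto simp: D_def)
    have "Min D > 0"
      using D elim by (subst Min_gr_iff) (auto simp: D_def inj_on_def)
    then obtain k0 where k0: "1 / Suc k0 < Min D"
      using nat_approx_posE by blast
    have "off_diagonal_part (t k) (L k) n h x = (\<Prod>i<n. h i (x i))" if "k \<ge> k0" for k
    proof (rule off_diagonal_part_eq[OF t step])
      show "t k (Suc l) - t k l \<le> Min D" if "l < L k" for l
      proof -
        have "1 / Suc k \<le> 1 / Suc k0" using \<open>k \<ge> k0\<close> by (simp add: frac_le)
        then show ?thesis using mesh[OF that] k0 by linarith
      qed
      show "Min D \<le> \<bar>x i - x j\<bar>" if "i < n" "j < n" "i \<noteq> j" for i j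
        using that D by (intro Min_le) (auto simp: D_def image_iff intro!: bexI[of _ "(i, j)"])
    qed
    then show ?case
      by (intro tendsto_eventually) (auto simp: eventually_sequentially)
  qed
qed

lemma off_diagonal_part_elementary:
  fixes W :: "real \<Rightarrow> 'w \<Rightarrow> real"
  assumes t: "is_grid t L"
  shows "\<exists>es. off_diagonal n es \<and> elementary_fun n es = off_diagonal_part t L n h \<and>
    elementary_integral W n es = (\<lambda>\<omega>. \<Sum>f\<in>grid_inj n L. (\<Prod>i<n. h i (t (Suc (f i)))) *
       (\<Prod>i<n. W (t (Suc (f i))) \<omega> - W (t (f i)) \<omega>))"
proof -
  obtain fs where fs: "set fs = grid_inj n L" "distinct fs"
    using finite_distinct_list[OF finite_grid_inj] by blast
  define es where "es = map (\<lambda>f. (\<Prod>i<n. h i (t (Suc (f i))), (\<lambda>i. t (f i)), (\<lambda>i. t (Suc (f i))))) fs"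
  have "off_diagonal n es"
    unfolding off_diagonal_def es_def set_map
  proof (rule ballI, erule imageE)
    fix e f assume e: "e = (\<Prod>i<n. h i (t (Suc (f i))), (\<lambda>i. t (f i)), (\<lambda>i. t (Suc (f i))))" and "f \<in> set fs"
    then have f: "\<And>i. i < n \<Longrightarrow> f i < L" "inj_on f {..<n}" using fs by (auto simp: grid_inj_def)
    have "{t (f i)<..t (Suc (f i))} \<inter> {t (f j)<..t (Suc (f j))} = {}" if "i < n" "j < n" "i \<noteq> j" for i j
      using grid_cells_disjoint[OF t f(1)[OF that(1)] f(1)[OF that(2)]] inj_onD[OF f(2), of i j] that by blast
    then show "case e of (c, a, b) \<Rightarrow> (\<forall>i<n. a i < b i) \<and>
        (\<forall>i<n. \<forall>j<n. i \<noteq> j \<longrightarrow> {a i<..b i} \<inter> {a j<..b j} = {})"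
      using f(1) t by (simp add: e is_grid_def)
  qed
  moreover have "elementary_fun n es = off_diagonal_part t L n h"
    unfolding elementary_fun_def[abs_def] off_diagonal_part_def[abs_def] es_def fs(1)[symmetric]
      sum_list_distinct_conv_sum_set[OF fs(2), symmetric]
    by (simp add: o_def cube_def)
  moreover have "elementary_integral W n es = (\<lambda>\<omega>. \<Sum>f\<in>grid_inj n L. (\<Prod>i<n. h i (t (Suc (f i)))) *
       (\<Prod>i<n. W (t (Suc (f i))) \<omega> - W (t (f i)) \<omega>))"
    unfolding elementary_integral_def[abs_def] es_def fs(1)[symmetric]
      sum_list_distinct_conv_sum_set[OF fs(2), symmetric]
    by (simp add: o_def)
  ultimately show ?thesis by (intro exI[of _ es] conjI)
qed

definition approximable :: "nat \<Rightarrow> ((nat \<Rightarrow> real) \<Rightarrow> real) \<Rightarrow> bool" where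
  "approximable n f \<longleftrightarrow> f \<in> L2 (Rn n) \<and>
     (\<exists>es. (\<forall>k. off_diagonal n (es k)) \<and> L2_tendsto (Rn n) (\<lambda>k. elementary_fun n (es k)) f)"

lemma off_diagonal_append: "off_diagonal n es \<Longrightarrow> off_diagonal n es' \<Longrightarrow> off_diagonal n (es @ es')"
  unfolding off_diagonal_def set_append by (rule ballI, erule UnE) (blast dest: bspec)+

lemma elementary_append:
  "elementary_fun n (es @ es') x = elementary_fun n es x + elementary_fun n es' x"
  "elementary_integral W n (es @ es') \<omega> = elementary_integral W n es \<omega> + elementary_integral W n es' \<omega>"
  by (simp_all add: elementary_fun_def elementary_integral_def)

definition scale_elementary :: "real \<Rightarrow> elementary \<Rightarrow> elementary" where
  "scale_elementary r = map (\<lambda>(c, a, b). (r * c, a, b))"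

lemma scale_elementary:
  "off_diagonal n es \<Longrightarrow> off_diagonal n (scale_elementary r es)"
  "elementary_fun n (scale_elementary r es) x = r * elementary_fun n es x"
  "elementary_integral W n (scale_elementary r es) \<omega> = r * elementary_integral W n es \<omega>"
proof -
  show "off_diagonal n (scale_elementary r es)" if "off_diagonal n es"
    unfolding off_diagonal_def scale_elementary_def set_map
  proof (rule ballI, erule imageE)
    fix e' e assume e: "e' = (case e of (c, a, b) \<Rightarrow> (r * c, a, b))" "e \<in> set es"
    obtain c a b where "e = (c, a, b)" by (cases e)
    then show "case e' of (c, a, b) \<Rightarrow> (\<forall>i<n. a i < b i) \<and>
        (\<forall>i<n. \<forall>j<n. i \<noteq> j \<longrightarrow> {a i<..b i} \<inter> {a j<..b j} = {})"
      using bspec[OF that[unfolded off_diagonal_def] e(2)] e(1) by (simp only: prod.case)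
  qed
qed (simp_all add: scale_elementary_def elementary_fun_def elementary_integral_def
      sum_list_const_mult[symmetric] o_def case_prod_unfold mult.assoc)

lemma approximable_zero: "approximable n (\<lambda>x. 0)"
  unfolding approximable_def
  by (intro conjI L2_zero exI[of _ "\<lambda>k. []"]) (simp_all add: off_diagonal_def elementary_fun_def)

lemma approximable_add:
  assumes "approximable n f" "approximable n g"
  shows "approximable n (\<lambda>x. f x + g x)"
proof -
  obtain es where f: "f \<in> L2 (Rn n)" "\<And>k. off_diagonal n (es k)"
    "L2_tendsto (Rn n) (\<lambda>k. elementary_fun n (es k)) f" using assms(1) by (auto simp: approximable_def)
  obtain es' where g: "g \<in> L2 (Rn n)" "\<And>k. off_diagonal n (es' k)"
    "L2_tendsto (Rn n) (\<lambda>k. elementary_fun n (es' k)) g" using assms(2) by (auto simp: approximable_def)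
  have "L2_tendsto (Rn n) (\<lambda>k. elementary_fun n (es k @ es' k)) (\<lambda>x. f x + g x)"
    unfolding elementary_append by (intro L2_tendsto_add f g elementary_fun_L2)
  moreover have "off_diagonal n (es k @ es' k)" for k
    by (intro off_diagonal_append f g)
  ultimately show ?thesis unfolding approximable_def using L2_add[OF f(1) g(1)]
    by (intro conjI exI[of _ "\<lambda>k. es k @ es' k"] allI)
qed

lemma approximable_cmult:
  assumes "approximable n f"
  shows "approximable n (\<lambda>x. c * f x)"
proof -
  obtain es where f: "f \<in> L2 (Rn n)" "\<And>k. off_diagonal n (es k)"
    "L2_tendsto (Rn n) (\<lambda>k. elementary_fun n (es k)) f" using assms by (auto simp: approximable_def)
  have "L2_tendsto (Rn n) (\<lambda>k. elementary_fun n (scale_elementary c (es k))) (\<lambda>x. c * f x)"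
    unfolding scale_elementary by (intro L2_tendsto_cmult f)
  moreover have "off_diagonal n (scale_elementary c (es k))" for k
    by (intro scale_elementary f)
  ultimately show ?thesis unfolding approximable_def using L2_cmult[OF f(1)]
    by (intro conjI exI[of _ "\<lambda>k. scale_elementary c (es k)"] allI)
qed

lemma approximable_sum:
  "(\<And>i. i \<in> A \<Longrightarrow> approximable n (f i)) \<Longrightarrow> approximable n (\<lambda>x. \<Sum>i\<in>A. f i x)"
  by (induction A rule: infinite_finite_induct) (auto intro: approximable_zero approximable_add)

text \<open>A diagonal argument: the \<open>j\<close>-th function is replaced by an elementary function at squared distance
  below \<open>1 / Suc j\<close>.\<close>

lemma approximable_limit:
  assumes F: "\<And>j. approximable n (F j)" and f: "f \<in> L2 (Rn n)" and lim: "L2_tendsto (Rn n) F f"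
  shows "approximable n f"
proof -
  have "\<exists>e. off_diagonal n e \<and> (LINT x|Rn n. (elementary_fun n e x - F j x)\<^sup>2) < 1 / Suc j" for j
  proof -
    obtain es where es: "\<And>k. off_diagonal n (es k)"
      "L2_tendsto (Rn n) (\<lambda>k. elementary_fun n (es k)) (F j)" using F[of j] by (auto simp: approximable_def)
    have "\<forall>\<^sub>F k in sequentially. (LINT x|Rn n. (elementary_fun n (es k) x - F j x)\<^sup>2) < 1 / Suc j"
      by (rule order_tendstoD(2)[OF es(2)]) simp
    then have "\<exists>k. (LINT x|Rn n. (elementary_fun n (es k) x - F j x)\<^sup>2) < 1 / Suc j"
      by (rule eventually_happens'[OF sequentially_bot])
    then obtain k where "(LINT x|Rn n. (elementary_fun n (es k) x - F j x)\<^sup>2) < 1 / Suc j" ..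
    with es(1)[of k] show ?thesis by (intro exI[of _ "es k"] conjI)
  qed
  then have "\<forall>j. \<exists>e. off_diagonal n e \<and> (LINT x|Rn n. (elementary_fun n e x - F j x)\<^sup>2) < 1 / Suc j" ..
  from choice[OF this] obtain e where
    "\<forall>j. off_diagonal n (e j) \<and> (LINT x|Rn n. (elementary_fun n (e j) x - F j x)\<^sup>2) < 1 / Suc j" ..
  then have e: "off_diagonal n (e j)" "(LINT x|Rn n. (elementary_fun n (e j) x - F j x)\<^sup>2) < 1 / Suc j" for j
    by simp_all
  have lim': "(\<lambda>j. LINT x|Rn n. (elementary_fun n (e j) x - F j x)\<^sup>2) \<longlonglongrightarrow> 0"
  proof (rule tendsto_sandwich[OF _ _ tendsto_const LIMSEQ_inverse_real_of_nat])
    show "\<forall>\<^sub>F j in sequentially. (LINT x|Rn n. (elementary_fun n (e j) x - F j x)\<^sup>2) \<le> inverse (real (Suc j))"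
      unfolding inverse_eq_divide by (intro always_eventually allI less_imp_le e(2))
    show "\<forall>\<^sub>F j in sequentially. 0 \<le> (LINT x|Rn n. (elementary_fun n (e j) x - F j x)\<^sup>2)"
      by (intro always_eventually allI Bochner_Integration.integral_nonneg zero_le_power2)
  qed
  have "L2_tendsto (Rn n) (\<lambda>k. elementary_fun n (e k)) f"
    by (rule L2_tendsto_trans[where G=F])
      (use F f lim lim' in \<open>simp_all add: elementary_fun_L2 approximable_def\<close>)
  then show ?thesis unfolding approximable_def using f e(1)
    by (intro conjI exI[of _ e] allI)
qed

lemma grid_sequence_exists:
  assumes "finite (E :: real set)"
  shows "\<exists>t L. \<forall>k. is_grid (t k) (L k) \<and> E \<subseteq> t k ` {..L k} \<and>
    (\<forall>l<L k. t k (Suc l) - t k l \<le> 1 / Suc k)"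
proof -
  define Q where "Q k t L \<longleftrightarrow> is_grid t L \<and> E \<subseteq> t ` {..L} \<and> (\<forall>l<L. t (Suc l) - t l \<le> 1 / Suc k)" for k t L
  have ex: "\<exists>t L. Q k t L" for k
    unfolding Q_def by (rule grid_exists[OF assms]) simp
  define T where "T k = (SOME t. \<exists>L. Q k t L)" for k
  define L where "L k = (SOME L. Q k (T k) L)" for k
  have "\<exists>L. Q k (T k) L" for k unfolding T_def by (rule someI_ex[OF ex])
  then have "Q k (T k) (L k)" for k unfolding L_def by (rule someI_ex)
  then have "\<forall>k. Q k (T k) (L k)" ..
  then show ?thesis unfolding Q_def by (intro exI[of _ T], intro exI[of _ L])
qed

lemma approximable_box: "approximable n (\<lambda>x. \<Prod>i<n. indicator {a i<..b i} (x i))"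
proof -
  define E where "E = a ` {..<n} \<union> b ` {..<n}"
  have "finite E" by (simp add: E_def)
  from grid_sequence_exists[OF this] obtain t L where tL: "\<forall>k. is_grid (t k) (L k) \<and> E \<subseteq> t k ` {..L k} \<and>
    (\<forall>l<L k. t k (Suc l) - t k l \<le> 1 / Suc k)" by (elim exE)
  have t: "is_grid (t k) (L k)" and E: "E \<subseteq> t k ` {..L k}"
    and mesh: "\<And>l. l < L k \<Longrightarrow> t k (Suc l) - t k l \<le> 1 / Suc k" for k
    using tL by simp_all
  have lim: "L2_tendsto (Rn n) (\<lambda>k. off_diagonal_part (t k) (L k) n (\<lambda>i. indicator {a i<..b i}))
      (\<lambda>x. \<Prod>i<n. indicator {a i<..b i} (x i))"
  proof (rule tensor_off_diagonal_limit[where h="\<lambda>i. indicator {a i<..b i}" and t=t and L=L])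
    show "indicator {a i<..b i} \<in> L2 lborel" for i by (rule indicator_Ioc_L2)
    show "is_grid (t k) (L k)" for k by (rule t)
    show "t k (Suc l) - t k l \<le> 1 / Suc k" if "l < L k" for k l by (rule mesh[OF that])
    show "grid_step (t k) (L k) (indicator {a i<..b i})" if "i < n" for k i
      by (rule grid_step_indicator[OF t]) (use E[of k] that in \<open>auto simp: E_def\<close>)
  qed
  have "approximable n (off_diagonal_part (t k) (L k) n (\<lambda>i. indicator {a i<..b i}))" for k
  proof -
    have "\<exists>es. off_diagonal n es \<and>
        elementary_fun n es = off_diagonal_part (t k) (L k) n (\<lambda>i. indicator {a i<..b i})"
      using off_diagonal_part_elementary[OF t[of k], of n "\<lambda>i. indicator {a i<..b i}" "\<lambda>_ (_::unit). 0"]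
      by (rule ex_forward) (elim conjE, intro conjI)
    then obtain es where "off_diagonal n es \<and>
        elementary_fun n es = off_diagonal_part (t k) (L k) n (\<lambda>i. indicator {a i<..b i})" ..
    then have es: "off_diagonal n es"
      "elementary_fun n es = off_diagonal_part (t k) (L k) n (\<lambda>i. indicator {a i<..b i})" by simp_all
    have "L2_tendsto (Rn n) (\<lambda>k. elementary_fun n es) (elementary_fun n es)" by simp
    then have "approximable n (elementary_fun n es)" unfolding approximable_def
      using es(1) by (intro conjI elementary_fun_L2 exI[of _ "\<lambda>_. es"] allI)
    then show ?thesis by (simp only: es(2))
  qed
  moreover have "(\<lambda>x. \<Prod>i<n. indicator {a i<..b i} (x i)) \<in> L2 (Rn n)"
    by (intro Rn_prod_L2 indicator_Ioc_L2)
  ultimately show ?thesis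
    using lim by (rule approximable_limit)
qed

abbreviation ioc_box :: "nat \<Rightarrow> (nat \<Rightarrow> real) \<Rightarrow> (nat \<Rightarrow> real) \<Rightarrow> (nat \<Rightarrow> real) set" where
  "ioc_box n a b \<equiv> (\<Pi>\<^sub>E i\<in>{..<n}. {a i<..b i})"

lemma indicator_box:
  assumes "x \<in> space (Rn n)"
  shows "indicator (ioc_box n a b) x = (\<Prod>i<n. indicator {a i<..b i} (x i) :: real)"
proof (cases "\<forall>i<n. x i \<in> {a i<..b i}")
  case True
  then show ?thesis using assms by (auto simp: space_Rn PiE_def Pi_def)
next
  case False
  then obtain i where i: "i < n" "x i \<notin> {a i<..b i}" by blast
  then have "x \<notin> ioc_box n a b" by (auto simp: PiE_def Pi_def)
  moreover have "(\<Prod>i<n. indicator {a i<..b i} (x i) :: real) = 0"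
    using i by (intro prod_zero) (auto intro!: bexI[of _ i])
  ultimately show ?thesis by simp
qed

lemma approximable_cong:
  assumes "approximable n f" "\<And>x. x \<in> space (Rn n) \<Longrightarrow> f x = g x"
  shows "approximable n g"
proof -
  have eq: "(LINT x|Rn n. (elementary_fun n e x - f x)\<^sup>2) = (LINT x|Rn n. (elementary_fun n e x - g x)\<^sup>2)" for e
    by (intro Bochner_Integration.integral_cong) (simp_all add: assms(2))
  have f: "f \<in> L2 (Rn n)" using assms(1) by (simp add: approximable_def)
  have "g \<in> borel_measurable (Rn n)"
    using L2_measurable[OF f] measurable_cong[of "Rn n" f g borel] assms(2) by simp
  then have "g \<in> L2 (Rn n)" by (rule L2_cong_AE[OF f]) (simp add: assms(2))
  then show ?thesis using assms(1) unfolding approximable_def eq by blast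
qed

lemma sets_Rn_boxes: "sets (Rn n) = sigma_sets (space (Rn n)) {ioc_box n a b | a b. True}"
proof -
  define P :: "(nat \<Rightarrow> real) set set" where "P = {{f\<in>(\<Pi>\<^sub>E i\<in>{..<n}. UNIV). \<forall>i\<in>j. f i \<in> A i} | A j.
      j \<in> {{..<n}} \<and> A \<in> Pi j (\<lambda>_. range (\<lambda>(a, b). {a<..b}))}"
  have "sets (\<Pi>\<^sub>M i\<in>{..<n}. sigma UNIV (range (\<lambda>(a, b). {a<..b::real}))) = sets (sigma (\<Pi>\<^sub>E i\<in>{..<n}. UNIV) P)"
    unfolding P_def
  proof (rule sets_PiM_sigma)
    show "\<exists>S\<subseteq>range (\<lambda>(a, b). {a<..b::real}). countable S \<and> UNIV = \<Union> S" for i :: nat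
    proof (intro exI[of _ "range (\<lambda>k::nat. {- real k<..real k})"] conjI)
      show "range (\<lambda>k::nat. {- real k<..real k}) \<subseteq> range (\<lambda>(a, b). {a<..b::real})"
        by (auto simp: image_iff split: prod.splits)
      have "\<exists>k::nat. u \<in> {- real k<..real k}" for u :: real
      proof -
        obtain k :: nat where "\<bar>u\<bar> < k" using reals_Archimedean2 by blast
        then show ?thesis by (intro exI[of _ k]) auto
      qed
      then show "(UNIV :: real set) = \<Union> (range (\<lambda>k::nat. {- real k<..real k}))" by blast
    qed simp
  qed auto
  then have "sets (Rn n) = sets (sigma (space (Rn n)) P)"
    unfolding borel_sigma_sets_Ioc[symmetric] sets_Rn[symmetric] space_Rn .
  also have "P = {ioc_box n a b | a b. True}"
  proof (intro set_eqI iffI)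
    fix X assume "X \<in> P"
    then obtain A where A: "X = {f\<in>(\<Pi>\<^sub>E i\<in>{..<n}. UNIV). \<forall>i<n. f i \<in> A i}"
      "\<And>i. i < n \<Longrightarrow> A i \<in> range (\<lambda>(a, b). {a<..b})" unfolding P_def by auto
    then have ex: "\<exists>p. A i = {fst p<..snd p}" if "i < n" for i
    proof -
      from A(2)[OF that] obtain p where "A i = (\<lambda>(a, b). {a<..b}) p" ..
      then show ?thesis by (intro exI[of _ p]) (simp add: case_prod_unfold)
    qed
    define p where "p i = (SOME p. A i = {fst p<..snd p})" for i
    have p: "A i = {fst (p i)<..snd (p i)}" if "i < n" for i
      unfolding p_def by (rule someI_ex[OF ex[OF that]])
    have "X = ioc_box n (\<lambda>i. fst (p i)) (\<lambda>i. snd (p i))"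
    proof (rule set_eqI)
      fix x show "x \<in> X \<longleftrightarrow> x \<in> ioc_box n (\<lambda>i. fst (p i)) (\<lambda>i. snd (p i))"
        unfolding A(1) by (simp add: PiE_iff p cong: conj_cong ball_cong) blast
    qed
    then show "X \<in> {ioc_box n a b | a b. True}" by (intro CollectI exI conjI TrueI)
  next
    fix X assume "X \<in> {ioc_box n a b | a b. True}"
    then obtain a b where X: "X = ioc_box n a b" by blast
    have "X = {f\<in>(\<Pi>\<^sub>E i\<in>{..<n}. UNIV). \<forall>i\<in>{..<n}. f i \<in> {a i<..b i}}"
      unfolding X by (rule set_eqI) (simp add: PiE_iff conj_commute)
    moreover have "(\<lambda>i. {a i<..b i}) \<in> {..<n} \<rightarrow> range (\<lambda>(a, b). {a<..b})"
    proof
      fix i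
      show "{a i<..b i} \<in> range (\<lambda>(a, b). {a<..b})"
        by (rule range_eqI[of _ _ "(a i, b i)"]) simp
    qed
    ultimately show "X \<in> P" unfolding P_def
      by (intro CollectI, intro exI[of _ "\<lambda>i. {a i<..b i}"], intro exI[of _ "{..<n}"]) simp
  qed
  also have "sets (sigma (space (Rn n)) {ioc_box n a b | a b. True}) =
      sigma_sets (space (Rn n)) {ioc_box n a b | a b. True}"
    by (rule sets_measure_of) (auto simp: space_Rn PiE_def)
  finally show ?thesis .
qed

abbreviation big_box :: "nat \<Rightarrow> nat \<Rightarrow> (nat \<Rightarrow> real) set" where
  "big_box n R \<equiv> ioc_box n (\<lambda>_. - real R) (\<lambda>_. real R)"

lemma box_measurable: "ioc_box n a b \<in> sets (Rn n)"
  unfolding sets_Rn_boxes by (rule sigma_sets.Basic) blast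

lemma indicator_big_box_L2:
  assumes "A \<in> sets (Rn n)"
  shows "indicator (A \<inter> big_box n R) \<in> L2 (Rn n)"
proof (rule L2_bound)
  show "(\<lambda>x. \<Prod>i<n. indicator {- real R<..real R} (x i)) \<in> L2 (Rn n)"
    by (intro Rn_prod_L2 indicator_Ioc_L2)
  show "indicator (A \<inter> big_box n R) \<in> borel_measurable (Rn n)"
    using assms box_measurable by auto
  show "AE x in Rn n. \<bar>indicator (A \<inter> big_box n R) x\<bar> \<le> \<bar>\<Prod>i<n. indicator {- real R<..real R} (x i) :: real\<bar>"
    by (intro AE_I2) (simp only: indicator_box[symmetric], simp add: indicator_def)
qed

text \<open>Dynkin's argument, with the half-open boxes as the intersection-stable generator. Intersecting with a
  bounded box keeps all indicators square-integrable, so disjoint unions pass to the limit by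
  dominated convergence.\<close>

lemma approximable_indicator:
  assumes "A \<in> sets (Rn n)"
  shows "approximable n (indicator (A \<inter> big_box n R))"
proof -
  have box: "approximable n (indicator (ioc_box n a b))" for a b
    by (rule approximable_cong[OF approximable_box indicator_box[symmetric]])
  have stable: "ioc_box n a b \<inter> ioc_box n c d = ioc_box n (\<lambda>i. max (a i) (c i)) (\<lambda>i. min (b i) (d i))" for a b c d
    unfolding PiE_Int by (rule PiE_cong) auto
  have int: "Int_stable {ioc_box n a b | a b. True}"
  proof (rule Int_stableI)
    fix X Y assume "X \<in> {ioc_box n a b | a b. True}" "Y \<in> {ioc_box n a b | a b. True}"
    then obtain a b c d where XY: "X = ioc_box n a b" "Y = ioc_box n c d" by (elim CollectE exE conjE)
    show "X \<inter> Y \<in> {ioc_box n a b | a b. True}"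
      unfolding XY stable
      by (rule CollectI, rule exI[of _ "\<lambda>i. max (a i) (c i)"], rule exI[of _ "\<lambda>i. min (b i) (d i)"]) simp
  qed
  have closed: "{ioc_box n a b | a b. True} \<subseteq> Pow (space (Rn n))"
    by (auto simp: space_Rn PiE_def)
  have mem: "A \<in> sigma_sets (space (Rn n)) {ioc_box n a b | a b. True}"
    using assms by (simp only: sets_Rn_boxes)
  from int closed mem show ?thesis
  proof (induction rule: sigma_sets_induct_disjoint)
    case (basic A)
    then obtain a b where A: "A = ioc_box n a b" by (elim CollectE exE conjE)
    show ?case unfolding A stable by (rule box)
  next
    case empty
    then show ?case using approximable_zero by simp
  next
    case (compl A)
    have "approximable n (\<lambda>x. indicator (big_box n R) x + (-1) * indicator (A \<inter> big_box n R) x)"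
      by (intro approximable_add approximable_cmult box compl)
    then show ?case by (rule approximable_cong) (auto simp: indicator_def)
  next
    case (union A)
    have A: "A j \<in> sets (Rn n)" for j using union by (auto simp: sets_Rn_boxes)
    have eq: "(\<Sum>j<k. indicator (A j \<inter> big_box n R) x) = (indicator ((\<Union>j<k. A j) \<inter> big_box n R) x :: real)" for k x
    proof (induction k)
      case (Suc k)
      have "A k \<inter> A j = {}" if "j < k" for j using union(1) that by (auto simp: disjoint_family_on_def)
      then have "(\<Union>j<k. A j) \<inter> A k = {}" by blast
      then have "indicator ((\<Union>j<k. A j) \<inter> big_box n R) x + indicator (A k \<inter> big_box n R) x =
          (indicator ((\<Union>j<Suc k. A j) \<inter> big_box n R) x :: real)"
        unfolding lessThan_Suc by (simp add: indicator_def) blast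
      then show ?case by (simp only: sum.lessThan_Suc Suc)
    qed simp
    have UA: "(\<Union>j. A j) \<in> sets (Rn n)" using A by auto
    define F :: "nat \<Rightarrow> (nat \<Rightarrow> real) \<Rightarrow> real" where
      "F k = indicator ((\<Union>j<k. A j) \<inter> big_box n R)" for k
    define f :: "(nat \<Rightarrow> real) \<Rightarrow> real" where "f = indicator ((\<Union>j. A j) \<inter> big_box n R)"
    have app: "approximable n (F k)" for k
      unfolding F_def eq[symmetric, abs_def] by (intro approximable_sum union)
    have fL: "f \<in> L2 (Rn n)" unfolding f_def by (rule indicator_big_box_L2[OF UA])
    have "L2_tendsto (Rn n) F f"
    proof (rule L2_dominated_convergence(2)[OF fL, where F=F and f=f])
      show "F k \<in> borel_measurable (Rn n)" for k
        using app[of k] by (simp add: approximable_def L2_measurable)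
      show "f \<in> borel_measurable (Rn n)" using fL by (rule L2_measurable)
      show "AE x in Rn n. (\<lambda>k. F k x) \<longlonglongrightarrow> f x"
      proof (intro AE_I2)
        fix x
        show "(\<lambda>k. F k x) \<longlonglongrightarrow> f x"
        proof (cases "\<exists>j. x \<in> A j")
          case True
          then obtain j where j: "x \<in> A j" by blast
          have "F k x = f x" if "k \<ge> Suc j" for k
          proof -
            have "j < k" using that by simp
            then show ?thesis using j by (auto simp: F_def f_def indicator_def)
          qed
          then have "\<forall>\<^sub>F k in sequentially. F k x = f x"
            unfolding eventually_sequentially by blast
          then show ?thesis by (rule tendsto_eventually)
        next
          case False
          then show ?thesis by (simp add: F_def f_def)
        qed
      qed
      show "AE x in Rn n. \<bar>F k x\<bar> \<le> \<bar>f x\<bar>" for k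
        by (intro AE_I2) (auto simp: F_def f_def indicator_def)
    qed
    then show ?case unfolding f_def[symmetric] by (rule approximable_limit[OF app fL])
  qed
qed

text \<open>Simple functions with bounded support are dense, and the indicators of their level sets have just been
  approximated; that elementary functions vanish on the diagonals does no harm, because the
  diagonals are null sets.\<close>

theorem L2_approximable:
  assumes f: "f \<in> L2 (Rn n)"
  shows "approximable n f"
proof -
  have "\<exists>s. (\<forall>k. simple_function (Rn n) (s k)) \<and> (\<forall>x\<in>space (Rn n). (\<lambda>k. s k x) \<longlonglongrightarrow> f x) \<and>
      (\<forall>k. \<forall>x\<in>space (Rn n). dist (s k x) 0 \<le> 2 * dist (f x) 0)"
    by (rule borel_measurable_implies_sequence_metric[OF L2_measurable[OF f]])
  then obtain s where
    s': "(\<forall>k. simple_function (Rn n) (s k)) \<and> (\<forall>x\<in>space (Rn n). (\<lambda>k. s k x) \<longlonglongrightarrow> f x) \<and>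
      (\<forall>k. \<forall>x\<in>space (Rn n). dist (s k x) 0 \<le> 2 * dist (f x) 0)" ..
  have s: "simple_function (Rn n) (s k)" "x \<in> space (Rn n) \<Longrightarrow> (\<lambda>k. s k x) \<longlonglongrightarrow> f x"
    "x \<in> space (Rn n) \<Longrightarrow> dist (s k x) 0 \<le> 2 * dist (f x) 0" for k x
    using s' by simp_all
  define F where "F k x = s k x * indicator (big_box n k) x" for k x
  have F: "approximable n (F k)" for k
  proof -
    have fin: "finite (s k ` space (Rn n))" using s(1) by (auto simp: simple_function_def)
    have m: "s k -` {y} \<inter> space (Rn n) \<in> sets (Rn n)" for y
      using s(1) borel_measurable_simple_function[OF s(1)] by (intro measurable_sets) auto
    have "approximable n (\<lambda>x. \<Sum>y\<in>s k ` space (Rn n).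
        y * indicator ((s k -` {y} \<inter> space (Rn n)) \<inter> big_box n k) x)"
      by (intro approximable_sum approximable_cmult approximable_indicator m)
    then show ?thesis
    proof (rule approximable_cong)
      fix x assume x: "x \<in> space (Rn n)"
      have "(\<Sum>y\<in>s k ` space (Rn n). y * indicator ((s k -` {y} \<inter> space (Rn n)) \<inter> big_box n k) x) =
          (\<Sum>y\<in>{s k x}. y * indicator ((s k -` {y} \<inter> space (Rn n)) \<inter> big_box n k) x)"
        using x by (intro sum.mono_neutral_right fin) (auto simp: indicator_def)
      then show "(\<Sum>y\<in>s k ` space (Rn n). y * indicator ((s k -` {y} \<inter> space (Rn n)) \<inter> big_box n k) x) = F k x"
        using x by (simp add: F_def indicator_def)
    qed
  qed
  have "L2_tendsto (Rn n) F f"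
  proof (rule L2_dominated_convergence(2)[where F=F and f=f, OF L2_cmult[OF f, of 2]])
    show "F k \<in> borel_measurable (Rn n)" for k using F[of k] by (simp add: approximable_def L2_measurable)
    show "AE x in Rn n. (\<lambda>k. F k x) \<longlonglongrightarrow> f x"
    proof (intro AE_I2)
      fix x assume x: "x \<in> space (Rn n)"
      obtain k0 :: nat where k0: "(\<Sum>i<n. \<bar>x i\<bar>) < k0" using reals_Archimedean2 by blast
      have "x \<in> big_box n k" if "k \<ge> k0" for k
      proof -
        have "- real k < x i \<and> x i \<le> real k" if "i < n" for i
        proof -
          have "\<bar>x i\<bar> \<le> (\<Sum>i<n. \<bar>x i\<bar>)" using that by (intro member_le_sum) auto
          moreover have "real k0 \<le> real k" using \<open>k \<ge> k0\<close> by simp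
          ultimately show ?thesis using k0 by linarith
        qed
        then show ?thesis using x by (simp add: space_Rn PiE_iff)
      qed
      then have "\<forall>\<^sub>F k in sequentially. s k x = F k x"
        unfolding eventually_sequentially by (intro exI[of _ k0]) (simp add: F_def)
      with s(2)[OF x] show "(\<lambda>k. F k x) \<longlonglongrightarrow> f x" by (rule Lim_transform_eventually)
    qed
    show "AE x in Rn n. \<bar>F k x\<bar> \<le> \<bar>2 * f x\<bar>" for k
      using s(3)[of _ k] by (intro AE_I2) (auto simp: F_def indicator_def abs_mult)
  qed (rule L2_measurable[OF f])
  then show ?thesis by (rule approximable_limit[OF F f])
qed

section \<open>The multiple integral\<close>

lemma L2_permute_norm:
  assumes "\<sigma> permutes {..<n}" "f \<in> L2 (Rn n)"
  shows "(LINT x|Rn n. (f (x \<circ> \<sigma>))\<^sup>2) = (LINT x|Rn n. (f x)\<^sup>2)"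
  by (rule integral_permute[OF assms(1), of "\<lambda>x. (f x)\<^sup>2"]) (use L2_measurable[OF assms(2)] in measurable)

text \<open>Cauchy--Schwarz for each permutation, since permuting coordinates preserves the norm.\<close>

lemma sym_inner_le:
  assumes f: "f \<in> L2 (Rn n)"
  shows "sym_inner n f f \<le> fact n * (LINT x|Rn n. (f x)\<^sup>2)"
proof -
  have "(LINT x|Rn n. f x * f (x \<circ> \<sigma>)) \<le> (LINT x|Rn n. (f x)\<^sup>2)" if p: "\<sigma> permutes {..<n}" for \<sigma>
  proof (rule power2_le_imp_le)
    show "(LINT x|Rn n. f x * f (x \<circ> \<sigma>))\<^sup>2 \<le> (LINT x|Rn n. (f x)\<^sup>2)\<^sup>2"
      using L2_Cauchy_Schwarz[OF f L2_permute[OF p f]]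
      unfolding L2_permute_norm[OF p f] by (simp add: power2_eq_square)
  qed simp
  then have "sym_inner n f f \<le> (\<Sum>\<sigma> | \<sigma> permutes {..<n}. LINT x|Rn n. (f x)\<^sup>2)"
    unfolding sym_inner_def by (intro sum_mono) simp
  also have "\<dots> = fact n * (LINT x|Rn n. (f x)\<^sup>2)"
    by (simp add: card_permutations)
  finally show ?thesis .
qed

lemma sym_inner_tendsto:
  assumes F: "\<And>k. F k \<in> L2 (Rn n)" "f \<in> L2 (Rn n)" "L2_tendsto (Rn n) F f"
    and G: "\<And>k. G k \<in> L2 (Rn n)" "g \<in> L2 (Rn n)" "L2_tendsto (Rn n) G g"
  shows "(\<lambda>k. sym_inner n (F k) (G k)) \<longlonglongrightarrow> sym_inner n f g"
  unfolding sym_inner_def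
proof (rule tendsto_sum)
  fix \<sigma> assume "\<sigma> \<in> {\<sigma>. \<sigma> permutes {..<n}}"
  then have p: "\<sigma> permutes {..<n}" by simp
  have eq: "(LINT x|Rn n. (G k (x \<circ> \<sigma>) - g (x \<circ> \<sigma>))\<^sup>2) = (LINT x|Rn n. (G k x - g x)\<^sup>2)" for k
    using L2_permute_norm[OF p L2_diff[OF G(1)[of k] G(2)]] .
  show "(\<lambda>k. LINT x|Rn n. F k x * G k (x \<circ> \<sigma>)) \<longlonglongrightarrow> (LINT x|Rn n. f x * g (x \<circ> \<sigma>))"
  proof (rule L2_inner_tendsto[OF F, where G="\<lambda>k x. G k (x \<circ> \<sigma>)" and g="\<lambda>x. g (x \<circ> \<sigma>)"])
    show "(\<lambda>x. G k (x \<circ> \<sigma>)) \<in> L2 (Rn n)" for k by (rule L2_permute[OF p G(1)])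
    show "(\<lambda>x. g (x \<circ> \<sigma>)) \<in> L2 (Rn n)" by (rule L2_permute[OF p G(2)])
    show "(\<lambda>k. LINT x|Rn n. (G k (x \<circ> \<sigma>) - g (x \<circ> \<sigma>))\<^sup>2) \<longlonglongrightarrow> 0" unfolding eq by (rule G(3))
  qed
qed

lemma sym_inner_permute_right:
  assumes p: "\<tau> permutes {..<n}"
  shows "sym_inner n f (\<lambda>x. g (x \<circ> \<tau>)) = sym_inner n f g"
proof -
  have "sym_inner n f (\<lambda>x. g (x \<circ> \<tau>)) = (\<Sum>\<sigma> | \<sigma> permutes {..<n}. LINT x|Rn n. f x * g (x \<circ> (\<sigma> \<circ> \<tau>)))"
    by (simp add: sym_inner_def comp_assoc)
  also have "\<dots> = sym_inner n f g"
    unfolding sym_inner_def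
    by (rule sum_permutations_compose_right[OF p, symmetric])
  finally show ?thesis .
qed

lemma sym_inner_permute_left:
  assumes p: "\<tau> permutes {..<n}" and f: "f \<in> L2 (Rn n)" and g: "g \<in> L2 (Rn n)"
  shows "sym_inner n (\<lambda>x. f (x \<circ> \<tau>)) g = sym_inner n f g"
proof -
  have eq: "(LINT x|Rn n. f (x \<circ> \<tau>) * g (x \<circ> (\<tau> \<circ> \<sigma>))) = (LINT x|Rn n. f x * g (x \<circ> \<sigma>))"
    if q: "\<sigma> permutes {..<n}" for \<sigma>
  proof -
    have m: "(\<lambda>x. f x * g (x \<circ> \<sigma>)) \<in> borel_measurable (Rn n)"
      by (intro borel_measurable_times L2_measurable L2_permute[OF q] f g)
    show ?thesis using integral_permute[OF p m] by (simp only: comp_assoc)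
  qed
  have "sym_inner n (\<lambda>x. f (x \<circ> \<tau>)) g =
      (\<Sum>\<sigma> | \<sigma> permutes {..<n}. LINT x|Rn n. f (x \<circ> \<tau>) * g (x \<circ> (\<tau> \<circ> \<sigma>)))"
    unfolding sym_inner_def
  proof (rule sum.reindex_bij_witness[of _ "\<lambda>\<sigma>. \<tau> \<circ> \<sigma>" "\<lambda>\<sigma>. inv \<tau> \<circ> \<sigma>"])
    fix \<sigma> :: "nat \<Rightarrow> nat"
    show "\<tau> \<circ> (inv \<tau> \<circ> \<sigma>) = \<sigma>" "inv \<tau> \<circ> (\<tau> \<circ> \<sigma>) = \<sigma>"
      by (simp_all add: comp_assoc[symmetric] permutes_inv_o[OF p])
    show "(LINT x|Rn n. f (x \<circ> \<tau>) * g (x \<circ> (\<tau> \<circ> (inv \<tau> \<circ> \<sigma>)))) = (LINT x|Rn n. f (x \<circ> \<tau>) * g (x \<circ> \<sigma>))"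
      by (simp add: comp_assoc[symmetric] permutes_inv_o[OF p])
  qed (auto intro: permutes_compose permutes_inv p)
  also have "\<dots> = sym_inner n f g"
    unfolding sym_inner_def by (intro sum.cong refl eq) simp
  finally show ?thesis .
qed

context brownian
begin

abbreviation is_integral :: "nat \<Rightarrow> ((nat \<Rightarrow> real) \<Rightarrow> real) \<Rightarrow> ('w \<Rightarrow> real) \<Rightarrow> bool" where
  "is_integral \<equiv> is_multiple_integral M W"

abbreviation elem :: "nat \<Rightarrow> elementary \<Rightarrow> 'w \<Rightarrow> real" where
  "elem \<equiv> elementary_integral W"

lemma elem_measurable: "elem n es \<in> borel_measurable M"
proof (induction es)
  case Nil
  then show ?case by (simp add: elementary_integral_def[abs_def])
next
  case (Cons e es)
  obtain c a b where e: "e = (c, a, b)" by (cases e)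
  show ?case unfolding e elementary_integral_Cons[abs_def]
    by (intro borel_measurable_add borel_measurable_times borel_measurable_const borel_measurable_prod
        borel_measurable_diff W_measurable Cons)
qed

lemma elem_L2:
  assumes "off_diagonal n es"
  shows "elem n es \<in> L2 M"
  by (rule L2_I[OF elem_measurable])
    (use elementary_integral_isometry(1)[OF assms assms] in \<open>simp add: power2_eq_square\<close>)

lemma elem_diff_le:
  assumes "off_diagonal n es" "off_diagonal n es'"
  shows "(LINT \<omega>|M. (elem n es \<omega> - elem n es' \<omega>)\<^sup>2) \<le>
    fact n * (LINT x|Rn n. (elementary_fun n es x - elementary_fun n es' x)\<^sup>2)"
proof -
  define d where "d = es @ scale_elementary (- 1) es'"
  have od: "off_diagonal n d"
    unfolding d_def by (intro off_diagonal_append scale_elementary assms)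
  have f: "elementary_fun n d x = elementary_fun n es x - elementary_fun n es' x" for x
    by (simp add: d_def elementary_append scale_elementary)
  have I: "elem n d \<omega> = elem n es \<omega> - elem n es' \<omega>" for \<omega>
    by (simp add: d_def elementary_append scale_elementary)
  have "(LINT \<omega>|M. (elem n d \<omega>)\<^sup>2) = sym_inner n (elementary_fun n d) (elementary_fun n d)"
    using elementary_integral_isometry(2)[OF od od] by (simp add: power2_eq_square)
  also have "\<dots> \<le> fact n * (LINT x|Rn n. (elementary_fun n d x)\<^sup>2)"
    by (rule sym_inner_le[OF elementary_fun_L2])
  finally show ?thesis by (simp only: f I)
qed

text \<open>By the isometry the integrals of an approximating sequence form a Cauchy sequence.\<close>

lemma is_integral_exists:
  assumes f: "f \<in> L2 (Rn n)"
  shows "\<exists>Z. is_integral n f Z"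
proof -
  have "\<exists>es. (\<forall>k. off_diagonal n (es k)) \<and> L2_tendsto (Rn n) (\<lambda>k. elementary_fun n (es k)) f"
    using L2_approximable[OF f] by (simp add: approximable_def)
  then obtain es where "(\<forall>k. off_diagonal n (es k)) \<and> L2_tendsto (Rn n) (\<lambda>k. elementary_fun n (es k)) f" ..
  then have od: "\<And>k. off_diagonal n (es k)" and lim: "L2_tendsto (Rn n) (\<lambda>k. elementary_fun n (es k)) f"
    by simp_all
  define D where "D k = (LINT x|Rn n. (elementary_fun n (es k) x - f x)\<^sup>2)" for k
  have Dlim: "D \<longlonglongrightarrow> 0" unfolding D_def by (rule lim)
  have le: "(LINT \<omega>|M. (elem n (es k) \<omega> - elem n (es l) \<omega>)\<^sup>2) \<le> fact n * (2 * D k + 2 * D l)" for k l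
  proof -
    have "(LINT x|Rn n. (elementary_fun n (es k) x - elementary_fun n (es l) x)\<^sup>2) \<le>
        2 * D k + 2 * (LINT x|Rn n. (f x - elementary_fun n (es l) x)\<^sup>2)"
      unfolding D_def by (rule L2_dist_triangle[OF elementary_fun_L2 f elementary_fun_L2])
    also have "(LINT x|Rn n. (f x - elementary_fun n (es l) x)\<^sup>2) = D l"
      unfolding D_def by (simp only: power2_commute[of "f _"])
    finally show ?thesis
      using elem_diff_le[OF od od, of k l] mult_left_mono[of _ _ "fact n :: real"] order_trans
      by (meson fact_ge_zero)
  qed
  have "\<exists>Z\<in>L2 M. L2_tendsto M (\<lambda>k. elem n (es k)) Z"
  proof (rule L2_complete[OF elem_L2[OF od]])
    fix e :: real assume "e > 0"
    then have pos: "e / (4 * fact n) > 0" by simp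
    obtain k0 where k0: "\<And>k. k \<ge> k0 \<Longrightarrow> D k < e / (4 * fact n)"
      using order_tendstoD(2)[OF Dlim pos] by (auto simp: eventually_sequentially)
    have "(LINT \<omega>|M. (elem n (es k) \<omega> - elem n (es l) \<omega>)\<^sup>2) \<le> e" if "k \<ge> k0" "l \<ge> k0" for k l
    proof -
      have "2 * D k + 2 * D l \<le> e / fact n"
        using k0[OF that(1)] k0[OF that(2)] by (simp add: field_simps)
      then have "fact n * (2 * D k + 2 * D l) \<le> fact n * (e / fact n)" by (rule mult_left_mono) simp
      then show ?thesis using le[of k l] by simp
    qed
    then show "\<exists>k0. \<forall>k\<ge>k0. \<forall>l\<ge>k0. (LINT \<omega>|M. (elem n (es k) \<omega> - elem n (es l) \<omega>)\<^sup>2) \<le> e"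
      by (intro exI[of _ k0]) simp
  qed
  then obtain Z where Z: "Z \<in> L2 M" and "L2_tendsto M (\<lambda>k. elem n (es k)) Z" ..
  with f od lim have "is_integral n f Z"
    unfolding is_multiple_integral_def by (intro conjI exI[of _ es] allI)
  then show ?thesis by (intro exI[of _ Z])
qed

lemma is_integral_approx:
  "is_integral n f Z \<Longrightarrow> \<exists>es. (\<forall>k. off_diagonal n (es k)) \<and>
    L2_tendsto (Rn n) (\<lambda>k. elementary_fun n (es k)) f \<and> L2_tendsto M (\<lambda>k. elem n (es k)) Z"
  unfolding is_multiple_integral_def by (elim conjE)

lemma is_integral_L2: "is_integral n f Z \<Longrightarrow> f \<in> L2 (Rn n)" "is_integral n f Z \<Longrightarrow> Z \<in> L2 M"
  by (simp_all add: is_multiple_integral_def)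

lemma is_integral_elem: "off_diagonal n es \<Longrightarrow> is_integral n (elementary_fun n es) (elem n es)"
  unfolding is_multiple_integral_def
  by (intro conjI elementary_fun_L2 elem_L2 exI[of _ "\<lambda>_. es"] allI) simp_all

lemma is_integral_isometry:
  assumes Z: "is_integral n f Z" and Z': "is_integral n' g Z'"
  shows "expectation (\<lambda>\<omega>. Z \<omega> * Z' \<omega>) = (if n = n' then sym_inner n f g else 0)"
proof -
  obtain es where es: "(\<forall>k. off_diagonal n (es k)) \<and>
      L2_tendsto (Rn n) (\<lambda>k. elementary_fun n (es k)) f \<and> L2_tendsto M (\<lambda>k. elem n (es k)) Z"
    using is_integral_approx[OF Z] ..
  note f = is_integral_L2[OF Z] es[THEN conjunct1, rule_format] es[THEN conjunct2, THEN conjunct1]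
    es[THEN conjunct2, THEN conjunct2]
  obtain es' where es': "(\<forall>k. off_diagonal n' (es' k)) \<and>
      L2_tendsto (Rn n') (\<lambda>k. elementary_fun n' (es' k)) g \<and> L2_tendsto M (\<lambda>k. elem n' (es' k)) Z'"
    using is_integral_approx[OF Z'] ..
  note g = is_integral_L2[OF Z'] es'[THEN conjunct1, rule_format] es'[THEN conjunct2, THEN conjunct1]
    es'[THEN conjunct2, THEN conjunct2]
  have 1: "(\<lambda>k. expectation (\<lambda>\<omega>. elem n (es k) \<omega> * elem n' (es' k) \<omega>)) \<longlonglongrightarrow> expectation (\<lambda>\<omega>. Z \<omega> * Z' \<omega>)"
    by (rule L2_inner_tendsto[OF elem_L2[OF f(3)] f(2,5) elem_L2[OF g(3)] g(2,5)])
  have 2: "(\<lambda>k. expectation (\<lambda>\<omega>. elem n (es k) \<omega> * elem n' (es' k) \<omega>)) \<longlonglongrightarrow> (if n = n' then sym_inner n f g else 0)"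
  proof (cases "n = n'")
    case True
    note g' = g[folded True]
    have "(\<lambda>k. sym_inner n (elementary_fun n (es k)) (elementary_fun n (es' k))) \<longlonglongrightarrow> sym_inner n f g"
      by (rule sym_inner_tendsto[OF elementary_fun_L2 f(1,4) elementary_fun_L2 g'(1,4)])
    then show ?thesis
      using elementary_integral_isometry(2)[OF f(3) g(3)] True by simp
  next
    case False
    then show ?thesis using elementary_integral_isometry(2)[OF f(3) g(3)] by simp
  qed
  show ?thesis by (rule LIMSEQ_unique[OF 1 2])
qed

lemma is_integral_cmult:
  assumes "is_integral n f Z"
  shows "is_integral n (\<lambda>x. c * f x) (\<lambda>\<omega>. c * Z \<omega>)"
proof -
  obtain es where es: "(\<forall>k. off_diagonal n (es k)) \<and>
      L2_tendsto (Rn n) (\<lambda>k. elementary_fun n (es k)) f \<and> L2_tendsto M (\<lambda>k. elem n (es k)) Z"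
    using is_integral_approx[OF assms] ..
  note f = is_integral_L2[OF assms] es[THEN conjunct1, rule_format] es[THEN conjunct2, THEN conjunct1]
    es[THEN conjunct2, THEN conjunct2]
  have "L2_tendsto (Rn n) (\<lambda>k. elementary_fun n (scale_elementary c (es k))) (\<lambda>x. c * f x)"
    unfolding scale_elementary by (rule L2_tendsto_cmult[OF f(4)])
  moreover have "L2_tendsto M (\<lambda>k. elem n (scale_elementary c (es k))) (\<lambda>\<omega>. c * Z \<omega>)"
    unfolding scale_elementary by (rule L2_tendsto_cmult[OF f(5)])
  moreover have "off_diagonal n (scale_elementary c (es k))" for k
    by (rule scale_elementary(1)[OF f(3)])
  ultimately show ?thesis
    unfolding is_multiple_integral_def
    by (intro conjI L2_cmult f(1,2) exI[of _ "\<lambda>k. scale_elementary c (es k)"] allI)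
qed

lemma is_integral_add:
  assumes "is_integral n f Z" "is_integral n g Z'"
  shows "is_integral n (\<lambda>x. f x + g x) (\<lambda>\<omega>. Z \<omega> + Z' \<omega>)"
proof -
  obtain es where es: "(\<forall>k. off_diagonal n (es k)) \<and>
      L2_tendsto (Rn n) (\<lambda>k. elementary_fun n (es k)) f \<and> L2_tendsto M (\<lambda>k. elem n (es k)) Z"
    using is_integral_approx[OF assms(1)] ..
  note f = is_integral_L2[OF assms(1)] es[THEN conjunct1, rule_format] es[THEN conjunct2, THEN conjunct1]
    es[THEN conjunct2, THEN conjunct2]
  obtain es' where es': "(\<forall>k. off_diagonal n (es' k)) \<and>
      L2_tendsto (Rn n) (\<lambda>k. elementary_fun n (es' k)) g \<and> L2_tendsto M (\<lambda>k. elem n (es' k)) Z'"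
    using is_integral_approx[OF assms(2)] ..
  note g = is_integral_L2[OF assms(2)] es'[THEN conjunct1, rule_format] es'[THEN conjunct2, THEN conjunct1]
    es'[THEN conjunct2, THEN conjunct2]
  have "L2_tendsto (Rn n) (\<lambda>k. elementary_fun n (es k @ es' k)) (\<lambda>x. f x + g x)"
    unfolding elementary_append
    by (rule L2_tendsto_add[OF elementary_fun_L2 f(1,4) elementary_fun_L2 g(1,4)])
  moreover have "L2_tendsto M (\<lambda>k. elem n (es k @ es' k)) (\<lambda>\<omega>. Z \<omega> + Z' \<omega>)"
    unfolding elementary_append
    by (rule L2_tendsto_add[OF elem_L2[OF f(3)] f(2,5) elem_L2[OF g(3)] g(2,5)])
  moreover have "off_diagonal n (es k @ es' k)" for k
    by (rule off_diagonal_append[OF f(3) g(3)])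
  ultimately show ?thesis
    unfolding is_multiple_integral_def
    by (intro conjI L2_add f(1,2) g(1,2) exI[of _ "\<lambda>k. es k @ es' k"] allI)
qed

lemma is_integral_zero: "is_integral n (\<lambda>x. 0) (\<lambda>\<omega>. 0)"
proof -
  have "off_diagonal n []" by (simp add: off_diagonal_def)
  from is_integral_elem[OF this] show ?thesis
    by (simp add: elementary_fun_def[abs_def] elementary_integral_def[abs_def])
qed

lemma is_integral_sum:
  "(\<And>i. i \<in> A \<Longrightarrow> is_integral n (f i) (Z i)) \<Longrightarrow>
    is_integral n (\<lambda>x. \<Sum>i\<in>A. f i x) (\<lambda>\<omega>. \<Sum>i\<in>A. Z i \<omega>)"
  by (induction A rule: infinite_finite_induct) (simp_all add: is_integral_zero is_integral_add)

lemma is_integral_diff: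
  assumes "is_integral n f Z" "is_integral n g Z'"
  shows "is_integral n (\<lambda>x. f x - g x) (\<lambda>\<omega>. Z \<omega> - Z' \<omega>)"
  using is_integral_add[OF assms(1) is_integral_cmult[OF assms(2), of "- 1"]] by simp

lemma is_integral_norm_le:
  assumes "is_integral n f Z"
  shows "expectation (\<lambda>\<omega>. (Z \<omega>)\<^sup>2) \<le> fact n * (LINT x|Rn n. (f x)\<^sup>2)"
  using is_integral_isometry[OF assms assms] sym_inner_le[OF is_integral_L2(1)[OF assms]]
  by (simp add: power2_eq_square)

lemma is_integral_unique_AE:
  assumes Z: "is_integral n f Z" and Z': "is_integral n g Z'" and eq: "AE x in Rn n. f x = g x"
  shows "AE \<omega> in M. Z \<omega> = Z' \<omega>"
proof -
  note d = is_integral_diff[OF Z Z']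
  have "(LINT x|Rn n. (f x - g x)\<^sup>2) = (LINT x|Rn n. 0)"
  proof (rule integral_cong_AE)
    show "(\<lambda>x. (f x - g x)\<^sup>2) \<in> borel_measurable (Rn n)"
      using L2_measurable[OF is_integral_L2(1)[OF d]] by measurable
    show "AE x in Rn n. (f x - g x)\<^sup>2 = 0" using eq by eventually_elim simp
  qed simp
  then have "expectation (\<lambda>\<omega>. (Z \<omega> - Z' \<omega>)\<^sup>2) \<le> 0"
    using is_integral_norm_le[OF d] by simp
  then have "expectation (\<lambda>\<omega>. (Z \<omega> - Z' \<omega>)\<^sup>2) = 0"
    by (intro antisym) simp_all
  then have "AE \<omega> in M. Z \<omega> - Z' \<omega> = 0"
    by (rule L2_zero_AE[OF is_integral_L2(2)[OF d]])
  then show ?thesis by eventually_elim simp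
qed

lemma is_integral_unique:
  "is_integral n f Z \<Longrightarrow> is_integral n f Z' \<Longrightarrow> AE \<omega> in M. Z \<omega> = Z' \<omega>"
  by (rule is_integral_unique_AE[OF _ _ AE_I2[OF refl]])

lemma is_integral_cong_AE:
  assumes "is_integral n f Z" "g \<in> borel_measurable (Rn n)" "AE x in Rn n. f x = g x"
    and "Z' \<in> borel_measurable M" "AE \<omega> in M. Z \<omega> = Z' \<omega>"
  shows "is_integral n g Z'"
proof -
  obtain es where es: "(\<forall>k. off_diagonal n (es k)) \<and>
      L2_tendsto (Rn n) (\<lambda>k. elementary_fun n (es k)) f \<and> L2_tendsto M (\<lambda>k. elem n (es k)) Z"
    using is_integral_approx[OF assms(1)] ..
  note f = is_integral_L2[OF assms(1)] es[THEN conjunct1, rule_format] es[THEN conjunct2, THEN conjunct1]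
    es[THEN conjunct2, THEN conjunct2]
  have g: "g \<in> L2 (Rn n)" by (rule L2_cong_AE[OF f(1) assms(2,3)])
  have Z': "Z' \<in> L2 M" by (rule L2_cong_AE[OF f(2) assms(4,5)])
  have 1: "(LINT x|Rn n. (elementary_fun n (es k) x - f x)\<^sup>2) = (LINT x|Rn n. (elementary_fun n (es k) x - g x)\<^sup>2)" for k
  proof (rule integral_cong_AE)
    show "AE x in Rn n. (elementary_fun n (es k) x - f x)\<^sup>2 = (elementary_fun n (es k) x - g x)\<^sup>2"
      using assms(3) by eventually_elim simp
  qed (intro borel_measurable_power borel_measurable_diff L2_measurable[OF elementary_fun_L2] L2_measurable[OF f(1)]
      L2_measurable[OF g])+
  have 2: "(LINT \<omega>|M. (elem n (es k) \<omega> - Z \<omega>)\<^sup>2) = (LINT \<omega>|M. (elem n (es k) \<omega> - Z' \<omega>)\<^sup>2)" for k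
  proof (rule integral_cong_AE)
    show "AE \<omega> in M. (elem n (es k) \<omega> - Z \<omega>)\<^sup>2 = (elem n (es k) \<omega> - Z' \<omega>)\<^sup>2"
      using assms(5) by eventually_elim simp
  qed (intro borel_measurable_power borel_measurable_diff elem_measurable L2_measurable[OF f(2)] L2_measurable[OF Z'])+
  show ?thesis unfolding is_multiple_integral_def
    by (intro conjI g Z' exI[of _ es] allI f(3) f(4)[unfolded 1] f(5)[unfolded 2])
qed

lemma is_integral_limit:
  assumes F: "\<And>k. is_integral n (F k) (Z k)" and f: "is_integral n f Z'" and lim: "L2_tendsto (Rn n) F f"
  shows "L2_tendsto M Z Z'"
proof (rule tendsto_sandwich[OF _ _ tendsto_const])
  show "(\<lambda>k. fact n * (LINT x|Rn n. (F k x - f x)\<^sup>2)) \<longlonglongrightarrow> 0"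
    by (rule tendsto_mult_right_zero[OF lim])
  show "\<forall>\<^sub>F k in sequentially. expectation (\<lambda>\<omega>. (Z k \<omega> - Z' \<omega>)\<^sup>2) \<le> fact n * (LINT x|Rn n. (F k x - f x)\<^sup>2)"
    by (intro always_eventually allI is_integral_norm_le is_integral_diff F f)
  show "\<forall>\<^sub>F k in sequentially. 0 \<le> expectation (\<lambda>\<omega>. (Z k \<omega> - Z' \<omega>)\<^sup>2)"
    by (intro always_eventually allI Bochner_Integration.integral_nonneg zero_le_power2)
qed

text \<open>The form \<open>sym_inner\<close> is invariant under permutations in either argument, so the integrals of \<open>f\<close> and of
  the permuted function have distance zero.\<close>

lemma is_integral_permute:
  assumes p: "\<sigma> permutes {..<n}" and Z: "is_integral n f Z"
  shows "is_integral n (\<lambda>x. f (x \<circ> \<sigma>)) Z"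
proof -
  note f = is_integral_L2(1)[OF Z]
  note fp = L2_permute[OF p f]
  obtain Z' where Z': "is_integral n (\<lambda>x. f (x \<circ> \<sigma>)) Z'" using is_integral_exists[OF fp] ..
  have "expectation (\<lambda>\<omega>. (Z' \<omega> - Z \<omega>)\<^sup>2) = 0"
    using is_integral_isometry[OF Z Z] is_integral_isometry[OF Z' Z] is_integral_isometry[OF Z' Z']
    unfolding L2_diff_norm[OF is_integral_L2(2)[OF Z'] is_integral_L2(2)[OF Z]]
    by (simp add: power2_eq_square sym_inner_permute_left[OF p f f] sym_inner_permute_left[OF p f fp]
        sym_inner_permute_right[OF p])
  then have "AE \<omega> in M. Z' \<omega> - Z \<omega> = 0"
    by (intro L2_zero_AE L2_diff is_integral_L2(2)[OF Z] is_integral_L2(2)[OF Z'])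
  then have "AE \<omega> in M. Z' \<omega> = Z \<omega>" by eventually_elim simp
  then show ?thesis
    by (intro is_integral_cong_AE[OF Z'] L2_measurable[OF fp] L2_measurable[OF is_integral_L2(2)[OF Z]]) simp_all
qed

lemma is_integral_multiple_integral:
  assumes "f \<in> L2 (Rn n)"
  shows "is_integral n f (multiple_integral M W n f)"
  unfolding multiple_integral_def by (rule someI_ex[OF is_integral_exists[OF assms]])

lemma multiple_integral_AE:
  assumes "is_integral n f Z"
  shows "AE \<omega> in M. multiple_integral M W n f \<omega> = Z \<omega>"
  by (rule is_integral_unique[OF is_integral_multiple_integral[OF is_integral_L2(1)[OF assms]] assms])

lemma wiener_chaosI:
  assumes "is_integral n f Z"
  shows "Z \<in> wiener_chaos M W n"
  unfolding wiener_chaos_def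
proof (intro CollectI conjI bexI)
  show "Z \<in> borel_measurable M" by (rule L2_measurable[OF is_integral_L2(2)[OF assms]])
  show "f \<in> L2 (Rn n)" by (rule is_integral_L2(1)[OF assms])
  show "AE \<omega> in M. Z \<omega> = multiple_integral M W n f \<omega>"
    using multiple_integral_AE[OF assms] by eventually_elim simp
qed

lemma wiener_chaos_is_integral:
  assumes "Z \<in> wiener_chaos M W n"
  shows "\<exists>f. is_integral n f Z"
proof -
  from assms obtain f where f: "f \<in> L2 (Rn n)" "AE \<omega> in M. Z \<omega> = multiple_integral M W n f \<omega>"
    and m: "Z \<in> borel_measurable M"
    unfolding wiener_chaos_def by blast
  have "AE \<omega> in M. multiple_integral M W n f \<omega> = Z \<omega>" using f(2) by eventually_elim simp
  then have "is_integral n f Z"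
    by (intro is_integral_cong_AE[OF is_integral_multiple_integral[OF f(1)]] L2_measurable[OF f(1)] m) simp_all
  then show ?thesis by (intro exI[of _ f])
qed

lemma wiener_chaos_orthogonal:
  assumes "U \<in> wiener_chaos M W n" "V \<in> wiener_chaos M W n'" "n \<noteq> n'"
  shows "integrable M (\<lambda>\<omega>. U \<omega> * V \<omega>)" "expectation (\<lambda>\<omega>. U \<omega> * V \<omega>) = 0"
proof -
  obtain f where f: "is_integral n f U" using wiener_chaos_is_integral[OF assms(1)] ..
  obtain g where g: "is_integral n' g V" using wiener_chaos_is_integral[OF assms(2)] ..
  show "integrable M (\<lambda>\<omega>. U \<omega> * V \<omega>)"
    by (rule L2_mult_integrable[OF is_integral_L2(2)[OF f] is_integral_L2(2)[OF g]])
  show "expectation (\<lambda>\<omega>. U \<omega> * V \<omega>) = 0"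
    using is_integral_isometry[OF f g] assms(3) by simp
qed

lemma is_integral_const: "is_integral 0 (\<lambda>x. c) (\<lambda>\<omega>. c)"
proof -
  have "off_diagonal 0 [(c, (\<lambda>_. 0), (\<lambda>_. 0))]" by (simp add: off_diagonal_def)
  from is_integral_elem[OF this] show ?thesis
    by (simp add: elementary_fun_def[abs_def] elementary_integral_def[abs_def])
qed

end

section \<open>Hermite polynomials with a variance parameter\<close>

text \<open>The generating function \<open>exp (x t - v t\<^sup>2 / 2)\<close>, a power series in \<open>t\<close>.\<close>

definition hermite_fps :: "real \<Rightarrow> real \<Rightarrow> real fps" where
  "hermite_fps v x = fps_exp x * (fps_exp (- v / 2) oo fps_X\<^sup>2)"

text \<open>The Hermite polynomial of variance \<open>v\<close> divided by \<open>fact n\<close>. With this normalisation the addition formula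
  is a Cauchy product.\<close>

definition herm :: "nat \<Rightarrow> real \<Rightarrow> real \<Rightarrow> real" where
  "herm n v x = fps_nth (hermite_fps v x) n"

lemma hermite_fps_add: "hermite_fps (v + w) (x + y) = hermite_fps v x * hermite_fps w y"
proof -
  have "- (v + w) / 2 = - v / 2 + - w / 2" by (simp add: field_simps)
  then have "fps_exp (- (v + w) / 2) oo fps_X\<^sup>2 =
      (fps_exp (- v / 2) oo fps_X\<^sup>2) * (fps_exp (- w / 2) oo fps_X\<^sup>2)"
    by (simp only: fps_exp_add_mult) (rule fps_compose_mult_distrib, simp add: power2_eq_square)
  then show ?thesis by (simp only: hermite_fps_def fps_exp_add_mult mult_ac)
qed

lemma hermite_fps_0: "hermite_fps 0 0 = 1"
  by (simp add: hermite_fps_def)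

lemma hermite_fps_sum: "hermite_fps (\<Sum>l\<in>A. v l) (\<Sum>l\<in>A. x l) = (\<Prod>l\<in>A. hermite_fps (v l) (x l))"
  by (induction A rule: infinite_finite_induct) (simp_all add: hermite_fps_0 hermite_fps_add)

lemma hermite_fps_deriv:
  "fps_deriv (hermite_fps v x) = (fps_const x - fps_const v * fps_X) * hermite_fps v x"
proof -
  have X: "fps_nth (fps_X\<^sup>2 :: real fps) 0 = 0" by (simp add: power2_eq_square)
  define e q :: "real fps" where "e = fps_exp x" and "q = fps_exp (- v / 2) oo fps_X\<^sup>2"
  have dX: "fps_deriv (fps_X\<^sup>2 :: real fps) = 2 * fps_X"
    unfolding power2_eq_square fps_deriv_mult by simp
  have "fps_deriv q = ((fps_const (- v / 2) oo fps_X\<^sup>2) * q) * (2 * fps_X)"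
    unfolding q_def fps_compose_deriv[OF X] fps_exp_deriv fps_compose_mult_distrib[OF X] dX ..
  then have d: "fps_deriv q = (fps_const (- v / 2) * q) * (2 * fps_X)"
    by (simp only: fps_const_compose)
  have c: "fps_const (- v / 2) * (2 :: real fps) = - fps_const v"
    unfolding numeral_fps_const fps_const_mult by simp
  have "e * ((fps_const (- v / 2) * q) * (2 * fps_X)) = (fps_const (- v / 2) * 2) * (fps_X * (e * q))"
    by (simp only: mult_ac)
  also have "\<dots> = - (fps_const v * fps_X) * (e * q)"
    unfolding c by (simp add: mult.assoc del: fps_const_neg)
  finally have "fps_deriv (e * q) = - (fps_const v * fps_X) * (e * q) + fps_const x * (e * q)"
    unfolding fps_deriv_mult d by (simp only: e_def fps_exp_deriv mult_ac)
  also have "\<dots> = (fps_const x - fps_const v * fps_X) * (e * q)"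
    by (simp only: left_diff_distrib minus_mult_left[symmetric]) simp
  finally show ?thesis unfolding hermite_fps_def e_def q_def .
qed

lemma herm_0 [simp]: "herm 0 v x = 1"
  by (simp add: herm_def hermite_fps_def)

lemma herm_1 [simp]: "herm (Suc 0) v x = x"
proof -
  have "fps_nth (fps_deriv (hermite_fps v x)) 0 = x"
    unfolding hermite_fps_deriv using herm_0[of v x] by (simp add: herm_def)
  then show ?thesis by (simp add: herm_def)
qed

lemma herm_rec: "real (Suc (Suc n)) * herm (Suc (Suc n)) v x = x * herm (Suc n) v x - v * herm n v x"
proof -
  have "fps_nth (fps_deriv (hermite_fps v x)) (Suc n) = x * herm (Suc n) v x - v * herm n v x"
    unfolding hermite_fps_deriv herm_def
    by (simp add: left_diff_distrib mult.assoc)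
  then show ?thesis by (simp add: herm_def)
qed

lemma herm_rec': "herm (Suc (Suc n)) v x = (x * herm (Suc n) v x - v * herm n v x) / real (Suc (Suc n))"
  using herm_rec[of n v x] by (simp add: field_simps)

lemma herm_scale: "herm n (a\<^sup>2 * v) (a * x) = a ^ n * herm n v x"
proof (induction n rule: induct_nat_012)
  case (ge2 n)
  show ?case unfolding herm_rec' ge2 by (simp add: field_simps power2_eq_square)
qed simp_all

lemma herm_add: "herm n (v + w) (x + y) = (\<Sum>i\<le>n. herm i v x * herm (n - i) w y)"
  by (simp add: herm_def hermite_fps_add fps_mult_nth atLeast0AtMost)

lemma herm_has_derivative:
  "((\<lambda>y. herm (Suc n) v y) has_real_derivative herm n v x) (at x)"
proof (induction n rule: induct_nat_012)
  case 0
  show ?case by simp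
next
  case 1
  have "(\<lambda>y. herm (Suc (Suc 0)) v y) = (\<lambda>y. (y * y - v) / 2)"
    by (simp add: herm_rec' numeral_2_eq_2 fun_eq_iff)
  moreover have "((\<lambda>y. (y * y - v) / 2) has_real_derivative x) (at x)"
    by (auto intro!: derivative_eq_intros)
  ultimately show ?case by simp
next
  case (ge2 n)
  have "((\<lambda>y. (y * herm (Suc (Suc n)) v y - v * herm (Suc n) v y) / real (Suc (Suc (Suc n)))) has_real_derivative
      (1 * herm (Suc (Suc n)) v x + herm (Suc n) v x * x - v * herm n v x) / real (Suc (Suc (Suc n)))) (at x)"
    by (intro DERIV_cdivide DERIV_diff DERIV_mult DERIV_cmult DERIV_ident ge2)
  moreover have "1 * herm (Suc (Suc n)) v x + herm (Suc n) v x * x - v * herm n v x =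
      real (Suc (Suc (Suc n))) * herm (Suc (Suc n)) v x"
    using herm_rec[of n v x] by (simp add: algebra_simps)
  ultimately show ?case unfolding herm_rec'[of "Suc n"] by simp
qed

text \<open>Differentiating \<open>herm n\<close> times the Gaussian factor gives \<open>- (n + 1)\<close> times \<open>herm (n + 1)\<close> times the same
  factor, by the derivative formula and the three-term recursion.\<close>

lemma hermite_eq_herm: "hermite n x = fact n * herm n 1 x"
proof -
  have "(deriv ^^ n) (\<lambda>y. exp (- (y\<^sup>2 / 2))) = (\<lambda>x. (-1) ^ n * (fact n * herm n 1 x) * exp (- (x\<^sup>2 / 2)))"
  proof (induction n)
    case (Suc n)
    have "deriv (\<lambda>x. (-1) ^ n * (fact n * herm n 1 x) * exp (- (x\<^sup>2 / 2))) x =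
        (-1) ^ Suc n * (fact (Suc n) * herm (Suc n) 1 x) * exp (- (x\<^sup>2 / 2))" for x :: real
    proof (cases n)
      case 0
      have "((\<lambda>x :: real. exp (- (x\<^sup>2 / 2))) has_real_derivative - x * exp (- (x\<^sup>2 / 2))) (at x)"
        by (auto intro!: derivative_eq_intros)
      then show ?thesis using 0 by (simp add: DERIV_imp_deriv)
    next
      case (Suc k)
      have "((\<lambda>x. (-1) ^ n * (fact n * herm n 1 x) * exp (- (x\<^sup>2 / 2))) has_real_derivative
        ((-1) ^ n * (fact n * herm k 1 x) * exp (- (x\<^sup>2 / 2)) +
          (- x * exp (- (x\<^sup>2 / 2))) * ((-1) ^ n * (fact n * herm n 1 x)))) (at x)"
        unfolding Suc
        by (intro DERIV_mult DERIV_cmult herm_has_derivative) (auto intro!: derivative_eq_intros)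
      then have "deriv (\<lambda>x. (-1) ^ n * (fact n * herm n 1 x) * exp (- (x\<^sup>2 / 2))) x =
        ((-1) ^ n * (fact n * herm k 1 x) * exp (- (x\<^sup>2 / 2)) +
          (- x * exp (- (x\<^sup>2 / 2))) * ((-1) ^ n * (fact n * herm n 1 x)))"
        by (rule DERIV_imp_deriv)
      also have "\<dots> = (-1) ^ Suc n * fact n * (x * herm n 1 x - 1 * herm k 1 x) * exp (- (x\<^sup>2 / 2))"
        by (simp add: algebra_simps)
      also have "x * herm n 1 x - 1 * herm k 1 x = real (Suc n) * herm (Suc n) 1 x"
        using herm_rec[of k 1 x] Suc by simp
      finally show ?thesis by (simp add: algebra_simps)
    qed
    then show ?case
      unfolding funpow.simps o_apply Suc by (rule ext)
  qed simp
  then have "hermite n x = (-1) ^ n * (-1) ^ n * (fact n * herm n 1 x) * (exp (x\<^sup>2 / 2) * exp (- (x\<^sup>2 / 2)))"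
    unfolding hermite_def by (simp only: mult_ac)
  also have "exp (x\<^sup>2 / 2) * exp (- (x\<^sup>2 / 2)) = 1"
    by (simp flip: exp_add)
  also have "(-1 :: real) ^ n * (-1) ^ n = 1"
    by (simp flip: power_mult_distrib)
  finally show ?thesis by simp
qed

lemma herm_continuous:
  assumes "(f \<longlongrightarrow> v) F" "(g \<longlongrightarrow> x) F"
  shows "((\<lambda>k. herm n (f k) (g k)) \<longlongrightarrow> herm n v x) F"
proof (induction n rule: induct_nat_012)
  case (ge2 n)
  show ?case unfolding herm_rec'
    by (intro tendsto_divide tendsto_diff tendsto_mult assms ge2 tendsto_const) simp
qed (simp_all add: assms)

lemma herm_measurable [measurable]: "herm n v \<in> borel_measurable borel"
proof (induction n rule: induct_nat_012)
  case (ge2 n)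
  note [measurable] = ge2
  show ?case unfolding herm_rec'[abs_def] by measurable
qed simp_all

lemma herm_poly: "\<exists>p :: real poly. \<forall>x. herm n v x = poly p x"
proof (induction n rule: induct_nat_012)
  case 0
  show ?case by (intro exI[of _ 1]) simp
next
  case 1
  show ?case by (intro exI[of _ "[:0, 1:]"]) simp
next
  case (ge2 n)
  from ge2 obtain p q :: "real poly" where "\<forall>x. herm n v x = poly p x" "\<forall>x. herm (Suc n) v x = poly q x" by blast
  then show ?case
    by (intro exI[of _ "smult (inverse (real (Suc (Suc n)))) ([:0, 1:] * q - smult v p)"])
      (simp add: herm_rec' field_simps)
qed

section \<open>Gaussian integration by parts\<close>

lemma normal_moment_rec:
  assumes "\<sigma> > 0"
  shows "(LINT x|lborel. normal_density 0 \<sigma> x * x ^ Suc (Suc k)) =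
    real (Suc k) * \<sigma>\<^sup>2 * (LINT x|lborel. normal_density 0 \<sigma> x * x ^ k)"
proof (cases "even k")
  case True
  then obtain j where k: "k = 2 * j" by blast
  have k2: "Suc (Suc k) = 2 * Suc j" by (simp add: k)
  define D F :: real where "D = (2 / \<sigma>\<^sup>2) ^ j * fact j" and "F = fact (2 * j)"
  have D: "D > 0" using assms by (simp add: D_def)
  have "fact (2 * Suc j) = (2 * real j + 2) * (2 * real j + 1) * F"
    by (simp add: F_def algebra_simps)
  moreover have "(2 / \<sigma>\<^sup>2) ^ Suc j * fact (Suc j) = (2 / \<sigma>\<^sup>2) * (real j + 1) * D"
    by (simp add: D_def algebra_simps)
  ultimately have "(LINT x|lborel. normal_density 0 \<sigma> x * (x - 0) ^ (2 * Suc j)) =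
      (2 * real j + 2) * (2 * real j + 1) * F / ((2 / \<sigma>\<^sup>2) * (real j + 1) * D)"
    by (simp only: integral_normal_moment_even[OF assms])
  also have "\<dots> = (2 * real j + 1) * \<sigma>\<^sup>2 * (F / D)"
    using assms D by (simp add: divide_simps)
  also have "F / D = (LINT x|lborel. normal_density 0 \<sigma> x * (x - 0) ^ (2 * j))"
    by (simp only: integral_normal_moment_even[OF assms] F_def D_def)
  finally show ?thesis unfolding k2 by (simp add: k)
next
  case False
  then obtain j where k: "k = 2 * j + 1" by (rule oddE)
  have "Suc (Suc k) = 2 * Suc j + 1" by (simp add: k)
  then show ?thesis
    using integral_normal_moment_odd[OF assms, of 0 "Suc j"] integral_normal_moment_odd[OF assms, of 0 j]
    by (simp add: k)
qed

lemma normal_poly_integrable: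
  assumes "\<sigma> > 0"
  shows "integrable lborel (\<lambda>x. normal_density 0 \<sigma> x * poly p x)"
proof -
  have "integrable lborel (\<lambda>x. \<Sum>i\<le>degree p. coeff p i * (normal_density 0 \<sigma> x * (x - 0) ^ i))"
    by (intro Bochner_Integration.integrable_sum integrable_mult_right integrable_normal_moment assms)
  then show ?thesis by (simp add: poly_altdef sum_distrib_left mult_ac)
qed

text \<open>Both sides are linear in the polynomial, and for monomials the identity is the recursion of the moments.\<close>

lemma normal_integration_by_parts:
  assumes "\<sigma> > 0"
  shows "(LINT x|lborel. normal_density 0 \<sigma> x * (x * poly p x)) =
    \<sigma>\<^sup>2 * (LINT x|lborel. normal_density 0 \<sigma> x * poly (pderiv p) x)"
proof -
  define Q where "Q p \<longleftrightarrow> (LINT x|lborel. normal_density 0 \<sigma> x * (x * poly p x)) =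
    \<sigma>\<^sup>2 * (LINT x|lborel. normal_density 0 \<sigma> x * poly (pderiv p) x)" for p
  have int: "integrable lborel (\<lambda>x. normal_density 0 \<sigma> x * poly p x)" for p
    by (rule normal_poly_integrable[OF assms])
  have int': "integrable lborel (\<lambda>x. normal_density 0 \<sigma> x * (x * poly p x))" for p
    using int[of "[:0, 1:] * p"] by simp
  have add: "Q (p + q)" if "Q p" "Q q" for p q
    using that int[of "pderiv p"] int[of "pderiv q"] int'[of p] int'[of q]
    by (simp add: Q_def pderiv_add distrib_left)
  have monom: "Q (monom c i)" for c i
  proof (cases i)
    case 0
    then show ?thesis
      using integral_normal_moment_odd[OF assms, of 0 0]
      by (simp add: Q_def poly_monom pderiv_monom mult.assoc[symmetric])
  next
    case (Suc k)
    have "(LINT x|lborel. normal_density 0 \<sigma> x * (x * poly (monom c i) x)) =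
        (LINT x|lborel. c * (normal_density 0 \<sigma> x * x ^ Suc (Suc k)))"
      by (simp add: poly_monom Suc mult_ac)
    also have "\<dots> = c * (real (Suc k) * \<sigma>\<^sup>2 * (LINT x|lborel. normal_density 0 \<sigma> x * x ^ k))"
      by (simp only: integral_mult_right_zero normal_moment_rec[OF assms])
    also have "\<dots> = \<sigma>\<^sup>2 * (LINT x|lborel. (real (Suc k) * c) * (normal_density 0 \<sigma> x * x ^ k))"
      by (simp only: integral_mult_right_zero mult_ac)
    also have "\<dots> = \<sigma>\<^sup>2 * (LINT x|lborel. normal_density 0 \<sigma> x * poly (pderiv (monom c i)) x)"
      by (simp add: Suc pderiv_monom poly_monom mult_ac)
    finally show ?thesis unfolding Q_def .
  qed
  have "Q (\<Sum>i\<in>A. monom (coeff p i) i)" if "finite A" for A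
    using that
  proof (induction A rule: finite_induct)
    case empty
    then show ?case by (simp add: Q_def)
  qed (simp add: add monom)
  from this[of "{..degree p}"] have "Q p" by (simp add: poly_as_sum_of_monoms)
  then show ?thesis by (simp add: Q_def)
qed

text \<open>Integration by parts turns the three-term recursion into a relation between the inner products of
  degrees \<open>(n + 1, k + 1)\<close> and \<open>(n, k)\<close>.\<close>

lemma herm_orthogonal:
  assumes "\<sigma> > 0"
  shows "integrable lborel (\<lambda>x. normal_density 0 \<sigma> x * (herm n (\<sigma>\<^sup>2) x * herm k (\<sigma>\<^sup>2) x))"
    and "(LINT x|lborel. normal_density 0 \<sigma> x * (herm n (\<sigma>\<^sup>2) x * herm k (\<sigma>\<^sup>2) x)) =
      (if n = k then (\<sigma>\<^sup>2) ^ n / fact n else 0)"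
proof -
  have "\<forall>n. \<exists>p :: real poly. \<forall>x. herm n (\<sigma>\<^sup>2) x = poly p x" using herm_poly by blast
  from choice[OF this] obtain P where P: "\<And>n x. herm n (\<sigma>\<^sup>2) x = poly (P n) x" by blast
  have dP: "poly (pderiv (P (Suc n))) x = poly (P n) x" for n x
    using herm_has_derivative[of n "\<sigma>\<^sup>2" x] DERIV_unique[OF poly_DERIV[of "P (Suc n)" x]] unfolding P by blast
  define E where "E p = (LINT x|lborel. normal_density 0 \<sigma> x * poly p x)" for p
  have int: "integrable lborel (\<lambda>x. normal_density 0 \<sigma> x * poly p x)" for p
    by (rule normal_poly_integrable[OF assms])
  show "integrable lborel (\<lambda>x. normal_density 0 \<sigma> x * (herm n (\<sigma>\<^sup>2) x * herm k (\<sigma>\<^sup>2) x))"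
    using int[of "P n * P k"] by (simp add: P)
  have IBP: "E ([:0, 1:] * p) = \<sigma>\<^sup>2 * E (pderiv p)" for p
    using normal_integration_by_parts[OF assms, of p] by (simp add: E_def)
  have lin: "E (smult a p - smult b q) = a * E p - b * E q" for a b p q
  proof -
    have "E (smult a p - smult b q) =
        (LINT x|lborel. a * (normal_density 0 \<sigma> x * poly p x) - b * (normal_density 0 \<sigma> x * poly q x))"
      unfolding E_def by (intro Bochner_Integration.integral_cong) (simp_all add: algebra_simps)
    also have "\<dots> = a * E p - b * E q"
      unfolding E_def by (subst Bochner_Integration.integral_diff) (simp_all add: int)
    finally show ?thesis .
  qed
  have Eeq: "E p = E q" if "\<And>x. poly p x = poly q x" for p q
    using that by (simp add: E_def)
  have E0: "E (P 0 * P 0) = 1"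
    using integral_normal_moment_even[OF assms, of 0 0] by (simp add: E_def P[symmetric])
  have P1: "poly (P (Suc 0)) x = x" "poly (P 0) x = 1" for x by (simp_all flip: P)
  have dP0: "poly (pderiv (P 0)) x = 0" for x
  proof -
    have "P 0 = 1" by (rule poly_ext) (simp add: P1)
    then show ?thesis by simp
  qed
  have rec: "real (Suc n) * E (P (Suc n) * P k) = \<sigma>\<^sup>2 * E (P n * pderiv (P k))" for n k
  proof (cases n)
    case 0
    have "E (P (Suc 0) * P k) = E ([:0, 1:] * P k)" by (rule Eeq) (simp add: P1)
    also have "\<dots> = \<sigma>\<^sup>2 * E (P 0 * pderiv (P k))"
      unfolding IBP by (intro arg_cong2[where f="(*)"] refl Eeq) (simp add: P1)
    finally show ?thesis by (simp add: 0)
  next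
    case (Suc j)
    have "real (Suc n) * E (P (Suc n) * P k) = E (smult (real (Suc n)) (P (Suc n) * P k) - smult 0 (P 0))"
      unfolding lin by simp
    also have "\<dots> = E (smult 1 ([:0, 1:] * (P n * P k)) - smult (\<sigma>\<^sup>2) (P j * P k))"
    proof (rule Eeq)
      fix x
      have "poly (smult (real (Suc n)) (P (Suc n) * P k) - smult 0 (P 0)) x =
          (real (Suc n) * poly (P (Suc n)) x) * poly (P k) x" by simp
      also have "real (Suc n) * poly (P (Suc n)) x = x * poly (P n) x - \<sigma>\<^sup>2 * poly (P j) x"
        using herm_rec[of j "\<sigma>\<^sup>2" x] unfolding P Suc .
      finally show "poly (smult (real (Suc n)) (P (Suc n) * P k) - smult 0 (P 0)) x =
          poly (smult 1 ([:0, 1:] * (P n * P k)) - smult (\<sigma>\<^sup>2) (P j * P k)) x"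
        by (simp add: algebra_simps)
    qed
    also have "\<dots> = \<sigma>\<^sup>2 * E (pderiv (P n * P k)) - \<sigma>\<^sup>2 * E (P j * P k)"
      unfolding lin IBP by simp
    also have "\<dots> = \<sigma>\<^sup>2 * E (smult 1 (pderiv (P n * P k)) - smult 1 (P j * P k))"
      unfolding lin by (simp add: algebra_simps)
    also have "E (smult 1 (pderiv (P n * P k)) - smult 1 (P j * P k)) = E (P n * pderiv (P k))"
      by (rule Eeq) (simp add: pderiv_mult Suc dP algebra_simps)
    finally show ?thesis .
  qed
  have "E (P n * P k) = (if n = k then (\<sigma>\<^sup>2) ^ n / fact n else 0)"
  proof (induction n arbitrary: k)
    case 0
    show ?case
    proof (cases k)
      case 0
      then show ?thesis using E0 by simp
    next
      case (Suc j)
      have "real (Suc j) * E (P (Suc j) * P 0) = 0"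
        unfolding rec by (simp add: E_def dP0)
      then show ?thesis by (simp add: Suc mult.commute)
    qed
  next
    case (Suc n)
    show ?case
    proof (cases k)
      case 0
      have "real (Suc n) * E (P (Suc n) * P 0) = 0"
        unfolding rec by (simp add: E_def dP0)
      then show ?thesis by (simp add: 0)
    next
      fix j assume k: "k = Suc j"
      have "E (P n * pderiv (P (Suc j))) = E (P n * P j)" by (rule Eeq) (simp add: dP)
      then have "real (Suc n) * E (P (Suc n) * P k) = \<sigma>\<^sup>2 * (if n = j then (\<sigma>\<^sup>2) ^ n / fact n else 0)"
        unfolding k rec Suc by simp
      then have "E (P (Suc n) * P k) = \<sigma>\<^sup>2 * (if n = j then (\<sigma>\<^sup>2) ^ n / fact n else 0) / real (Suc n)"
        by (simp add: nonzero_eq_divide_eq mult.commute del: of_nat_Suc)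
      then show ?thesis unfolding k by (cases "n = j") simp_all
    qed
  qed
  then show "(LINT x|lborel. normal_density 0 \<sigma> x * (herm n (\<sigma>\<^sup>2) x * herm k (\<sigma>\<^sup>2) x)) =
      (if n = k then (\<sigma>\<^sup>2) ^ n / fact n else 0)"
    by (simp add: E_def P)
qed

section \<open>Multiple integrals of tensor powers are Hermite polynomials\<close>

lemma cube_inner:
  assumes t: "is_grid t L" and f: "f \<in> grid_inj n L" and g: "g \<in> grid_inj n L"
  shows "(LINT x|Rn n. cube t n f x * cube t n g x) = (if f = g then \<Prod>i<n. t (Suc (f i)) - t (f i) else 0)"
proof -
  have fL: "\<And>i. i < n \<Longrightarrow> f i < L" and gL: "\<And>i. i < n \<Longrightarrow> g i < L"
    using f g by (auto simp: grid_inj_def)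
  have "(LINT x|Rn n. cube t n f x * cube t n g x) =
      (\<Prod>i<n. LINT u|lborel. indicator (grid_cell t (f i)) u * indicator (grid_cell t (g i)) u)"
    unfolding cube_def by (intro Rn_prod_inner indicator_Ioc_L2)
  also have "\<dots> = (\<Prod>i<n. if f i = g i then t (Suc (f i)) - t (f i) else 0)"
    by (intro prod.cong refl) (use fL gL in \<open>auto simp: grid_cell_inner[OF t]\<close>)
  also have "\<dots> = (if f = g then \<Prod>i<n. t (Suc (f i)) - t (f i) else 0)"
  proof (cases "f = g")
    case False
    have "f \<in> extensional {..<n}" "g \<in> extensional {..<n}" using f g by (auto simp: grid_inj_def PiE_def)
    then have "\<exists>i<n. f i \<noteq> g i" using False by (metis extensionalityI lessThan_iff)
    then show ?thesis using False by auto
  qed simp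
  finally show ?thesis .
qed

lemma off_diagonal_part_norm:
  assumes t: "is_grid t L"
  shows "(LINT x|Rn n. (off_diagonal_part t L n h x)\<^sup>2) =
    (\<Sum>f\<in>grid_inj n L. (\<Prod>i<n. h i (t (Suc (f i))))\<^sup>2 * (\<Prod>i<n. t (Suc (f i)) - t (f i)))"
proof -
  define b where "b f = (\<Prod>i<n. h i (t (Suc (f i))))" for f
  have int: "integrable (Rn n) (\<lambda>x. (b f * b g) * (cube t n f x * cube t n g x))" for f g
    by (intro integrable_mult_right L2_mult_integrable cube_L2)
  have "(LINT x|Rn n. (off_diagonal_part t L n h x)\<^sup>2) =
      (LINT x|Rn n. (\<Sum>f\<in>grid_inj n L. \<Sum>g\<in>grid_inj n L. (b f * b g) * (cube t n f x * cube t n g x)))"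
    unfolding off_diagonal_part_def power2_eq_square sum_product b_def by (simp only: mult_ac)
  also have "\<dots> = (\<Sum>f\<in>grid_inj n L. LINT x|Rn n. (\<Sum>g\<in>grid_inj n L. (b f * b g) * (cube t n f x * cube t n g x)))"
    by (rule Bochner_Integration.integral_sum) (rule Bochner_Integration.integrable_sum, rule int)
  also have "\<dots> = (\<Sum>f\<in>grid_inj n L. \<Sum>g\<in>grid_inj n L. LINT x|Rn n. (b f * b g) * (cube t n f x * cube t n g x))"
    by (intro sum.cong refl Bochner_Integration.integral_sum int)
  also have "\<dots> = (\<Sum>f\<in>grid_inj n L. \<Sum>g\<in>grid_inj n L.
      if f = g then (b f)\<^sup>2 * (\<Prod>i<n. t (Suc (f i)) - t (f i)) else 0)"
    by (intro sum.cong refl) (simp add: cube_inner[OF t] power2_eq_square)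
  also have "\<dots> = (\<Sum>f\<in>grid_inj n L. (b f)\<^sup>2 * (\<Prod>i<n. t (Suc (f i)) - t (f i)))"
    by (intro sum.cong refl) simp
  finally show ?thesis unfolding b_def .
qed

lemma grid_step_L2_norm:
  assumes t: "is_grid t L" and h: "grid_step t L h"
  shows "(LINT u|lborel. (h u)\<^sup>2) = (\<Sum>l<L. (h (t (Suc l)))\<^sup>2 * (t (Suc l) - t l))"
proof -
  have "grid_step t L (\<lambda>u. (h u)\<^sup>2)" using h unfolding grid_step_def by (metis zero_power2)
  from grid_step_sum[OF t this]
  have eq: "(h u)\<^sup>2 = (\<Sum>l<L. (h (t (Suc l)))\<^sup>2 * indicator (grid_cell t l) u)" for u .
  have le: "t l \<le> t (Suc l)" if "l < L" for l using t that by (simp add: is_grid_def less_imp_le)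
  have "(LINT u|lborel. (h u)\<^sup>2) = (LINT u|lborel. (\<Sum>l<L. (h (t (Suc l)))\<^sup>2 * indicator (grid_cell t l) u))"
    by (rule Bochner_Integration.integral_cong[OF refl eq])
  also have "\<dots> = (\<Sum>l<L. LINT u|lborel. (h (t (Suc l)))\<^sup>2 * indicator (grid_cell t l) u)"
    by (rule Bochner_Integration.integral_sum) (use le in \<open>simp add: less_top[symmetric]\<close>)
  also have "\<dots> = (\<Sum>l<L. (h (t (Suc l)))\<^sup>2 * (t (Suc l) - t l))"
    by (intro sum.cong refl) (use le in simp)
  finally show ?thesis .
qed

context brownian
begin

lemma incr_herm_expectation:
  fixes a :: real
  assumes t: "is_grid t L" and l: "l < L"
  defines "w \<equiv> a\<^sup>2 * (t (Suc l) - t l)"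
  shows "integrable M (\<lambda>\<omega>. herm j w (a * incr t l \<omega>) * herm k w (a * incr t l \<omega>))"
    and "expectation (\<lambda>\<omega>. herm j w (a * incr t l \<omega>) * herm k w (a * incr t l \<omega>)) = (if j = k then w ^ j / fact j else 0)"
    and "integrable M (\<lambda>\<omega>. herm j w (a * incr t l \<omega>) * incr t l \<omega>)"
    and "expectation (\<lambda>\<omega>. herm j w (a * incr t l \<omega>) * incr t l \<omega>) = (if j = 1 then a * (t (Suc l) - t l) else 0)"
proof -
  define v where "v = t (Suc l) - t l"
  have v: "v > 0" using t l by (simp add: v_def is_grid_def)
  then have s: "sqrt v > 0" "(sqrt v)\<^sup>2 = v" by simp_all
  note D = incr_distributed[OF t l, folded v_def]
  have m: "(\<lambda>x. herm j v x * herm k v x) \<in> borel_measurable lborel" for j k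
    using borel_measurable_times[OF herm_measurable[of j v] herm_measurable[of k v]] by simp
  have int: "integrable M (\<lambda>\<omega>. herm j v (incr t l \<omega>) * herm k v (incr t l \<omega>))" for j k
    using herm_orthogonal(1)[OF s(1), of j k] distributed_integrable[OF D m] by (simp add: s(2) v less_imp_le)
  have E: "expectation (\<lambda>\<omega>. herm j v (incr t l \<omega>) * herm k v (incr t l \<omega>)) = (if j = k then v ^ j / fact j else 0)" for j k
    using herm_orthogonal(2)[OF s(1), of j k] distributed_integral[OF D m] by (simp add: s(2) v less_imp_le)
  have w: "w = a\<^sup>2 * v" by (simp add: w_def v_def)
  have eq1: "herm j w (a * x) * herm k w (a * x) = (a ^ j * a ^ k) * (herm j v x * herm k v x)" for x
    unfolding w herm_scale by (simp only: mult_ac)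
  have eq2: "herm j w (a * x) * x = a ^ j * (herm j v x * herm 1 v x)" for x
    unfolding w herm_scale by simp
  show "integrable M (\<lambda>\<omega>. herm j w (a * incr t l \<omega>) * herm k w (a * incr t l \<omega>))"
    unfolding eq1 by (intro integrable_mult_right int)
  show "integrable M (\<lambda>\<omega>. herm j w (a * incr t l \<omega>) * incr t l \<omega>)"
    unfolding eq2 by (intro integrable_mult_right int)
  show "expectation (\<lambda>\<omega>. herm j w (a * incr t l \<omega>) * herm k w (a * incr t l \<omega>)) = (if j = k then w ^ j / fact j else 0)"
    unfolding eq1 integral_mult_right_zero E by (simp add: w power_mult_distrib power2_eq_square)
  show "expectation (\<lambda>\<omega>. herm j w (a * incr t l \<omega>) * incr t l \<omega>) = (if j = 1 then a * (t (Suc l) - t l) else 0)"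
    unfolding eq2 integral_mult_right_zero E by (simp add: v_def)
qed

lemma herm_sum_expansion:
  fixes w x :: "nat \<Rightarrow> real"
  shows "herm n (\<Sum>l<L. w l) (\<Sum>l<L. x l) =
    (\<Sum>A\<in>multisets_of_size {..<L} n. \<Prod>l<L. herm (count A l) (w l) (x l))"
  unfolding herm_def hermite_fps_sum by (rule fps_prod_nth') simp

text \<open>The generating function of the sum is the product over the cells. By orthogonality only equal
  patterns of degrees survive in the expectation of the square, and they add up to a coefficient
  of the product of the exponential series \<open>exp (w l * t)\<close>.\<close>

lemma herm_grid_norm:
  fixes a :: "nat \<Rightarrow> real"
  assumes t: "is_grid t L"
  defines "V \<equiv> \<Sum>l<L. (a l)\<^sup>2 * (t (Suc l) - t l)"
  shows "integrable M (\<lambda>\<omega>. (herm n V (\<Sum>l<L. a l * incr t l \<omega>))\<^sup>2)"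
    and "expectation (\<lambda>\<omega>. (herm n V (\<Sum>l<L. a l * incr t l \<omega>))\<^sup>2) = V ^ n / fact n"
proof -
  define w where "w l = (a l)\<^sup>2 * (t (Suc l) - t l)" for l
  have Vw: "V = (\<Sum>l<L. w l)" by (simp add: V_def w_def)
  define MS where "MS = multisets_of_size {..<L} n"
  have fin: "finite MS" unfolding MS_def by (rule finite_multisets_of_size) simp
  define g where "g A B l x = herm (count A l) (w l) (a l * x) * herm (count B l) (w l) (a l * x)" for A B l x
  have gm: "g A B l \<in> borel_measurable borel" for A B l unfolding g_def by measurable
  have gi: "integrable M (\<lambda>\<omega>. g A B l (incr t l \<omega>))" if "l < L" for A B l
    unfolding g_def w_def by (rule incr_herm_expectation(1)[OF t that])
  have eq: "(herm n V (\<Sum>l<L. a l * incr t l \<omega>))\<^sup>2 = (\<Sum>A\<in>MS. \<Sum>B\<in>MS. \<Prod>l<L. g A B l (incr t l \<omega>))" for \<omega>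
    unfolding Vw herm_sum_expansion MS_def[symmetric] power2_eq_square sum_product g_def
    by (simp only: prod.distrib)
  have int: "integrable M (\<lambda>\<omega>. \<Prod>l<L. g A B l (incr t l \<omega>))" for A B
    by (rule incr_indep_expectation(2)[OF t gm gi])
  show "integrable M (\<lambda>\<omega>. (herm n V (\<Sum>l<L. a l * incr t l \<omega>))\<^sup>2)"
    unfolding eq by (intro Bochner_Integration.integrable_sum int)
  have one: "expectation (\<lambda>\<omega>. \<Prod>l<L. g A B l (incr t l \<omega>)) =
      (if A = B then \<Prod>l<L. w l ^ count A l / fact (count A l) else 0)" if A: "A \<in> MS" and B: "B \<in> MS" for A B
  proof -
    have "expectation (\<lambda>\<omega>. \<Prod>l<L. g A B l (incr t l \<omega>)) = (\<Prod>l<L. expectation (\<lambda>\<omega>. g A B l (incr t l \<omega>)))"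
      by (rule incr_indep_expectation(1)[OF t gm gi])
    also have "\<dots> = (\<Prod>l<L. if count A l = count B l then w l ^ count A l / fact (count A l) else 0)"
      by (intro prod.cong refl) (simp add: g_def w_def incr_herm_expectation(2)[OF t])
    also have "\<dots> = (if A = B then \<Prod>l<L. w l ^ count A l / fact (count A l) else 0)"
    proof (cases "A = B")
      case False
      then obtain l where l: "count A l \<noteq> count B l" by (auto simp: multiset_eq_iff)
      then have "l \<in># A \<or> l \<in># B" by (metis count_inI)
      then have "l < L" using A B by (auto simp: MS_def multisets_of_size_def)
      then show ?thesis using l False by (simp, intro bexI[of _ l]) auto
    qed simp
    finally show ?thesis .
  qed
  have "expectation (\<lambda>\<omega>. (herm n V (\<Sum>l<L. a l * incr t l \<omega>))\<^sup>2) =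
      (\<Sum>A\<in>MS. expectation (\<lambda>\<omega>. \<Sum>B\<in>MS. \<Prod>l<L. g A B l (incr t l \<omega>)))"
    unfolding eq by (rule Bochner_Integration.integral_sum) (rule Bochner_Integration.integrable_sum, rule int)
  also have "\<dots> = (\<Sum>A\<in>MS. \<Sum>B\<in>MS. expectation (\<lambda>\<omega>. \<Prod>l<L. g A B l (incr t l \<omega>)))"
    by (intro sum.cong refl Bochner_Integration.integral_sum int)
  also have "\<dots> = (\<Sum>A\<in>MS. \<Sum>B\<in>MS. if A = B then \<Prod>l<L. w l ^ count A l / fact (count A l) else 0)"
    by (intro sum.cong refl one)
  also have "\<dots> = (\<Sum>A\<in>MS. \<Prod>l<L. fps_nth (fps_exp (w l)) (count A l))"
    by (intro sum.cong refl) (simp add: fin)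
  also have "\<dots> = fps_nth (\<Prod>l<L. fps_exp (w l)) n"
    unfolding MS_def by (rule fps_prod_nth'[symmetric]) simp
  also have "(\<Prod>l<L. fps_exp (w l)) = fps_exp (\<Sum>l<L. w l)"
    by (induction L) (simp_all add: fps_exp_add_mult)
  finally show "expectation (\<lambda>\<omega>. (herm n V (\<Sum>l<L. a l * incr t l \<omega>))\<^sup>2) = V ^ n / fact n"
    by (simp add: V_def w_def)
qed

text \<open>Only the pattern of degrees which is one on the cells of \<open>f\<close> and zero elsewhere survives; in terms of
  generating functions, each cell of \<open>f\<close> contributes a multiple of the variable and each other cell contributes 1.\<close>

lemma herm_grid_inner:
  fixes a :: "nat \<Rightarrow> real"
  assumes t: "is_grid t L" and f: "f \<in> grid_inj n L"
  defines "V \<equiv> \<Sum>l<L. (a l)\<^sup>2 * (t (Suc l) - t l)"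
  shows "integrable M (\<lambda>\<omega>. herm n V (\<Sum>l<L. a l * incr t l \<omega>) * (\<Prod>i<n. incr t (f i) \<omega>))"
    and "expectation (\<lambda>\<omega>. herm n V (\<Sum>l<L. a l * incr t l \<omega>) * (\<Prod>i<n. incr t (f i) \<omega>)) =
      (\<Prod>i<n. a (f i) * (t (Suc (f i)) - t (f i)))"
proof -
  define P where "P = f ` {..<n}"
  have finj: "inj_on f {..<n}" and P: "P \<subseteq> {..<L}" using f by (auto simp: grid_inj_def P_def)
  have cP: "card P = n" and fP: "finite P" using card_image[OF finj] by (simp_all add: P_def)
  have fr: "(\<Prod>i<n. F (f i)) = (\<Prod>l\<in>P. F l)" for F :: "nat \<Rightarrow> real"
    unfolding P_def prod.reindex[OF finj] by simp
  define w where "w l = (a l)\<^sup>2 * (t (Suc l) - t l)" for l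
  define MS where "MS = multisets_of_size {..<L} n"
  have fin: "finite MS" unfolding MS_def by (rule finite_multisets_of_size) simp
  define g where "g A l x = herm (count A l) (w l) (a l * x) * (if l \<in> P then x else 1)" for A l x
  have gm: "g A l \<in> borel_measurable borel" for A l unfolding g_def by measurable
  have gE: "integrable M (\<lambda>\<omega>. g A l (incr t l \<omega>)) \<and> expectation (\<lambda>\<omega>. g A l (incr t l \<omega>)) =
      fps_nth (if l \<in> P then fps_const (a l * (t (Suc l) - t l)) * fps_X else 1) (count A l)" if l: "l < L" for A l
  proof (cases "l \<in> P")
    case True
    have "fps_nth (fps_const c * fps_X) j = (if j = 1 then c else 0)" for c :: real and j
      by (cases j) simp_all
    then show ?thesis using True
      using incr_herm_expectation(3,4)[OF t l, where a="a l" and j="count A l"] unfolding g_def w_def by (simp only: if_True)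
  next
    case False
    then show ?thesis
      using incr_herm_expectation(1,2)[OF t l, where a="a l" and j="count A l" and k=0]
      unfolding g_def w_def by (simp add: not_in_iff)
  qed
  have gi: "integrable M (\<lambda>\<omega>. g A l (incr t l \<omega>))" if "l < L" for A l using gE[OF that] by simp
  have eq: "herm n V (\<Sum>l<L. a l * incr t l \<omega>) * (\<Prod>i<n. incr t (f i) \<omega>) = (\<Sum>A\<in>MS. \<Prod>l<L. g A l (incr t l \<omega>))" for \<omega>
    unfolding V_def w_def[symmetric] herm_sum_expansion MS_def[symmetric] fr[of "\<lambda>l. incr t l \<omega>"] prod_eq_prod_if[OF P] g_def
      sum_distrib_right
    by (simp only: prod.distrib)
  have int: "integrable M (\<lambda>\<omega>. \<Prod>l<L. g A l (incr t l \<omega>))" for A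
    by (rule incr_indep_expectation(2)[OF t gm gi])
  show "integrable M (\<lambda>\<omega>. herm n V (\<Sum>l<L. a l * incr t l \<omega>) * (\<Prod>i<n. incr t (f i) \<omega>))"
    unfolding eq by (intro Bochner_Integration.integrable_sum int)
  have "expectation (\<lambda>\<omega>. herm n V (\<Sum>l<L. a l * incr t l \<omega>) * (\<Prod>i<n. incr t (f i) \<omega>)) =
      (\<Sum>A\<in>MS. expectation (\<lambda>\<omega>. \<Prod>l<L. g A l (incr t l \<omega>)))"
    unfolding eq by (rule Bochner_Integration.integral_sum) (rule int)
  also have "\<dots> = (\<Sum>A\<in>MS. \<Prod>l<L. expectation (\<lambda>\<omega>. g A l (incr t l \<omega>)))"
    by (intro sum.cong refl incr_indep_expectation(1)[OF t gm gi])
  also have "\<dots> = (\<Sum>A\<in>MS. \<Prod>l<L. fps_nth (if l \<in> P then fps_const (a l * (t (Suc l) - t l)) * fps_X else 1) (count A l))"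
    using gE by (intro sum.cong prod.cong refl) simp
  also have "\<dots> = fps_nth (\<Prod>l<L. if l \<in> P then fps_const (a l * (t (Suc l) - t l)) * fps_X else 1) n"
    unfolding MS_def by (rule fps_prod_nth'[symmetric]) simp
  also have "(\<Prod>l<L. if l \<in> P then fps_const (a l * (t (Suc l) - t l)) * fps_X else 1) =
      (\<Prod>l\<in>P. fps_const (a l * (t (Suc l) - t l)) * fps_X)"
    by (rule prod_eq_prod_if[OF P, symmetric])
  also have "\<dots> = fps_const (\<Prod>l\<in>P. a l * (t (Suc l) - t l)) * fps_X ^ n"
  proof -
    have "(\<Prod>l\<in>R. fps_const (c l) * fps_X) = fps_const (\<Prod>l\<in>R. c l) * fps_X ^ card R" if "finite R"
      for c :: "nat \<Rightarrow> real" and R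
      using that by (induction R rule: finite_induct) (simp_all add: mult_ac fps_const_mult[symmetric] del: fps_const_mult)
    from this[OF fP] show ?thesis by (simp only: cP)
  qed
  also have "fps_nth \<dots> n = (\<Prod>l\<in>P. a l * (t (Suc l) - t l))"
    by simp
  finally show "expectation (\<lambda>\<omega>. herm n V (\<Sum>l<L. a l * incr t l \<omega>) * (\<Prod>i<n. incr t (f i) \<omega>)) =
      (\<Prod>i<n. a (f i) * (t (Suc (f i)) - t (f i)))"
    unfolding fr[of "\<lambda>l. a l * (t (Suc l) - t l)"] .
qed

text \<open>The inner product of the Hermite polynomial with the elementary integral is the squared norm of the
  off-diagonal part, by \<open>herm_grid_inner\<close>. The squared distance is therefore at most \<open>fact n\<close> times the
  integral of the squared tensor power over the cubes that meet a diagonal.\<close>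

lemma herm_off_diagonal_distance:
  assumes t: "is_grid t L" and h: "grid_step t L h" and od: "off_diagonal n es"
    and ef: "elementary_fun n es = off_diagonal_part t L n (\<lambda>_. h)"
    and ei: "elem n es = (\<lambda>\<omega>. \<Sum>f\<in>grid_inj n L. (\<Prod>i<n. h (t (Suc (f i)))) *
       (\<Prod>i<n. W (t (Suc (f i))) \<omega> - W (t (f i)) \<omega>))"
  defines "V \<equiv> LINT u|lborel. (h u)\<^sup>2" and "S \<equiv> \<lambda>\<omega>. \<Sum>l<L. h (t (Suc l)) * incr t l \<omega>"
  shows "(\<lambda>\<omega>. fact n * herm n V (S \<omega>)) \<in> L2 M"
    and "expectation (\<lambda>\<omega>. (elem n es \<omega> - fact n * herm n V (S \<omega>))\<^sup>2) \<le>
      fact n * (V ^ n - (LINT x|Rn n. (elementary_fun n es x)\<^sup>2))"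
proof -
  define a where "a l = h (t (Suc l))" for l
  define Q where "Q = (LINT x|Rn n. (elementary_fun n es x)\<^sup>2)"
  have V: "V = (\<Sum>l<L. (a l)\<^sup>2 * (t (Suc l) - t l))"
    unfolding V_def a_def by (rule grid_step_L2_norm[OF t h])
  have S: "S \<omega> = (\<Sum>l<L. a l * incr t l \<omega>)" for \<omega> by (simp add: S_def a_def)
  have Q: "Q = (\<Sum>f\<in>grid_inj n L. (\<Prod>i<n. a (f i)) * (\<Prod>i<n. a (f i) * (t (Suc (f i)) - t (f i))))"
    unfolding Q_def ef off_diagonal_part_norm[OF t] a_def by (simp add: power2_eq_square prod.distrib mult_ac)
  have I: "elem n es \<omega> = (\<Sum>f\<in>grid_inj n L. (\<Prod>i<n. a (f i)) * (\<Prod>i<n. incr t (f i) \<omega>))" for \<omega>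
    by (simp only: ei a_def incr_def)
  have Sm: "S \<in> borel_measurable M" unfolding S_def by measurable
  have HL: "(\<lambda>\<omega>. herm n V (S \<omega>)) \<in> L2 M"
  proof (rule L2_I)
    show "(\<lambda>\<omega>. herm n V (S \<omega>)) \<in> borel_measurable M" using Sm by measurable
    show "integrable M (\<lambda>\<omega>. (herm n V (S \<omega>))\<^sup>2)" unfolding V S by (rule herm_grid_norm(1)[OF t])
  qed
  then show HL': "(\<lambda>\<omega>. fact n * herm n V (S \<omega>)) \<in> L2 M" by (rule L2_cmult)
  have HH: "expectation (\<lambda>\<omega>. (herm n V (S \<omega>))\<^sup>2) = V ^ n / fact n"
    unfolding V S by (rule herm_grid_norm(2)[OF t])
  have IL: "elem n es \<in> L2 M" by (rule elem_L2[OF od])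
  have II: "expectation (\<lambda>\<omega>. (elem n es \<omega>)\<^sup>2) \<le> fact n * Q"
    unfolding Q_def by (rule is_integral_norm_le[OF is_integral_elem[OF od]])
  have IH: "expectation (\<lambda>\<omega>. herm n V (S \<omega>) * elem n es \<omega>) = Q"
  proof -
    have int: "integrable M (\<lambda>\<omega>. (\<Prod>i<n. a (f i)) * (herm n V (S \<omega>) * (\<Prod>i<n. incr t (f i) \<omega>)))"
      if "f \<in> grid_inj n L" for f
      unfolding V S by (intro integrable_mult_right herm_grid_inner(1)[OF t that])
    have "expectation (\<lambda>\<omega>. herm n V (S \<omega>) * elem n es \<omega>) =
        expectation (\<lambda>\<omega>. \<Sum>f\<in>grid_inj n L. (\<Prod>i<n. a (f i)) * (herm n V (S \<omega>) * (\<Prod>i<n. incr t (f i) \<omega>)))"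
      unfolding I sum_distrib_left by (simp only: mult_ac)
    also have "\<dots> = (\<Sum>f\<in>grid_inj n L. expectation (\<lambda>\<omega>. (\<Prod>i<n. a (f i)) * (herm n V (S \<omega>) * (\<Prod>i<n. incr t (f i) \<omega>))))"
      by (rule Bochner_Integration.integral_sum) (rule int)
    also have "\<dots> = Q"
      unfolding Q integral_mult_right_zero
      by (intro sum.cong refl) (simp only: V S herm_grid_inner(2)[OF t])
    finally show ?thesis .
  qed
  have "expectation (\<lambda>\<omega>. (elem n es \<omega> - fact n * herm n V (S \<omega>))\<^sup>2) =
      expectation (\<lambda>\<omega>. (elem n es \<omega>)\<^sup>2) - 2 * expectation (\<lambda>\<omega>. elem n es \<omega> * (fact n * herm n V (S \<omega>)))
      + expectation (\<lambda>\<omega>. (fact n * herm n V (S \<omega>))\<^sup>2)"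
    by (rule L2_diff_norm[OF IL HL'])
  also have "expectation (\<lambda>\<omega>. elem n es \<omega> * (fact n * herm n V (S \<omega>))) = fact n * Q"
    unfolding IH[symmetric] integral_mult_right_zero[symmetric] by (simp only: mult_ac)
  also have "expectation (\<lambda>\<omega>. (fact n * herm n V (S \<omega>))\<^sup>2) = fact n * V ^ n"
    unfolding power_mult_distrib integral_mult_right_zero HH by (simp add: power2_eq_square)
  finally show "expectation (\<lambda>\<omega>. (elem n es \<omega> - fact n * herm n V (S \<omega>))\<^sup>2) \<le> fact n * (V ^ n - (LINT x|Rn n. (elementary_fun n es x)\<^sup>2))"
    using II unfolding Q_def[symmetric] by (simp add: algebra_simps)
qed

lemma elementary_1_grid:
  assumes t: "is_grid t L" and od: "off_diagonal 1 es" and E: "endpoints 1 es \<subseteq> t ` {..L}"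
  defines "h \<equiv> \<lambda>u. elementary_fun 1 es (\<lambda>_. u)"
  shows "grid_step t L h" and "elem 1 es \<omega> = (\<Sum>l<L. h (t (Suc l)) * incr t l \<omega>)"
proof -
  have "grid_step t L (\<lambda>u. elementary_fun 1 es (\<lambda>_. u)) \<and>
    elem 1 es \<omega> = (\<Sum>l<L. elementary_fun 1 es (\<lambda>_. t (Suc l)) * incr t l \<omega>)"
    using od E
  proof (induction es)
    case Nil
    show ?case by (simp add: elementary_fun_def elementary_integral_def grid_step_def)
  next
    case (Cons e es)
    obtain c a b where e: "e = (c, a, b)" by (cases e)
    have "off_diagonal 1 es" "endpoints 1 es \<subseteq> t ` {..L}"
      using Cons.prems by (auto simp: off_diagonal_def endpoints_def)
    note IH = Cons.IH[OF this]
    have ab: "a 0 < b 0" "a 0 \<in> t ` {..L}" "b 0 \<in> t ` {..L}"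
      using Cons.prems by (auto simp: e off_diagonal_def endpoints_def)
    then obtain p q where p: "p \<le> L" "a 0 = t p" and q: "q \<le> L" "b 0 = t q" by auto
    have pq: "p < q" using grid_less_iff[OF t p(1) q(1)] ab p q by simp
    have 1: "elementary_fun 1 (e # es) (\<lambda>_. u) = c * indicator {a 0<..b 0} u + elementary_fun 1 es (\<lambda>_. u)" for u
      by (simp add: e elementary_fun_Cons)
    have 2: "elem 1 (e # es) \<omega> = c * (W (b 0) \<omega> - W (a 0) \<omega>) + elem 1 es \<omega>"
      by (simp add: e elementary_integral_Cons)
    have ind: "indicator {a 0<..b 0} (t (Suc l)) = (if l \<in> {p..<q} then 1 else 0 :: real)" if "l < L" for l
    proof -
      have "t p < t (Suc l) \<longleftrightarrow> p \<le> l" using grid_less_iff[OF t p(1), of "Suc l"] that by auto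
      moreover have "t (Suc l) \<le> t q \<longleftrightarrow> l < q" using grid_less_iff[OF t q(1), of "Suc l"] that by auto
      ultimately show ?thesis by (simp add: indicator_def p q)
    qed
    have "(\<Sum>l<L. indicator {a 0<..b 0} (t (Suc l)) * incr t l \<omega>) = (\<Sum>l<L. if l \<in> {p..<q} then incr t l \<omega> else 0)"
      by (intro sum.cong refl) (simp add: ind)
    also have "\<dots> = (\<Sum>l\<in>{..<L} \<inter> {p..<q}. incr t l \<omega>)"
      by (rule sum.inter_restrict[symmetric]) simp
    also have "{..<L} \<inter> {p..<q} = {p..<q}" using q by auto
    also have "(\<Sum>l\<in>{p..<q}. incr t l \<omega>) = W (b 0) \<omega> - W (a 0) \<omega>"
      unfolding p q by (rule incr_telescope[symmetric]) (use pq in simp)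
    finally have 3: "(\<Sum>l<L. indicator {a 0<..b 0} (t (Suc l)) * incr t l \<omega>) = W (b 0) \<omega> - W (a 0) \<omega>" .
    have "grid_step t L (\<lambda>u. c * indicator {a 0<..b 0} u + elementary_fun 1 es (\<lambda>_. u))"
      by (intro grid_step_add grid_step_cmult grid_step_indicator[OF t ab(2,3)] IH[THEN conjunct1])
    moreover have "c * (W (b 0) \<omega> - W (a 0) \<omega>) + elem 1 es \<omega> =
        (\<Sum>l<L. (c * indicator {a 0<..b 0} (t (Suc l)) + elementary_fun 1 es (\<lambda>_. t (Suc l))) * incr t l \<omega>)"
      unfolding 3[symmetric] IH[THEN conjunct2] distrib_right sum.distrib sum_distrib_left by (simp only: mult.assoc)
    ultimately show ?case unfolding 1 2 by (rule conjI)
  qed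
  then show "grid_step t L h" and "elem 1 es \<omega> = (\<Sum>l<L. h (t (Suc l)) * incr t l \<omega>)"
    unfolding h_def by simp_all
qed

lemma elementary_fun_1_L2: "(\<lambda>u. elementary_fun 1 es (\<lambda>_. u)) \<in> L2 lborel"
proof (induction es)
  case Nil
  then show ?case by (simp add: elementary_fun_def L2_zero)
next
  case (Cons e es)
  obtain c a b where e: "e = (c, a, b)" by (cases e)
  have "(\<lambda>u. c * indicator {a 0<..b 0} u + elementary_fun 1 es (\<lambda>_. u)) \<in> L2 lborel"
    by (intro L2_add L2_cmult indicator_Ioc_L2 Cons)
  then show ?case by (simp add: e elementary_fun_Cons)
qed

text \<open>On finer and finer grids the off-diagonal parts exhaust the tensor power, and by the preceding bound
  their integrals converge to the Hermite polynomial.\<close>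

lemma is_integral_tensor_power_step:
  assumes od: "off_diagonal 1 es"
  defines "h \<equiv> \<lambda>u. elementary_fun 1 es (\<lambda>_. u)"
  shows "is_integral n (\<lambda>x. \<Prod>i<n. h (x i)) (\<lambda>\<omega>. fact n * herm n (LINT u|lborel. (h u)\<^sup>2) (elem 1 es \<omega>))"
proof -
  define V where "V = (LINT u|lborel. (h u)\<^sup>2)"
  have hL: "h \<in> L2 lborel" unfolding h_def by (rule elementary_fun_1_L2)
  have "\<exists>t L. \<forall>k. is_grid (t k) (L k) \<and> endpoints 1 es \<subseteq> t k ` {..L k} \<and>
    (\<forall>l<L k. t k (Suc l) - t k l \<le> 1 / Suc k)" by (rule grid_sequence_exists[OF finite_endpoints])
  then obtain t L where tL: "\<forall>k. is_grid (t k) (L k) \<and> endpoints 1 es \<subseteq> t k ` {..L k} \<and>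
    (\<forall>l<L k. t k (Suc l) - t k l \<le> 1 / Suc k)" by (elim exE)
  have t: "is_grid (t k) (L k)" and E: "endpoints 1 es \<subseteq> t k ` {..L k}"
    and mesh: "\<And>l. l < L k \<Longrightarrow> t k (Suc l) - t k l \<le> 1 / Suc k" for k
    using tL by simp_all
  have step: "grid_step (t k) (L k) h" for k
    unfolding h_def by (rule elementary_1_grid(1)[OF t od E])
  have S: "elem 1 es \<omega> = (\<Sum>l<L k. h (t k (Suc l)) * incr (t k) l \<omega>)" for k \<omega>
    unfolding h_def by (rule elementary_1_grid(2)[OF t od E])
  have lim: "L2_tendsto (Rn n) (\<lambda>k. off_diagonal_part (t k) (L k) n (\<lambda>_. h)) (\<lambda>x. \<Prod>i<n. h (x i))"
    by (rule tensor_off_diagonal_limit[where h="\<lambda>_. h" and t=t and L=L]) (rule hL t mesh step | assumption)+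
  have "\<forall>k. \<exists>es'. off_diagonal n es' \<and> elementary_fun n es' = off_diagonal_part (t k) (L k) n (\<lambda>_. h) \<and>
    elem n es' = (\<lambda>\<omega>. \<Sum>f\<in>grid_inj n (L k). (\<Prod>i<n. h (t k (Suc (f i)))) *
       (\<Prod>i<n. W (t k (Suc (f i))) \<omega> - W (t k (f i)) \<omega>))"
    by (intro allI off_diagonal_part_elementary t)
  from choice[OF this] obtain es' where es': "\<forall>k. off_diagonal n (es' k) \<and>
    elementary_fun n (es' k) = off_diagonal_part (t k) (L k) n (\<lambda>_. h) \<and>
    elem n (es' k) = (\<lambda>\<omega>. \<Sum>f\<in>grid_inj n (L k). (\<Prod>i<n. h (t k (Suc (f i)))) *
       (\<Prod>i<n. W (t k (Suc (f i))) \<omega> - W (t k (f i)) \<omega>))" ..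
  have od': "off_diagonal n (es' k)" and ef: "elementary_fun n (es' k) = off_diagonal_part (t k) (L k) n (\<lambda>_. h)"
    and ei: "elem n (es' k) = (\<lambda>\<omega>. \<Sum>f\<in>grid_inj n (L k). (\<Prod>i<n. h (t k (Suc (f i)))) *
       (\<Prod>i<n. W (t k (Suc (f i))) \<omega> - W (t k (f i)) \<omega>))" for k
    using es' by simp_all
  have TL: "(\<lambda>x. \<Prod>i<n. h (x i)) \<in> L2 (Rn n)" by (rule Rn_prod_L2) (rule hL)
  have Tn: "(LINT x|Rn n. (\<Prod>i<n. h (x i))\<^sup>2) = V ^ n"
    using Rn_prod_inner[of n "\<lambda>_. h" "\<lambda>_. h"] hL by (simp add: power2_eq_square V_def)
  have dist: "expectation (\<lambda>\<omega>. (elem n (es' k) \<omega> - fact n * herm n V (elem 1 es \<omega>))\<^sup>2) \<le>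
      fact n * (V ^ n - (LINT x|Rn n. (elementary_fun n (es' k) x)\<^sup>2))" for k
    unfolding V_def S[of _ k] by (rule herm_off_diagonal_distance(2)[OF t step od' ef ei])
  have HL: "(\<lambda>\<omega>. fact n * herm n V (elem 1 es \<omega>)) \<in> L2 M"
    unfolding V_def S[of _ 0] by (rule herm_off_diagonal_distance(1)[OF t step od' ef ei])
  have lim': "L2_tendsto (Rn n) (\<lambda>k. elementary_fun n (es' k)) (\<lambda>x. \<Prod>i<n. h (x i))"
    unfolding ef by (rule lim)
  have "(\<lambda>k. LINT x|Rn n. (elementary_fun n (es' k) x)\<^sup>2) \<longlonglongrightarrow> V ^ n"
    unfolding Tn[symmetric] by (rule L2_norm_tendsto[OF elementary_fun_L2 TL lim'])
  then have "(\<lambda>k. fact n * (V ^ n - (LINT x|Rn n. (elementary_fun n (es' k) x)\<^sup>2))) \<longlonglongrightarrow> fact n * (V ^ n - V ^ n)"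
    by (intro tendsto_mult_left tendsto_diff tendsto_const)
  then have up: "(\<lambda>k. fact n * (V ^ n - (LINT x|Rn n. (elementary_fun n (es' k) x)\<^sup>2))) \<longlonglongrightarrow> 0" by simp
  have "L2_tendsto M (\<lambda>k. elem n (es' k)) (\<lambda>\<omega>. fact n * herm n V (elem 1 es \<omega>))"
  proof (rule tendsto_sandwich[OF _ _ tendsto_const up])
    show "\<forall>\<^sub>F k in sequentially. expectation (\<lambda>\<omega>. (elem n (es' k) \<omega> - fact n * herm n V (elem 1 es \<omega>))\<^sup>2) \<le>
        fact n * (V ^ n - (LINT x|Rn n. (elementary_fun n (es' k) x)\<^sup>2))"
      by (intro always_eventually allI dist)
    show "\<forall>\<^sub>F k in sequentially. 0 \<le> expectation (\<lambda>\<omega>. (elem n (es' k) \<omega> - fact n * herm n V (elem 1 es \<omega>))\<^sup>2)"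
      by (intro always_eventually allI Bochner_Integration.integral_nonneg zero_le_power2)
  qed
  then show ?thesis unfolding is_multiple_integral_def V_def[symmetric]
    by (intro conjI TL HL exI[of _ es'] allI od' lim')
qed

end

lemma Rn_1_integral:
  assumes "g \<in> borel_measurable lborel"
  shows "(LINT x|Rn 1. g (x 0)) = (LINT u|lborel. g u :: real)"
proof -
  have "{..<1} = {0::nat}" by auto
  then show ?thesis unfolding Rn_def using assms by (simp add: Rn_prod.product_integral_singleton)
qed

lemma tensor_power_L2: "h \<in> L2 lborel \<Longrightarrow> (\<lambda>x. \<Prod>i<n. h (x i)) \<in> L2 (Rn n)"
  by (rule Rn_prod_L2)

lemma tensor_power_inner:
  assumes "h \<in> L2 lborel" "g \<in> L2 lborel"
  shows "(LINT x|Rn n. (\<Prod>i<n. h (x i)) * (\<Prod>i<n. g (x i))) = (LINT u|lborel. h u * g u) ^ n"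
  using Rn_prod_inner[of n "\<lambda>_. h" "\<lambda>_. g"] assms by simp

text \<open>Inner products of tensor powers are powers of inner products on the line.\<close>

lemma tensor_power_tendsto:
  assumes H: "\<And>k. H k \<in> L2 lborel" and h: "h \<in> L2 lborel" and lim: "L2_tendsto lborel H h"
  shows "L2_tendsto (Rn n) (\<lambda>k x. \<Prod>i<n. H k (x i)) (\<lambda>x. \<Prod>i<n. h (x i))"
proof -
  define V where "V = (LINT u|lborel. h u * h u)"
  have eq: "(LINT x|Rn n. ((\<Prod>i<n. H k (x i)) - (\<Prod>i<n. h (x i)))\<^sup>2) =
      (LINT u|lborel. H k u * H k u) ^ n - 2 * (LINT u|lborel. H k u * h u) ^ n + V ^ n" for k
    unfolding L2_diff_norm[OF tensor_power_L2[OF H] tensor_power_L2[OF h]] V_def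
      tensor_power_inner[OF H h] tensor_power_inner[OF H H, symmetric] tensor_power_inner[OF h h, symmetric]
    by (simp only: power2_eq_square)
  have "(\<lambda>k. (LINT u|lborel. H k u * H k u) ^ n - 2 * (LINT u|lborel. H k u * h u) ^ n + V ^ n) \<longlonglongrightarrow>
      V ^ n - 2 * V ^ n + V ^ n"
    unfolding V_def
    by (intro tendsto_intros L2_inner_tendsto[OF H h lim H h lim] L2_inner_tendsto[OF H h lim h h L2_const_tendsto])
  then show ?thesis unfolding eq by simp
qed

text \<open>For step functions approximating \<open>h\<close>, the Hermite polynomials converge in mean square by continuity of
  the multiple integral; the limit is identified along an almost surely convergent subsequence.\<close>

lemma (in brownian) is_integral_tensor_power:
  assumes h: "h \<in> L2 lborel" and X: "is_integral 1 (\<lambda>x. h (x 0)) X"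
  shows "is_integral n (\<lambda>x. \<Prod>i<n. h (x i)) (\<lambda>\<omega>. fact n * herm n (LINT u|lborel. (h u)\<^sup>2) (X \<omega>))"
proof -
  obtain es where es: "(\<forall>k. off_diagonal 1 (es k)) \<and>
      L2_tendsto (Rn 1) (\<lambda>k. elementary_fun 1 (es k)) (\<lambda>x. h (x 0)) \<and> L2_tendsto M (\<lambda>k. elem 1 (es k)) X"
    using is_integral_approx[OF X] ..
  then have od: "off_diagonal 1 (es k)" for k by simp
  have Xlim: "L2_tendsto M (\<lambda>k. elem 1 (es k)) X" using es by simp
  define H where "H k u = elementary_fun 1 (es k) (\<lambda>_. u)" for k u
  have HL: "H k \<in> L2 lborel" for k unfolding H_def by (rule elementary_fun_1_L2)
  have eH: "elementary_fun 1 (es k) x = H k (x 0)" for k x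
    by (simp add: H_def elementary_fun_def)
  have Hlim: "L2_tendsto lborel H h"
  proof -
    have "(LINT x|Rn 1. (elementary_fun 1 (es k) x - h (x 0))\<^sup>2) = (LINT u|lborel. (H k u - h u)\<^sup>2)" for k
      unfolding eH by (rule Rn_1_integral[of "\<lambda>u. (H k u - h u)\<^sup>2"])
        (intro borel_measurable_power borel_measurable_diff L2_measurable[OF HL] L2_measurable[OF h])
    then show ?thesis using es by simp
  qed
  obtain Z where Z: "is_integral n (\<lambda>x. \<Prod>i<n. h (x i)) Z"
    using is_integral_exists[OF tensor_power_L2[OF h]] ..
  define V where "V k = (LINT u|lborel. (H k u)\<^sup>2)" for k
  have Vlim: "V \<longlonglongrightarrow> (LINT u|lborel. (h u)\<^sup>2)"
    unfolding V_def by (rule L2_norm_tendsto[OF HL h Hlim])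
  have Ik: "is_integral n (\<lambda>x. \<Prod>i<n. H k (x i)) (\<lambda>\<omega>. fact n * herm n (V k) (elem 1 (es k) \<omega>))" for k
    unfolding V_def H_def by (rule is_integral_tensor_power_step[OF od])
  have Zlim: "L2_tendsto M (\<lambda>k \<omega>. fact n * herm n (V k) (elem 1 (es k) \<omega>)) Z"
    by (rule is_integral_limit[OF Ik Z tensor_power_tendsto[OF HL h Hlim]])
  obtain r where r: "strict_mono r \<and> (AE \<omega> in M. (\<lambda>k. elem 1 (es (r k)) \<omega>) \<longlonglongrightarrow> X \<omega>)"
    using L2_tendsto_AE_subseq[OF elem_L2[OF od] is_integral_L2(2)[OF X] Xlim] ..
  have rm: "strict_mono r" using r by simp
  have Zlim': "L2_tendsto M (\<lambda>k \<omega>. fact n * herm n (V (r k)) (elem 1 (es (r k)) \<omega>)) Z"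
    using LIMSEQ_subseq_LIMSEQ[OF Zlim rm] by (simp only: o_def)
  obtain q where q: "strict_mono q \<and>
      (AE \<omega> in M. (\<lambda>k. fact n * herm n (V (r (q k))) (elem 1 (es (r (q k))) \<omega>)) \<longlonglongrightarrow> Z \<omega>)"
    using L2_tendsto_AE_subseq[OF is_integral_L2(2)[OF Ik] is_integral_L2(2)[OF Z] Zlim'] ..
  have qm: "strict_mono q" using q by simp
  have Vq: "(\<lambda>k. V (r (q k))) \<longlonglongrightarrow> (LINT u|lborel. (h u)\<^sup>2)"
    using LIMSEQ_subseq_LIMSEQ[OF LIMSEQ_subseq_LIMSEQ[OF Vlim rm] qm] by (simp only: o_def)
  have ae: "AE \<omega> in M. Z \<omega> = fact n * herm n (LINT u|lborel. (h u)\<^sup>2) (X \<omega>)"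
    using r[THEN conjunct2] q[THEN conjunct2]
  proof eventually_elim
    case (elim \<omega>)
    have "(\<lambda>k. elem 1 (es (r (q k))) \<omega>) \<longlonglongrightarrow> X \<omega>"
      using LIMSEQ_subseq_LIMSEQ[OF elim(1) qm] by (simp only: o_def)
    then have "(\<lambda>k. fact n * herm n (V (r (q k))) (elem 1 (es (r (q k))) \<omega>)) \<longlonglongrightarrow>
        fact n * herm n (LINT u|lborel. (h u)\<^sup>2) (X \<omega>)"
      by (intro tendsto_mult_left herm_continuous Vq)
    then show ?case by (rule LIMSEQ_unique[OF elim(2)])
  qed
  have m: "(\<lambda>\<omega>. fact n * herm n (LINT u|lborel. (h u)\<^sup>2) (X \<omega>)) \<in> borel_measurable M"
    using measurable_compose[OF L2_measurable[OF is_integral_L2(2)[OF X]] herm_measurable]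
    by (intro borel_measurable_times borel_measurable_const)
  show ?thesis
    by (rule is_integral_cong_AE[OF Z L2_measurable[OF tensor_power_L2[OF h]] AE_I2[OF refl] m ae])
qed

section \<open>Two functions: polarisation\<close>

text \<open>Up to the factor \<open>j! k!\<close>, the Hermite polynomial of two standard normal variables with
  correlation \<open>c\<close>: the coefficient of \<open>s\<^sup>j t\<^sup>k\<close> in \<open>exp (x s + y t - (s\<^sup>2 + t\<^sup>2) / 2 - c s t)\<close>.\<close>

definition herm2 :: "nat \<Rightarrow> nat \<Rightarrow> real \<Rightarrow> real \<Rightarrow> real \<Rightarrow> real" where
  "herm2 j k c x y = (\<Sum>r\<le>min j k. (- c) ^ r / fact r * herm (j - r) 1 x * herm (k - r) 1 y)"

lemma herm_at_0: "herm (2 * r) (2 * c) 0 = (- c) ^ r / fact r" "herm (Suc (2 * r)) (2 * c) 0 = 0"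
proof (induction r)
  case 0
  show "herm (2 * 0) (2 * c) 0 = (- c) ^ 0 / fact 0" by simp
  show "herm (Suc (2 * 0)) (2 * c) 0 = 0" by simp
next
  case (Suc r)
  have "herm (Suc (Suc (2 * r))) (2 * c) 0 = - (2 * c) * ((- c) ^ r / fact r) / real (Suc (Suc (2 * r)))"
    unfolding herm_rec' Suc by simp
  also have "real (Suc (Suc (2 * r))) = 2 * real (Suc r)" by simp
  also have "- (2 * c) * ((- c) ^ r / fact r) / (2 * real (Suc r)) = (- c) ^ Suc r / fact (Suc r)"
    by (simp add: divide_simps del: of_nat_Suc)
  finally show "herm (2 * Suc r) (2 * c) 0 = (- c) ^ Suc r / fact (Suc r)" by simp
  have "herm (Suc (Suc (Suc (2 * r)))) (2 * c) 0 = 0"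
    unfolding herm_rec'[of "Suc (2 * r)"] Suc by simp
  then show "herm (Suc (2 * Suc r)) (2 * c) 0 = 0" by simp
qed

text \<open>The generating function of the left-hand side is the product of those of \<open>l * x\<close> with variance \<open>l\<^sup>2\<close>, of \<open>y\<close>
  with variance 1, and of the point 0 with variance \<open>2 * (l * c)\<close>; the last one supplies the powers of \<open>- c\<close>.\<close>

lemma herm_polarisation:
  "herm n (l\<^sup>2 + 2 * (l * c) + 1) (l * x + y) = (\<Sum>i\<le>n. l ^ i * herm2 i (n - i) c x y)"
proof -
  define F where "F k = (\<Sum>a\<le>n - k. l ^ a * herm a 1 x * herm (n - k - a) 1 y)" for k
  have "herm n (2 * (l * c) + (l\<^sup>2 * 1 + 1)) (0 + (l * x + y)) =
      (\<Sum>k\<le>n. herm k (2 * (l * c)) 0 * F k)"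
    unfolding herm_add[of n] herm_add[of _ "l\<^sup>2 * 1"] herm_scale F_def by (simp only: sum_distrib_left)
  also have "\<dots> = (\<Sum>k\<in>(\<lambda>r. 2 * r) ` {..n div 2}. herm k (2 * (l * c)) 0 * F k)"
  proof (rule sum.mono_neutral_right)
    show "\<forall>k\<in>{..n} - (\<lambda>r. 2 * r) ` {..n div 2}. herm k (2 * (l * c)) 0 * F k = 0"
    proof
      fix k assume k: "k \<in> {..n} - (\<lambda>r. 2 * r) ` {..n div 2}"
      have "odd k"
      proof
        assume "even k"
        then obtain r where "k = 2 * r" ..
        then show False using k by auto
      qed
      then obtain r where "k = Suc (2 * r)" by (metis oddE Suc_eq_plus1)
      then show "herm k (2 * (l * c)) 0 * F k = 0" by (simp add: herm_at_0)
    qed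
  qed auto
  also have "\<dots> = (\<Sum>r\<le>n div 2. (- (l * c)) ^ r / fact r * F (2 * r))"
    by (subst sum.reindex) (simp_all add: inj_on_def herm_at_0)
  also have "\<dots> = (\<Sum>r\<le>n div 2. \<Sum>a\<le>n - 2 * r. (- (l * c)) ^ r / fact r * (l ^ a * herm a 1 x * herm (n - 2 * r - a) 1 y))"
    unfolding F_def by (simp only: sum_distrib_left)
  also have "\<dots> = (\<Sum>(r, a)\<in>(SIGMA r:{..n div 2}. {..n - 2 * r}).
      (- (l * c)) ^ r / fact r * (l ^ a * herm a 1 x * herm (n - 2 * r - a) 1 y))"
    by (rule sum.Sigma) auto
  also have "\<dots> = (\<Sum>(i, r)\<in>(SIGMA i:{..n}. {..min i (n - i)}).
      l ^ i * ((- c) ^ r / fact r * herm (i - r) 1 x * herm (n - i - r) 1 y))"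
  proof (rule sum.reindex_bij_witness[of _ "\<lambda>(i, r). (r, i - r)" "\<lambda>(r, a). (a + r, r)"])
    fix p assume p: "p \<in> (SIGMA r:{..n div 2}. {..n - 2 * r})"
    obtain r a where ra: "p = (r, a)" by (cases p)
    have le: "2 * r \<le> n" "a \<le> n - 2 * r" using p by (auto simp: ra)
    have "n - (a + r) - r = n - 2 * r - a" by simp
    then show "(case (case p of (r, a) \<Rightarrow> (a + r, r)) of (i, r) \<Rightarrow>
        l ^ i * ((- c) ^ r / fact r * herm (i - r) 1 x * herm (n - i - r) 1 y)) =
      (case p of (r, a) \<Rightarrow> (- (l * c)) ^ r / fact r * (l ^ a * herm a 1 x * herm (n - 2 * r - a) 1 y))"
      by (simp add: ra power_add power_mult_distrib power_minus[of "l * c"] power_minus[of c])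
  qed (auto simp: less_eq_div_iff_mult_less_eq)
  also have "\<dots> = (\<Sum>i\<le>n. \<Sum>r\<le>min i (n - i). l ^ i * ((- c) ^ r / fact r * herm (i - r) 1 x * herm (n - i - r) 1 y))"
    by (rule sum.Sigma[symmetric]) auto
  also have "\<dots> = (\<Sum>i\<le>n. l ^ i * herm2 i (n - i) c x y)"
    by (simp only: herm2_def sum_distrib_left)
  finally show ?thesis by (simp add: ac_simps)
qed

text \<open>Inverts the definition of \<open>herm2\<close>: the series \<open>exp (c * u)\<close> and \<open>exp (- c * u)\<close> cancel.\<close>

lemma herm_mult_herm: "herm m 1 x * herm m 1 y = (\<Sum>r\<le>m. c ^ r / fact r * herm2 (m - r) (m - r) c x y)"
proof -
  define A where "A q = herm (m - q) 1 x * herm (m - q) 1 y" for q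
  have "(\<Sum>r\<le>m. c ^ r / fact r * herm2 (m - r) (m - r) c x y) =
      (\<Sum>r\<le>m. \<Sum>s\<le>m - r. (c ^ r / fact r * ((- c) ^ s / fact s)) * A (r + s))"
    by (simp add: herm2_def A_def sum_distrib_left mult.assoc)
  also have "\<dots> = (\<Sum>(r, s)\<in>(SIGMA r:{..m}. {..m - r}). (c ^ r / fact r * ((- c) ^ s / fact s)) * A (r + s))"
    by (rule sum.Sigma) auto
  also have "\<dots> = (\<Sum>(q, r)\<in>(SIGMA q:{..m}. {..q}). (c ^ r / fact r * ((- c) ^ (q - r) / fact (q - r))) * A q)"
    by (rule sum.reindex_bij_witness[of _ "\<lambda>(q, r). (r, q - r)" "\<lambda>(r, s). (r + s, r)"]) auto
  also have "\<dots> = (\<Sum>q\<le>m. \<Sum>r\<le>q. (c ^ r / fact r * ((- c) ^ (q - r) / fact (q - r))) * A q)"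
    by (rule sum.Sigma[symmetric]) auto
  also have "\<dots> = (\<Sum>q\<le>m. fps_nth (fps_exp c * fps_exp (- c)) q * A q)"
    by (simp add: fps_mult_nth atLeast0AtMost sum_distrib_right)
  also have "fps_exp c * fps_exp (- c) = (1 :: real fps)"
    by (simp flip: fps_exp_add_mult)
  also have "(\<Sum>q\<le>m. fps_nth 1 q * A q) = A 0"
    by (simp add: if_distrib[of "\<lambda>z. z * _"] cong: if_cong)
  finally show ?thesis by (simp add: A_def)
qed

text \<open>The tensor product whose factors are \<open>h\<close> at the coordinates in \<open>S\<close> and \<open>g\<close> elsewhere.\<close>

definition mixed :: "nat \<Rightarrow> (real \<Rightarrow> real) \<Rightarrow> (real \<Rightarrow> real) \<Rightarrow> nat set \<Rightarrow> (nat \<Rightarrow> real) \<Rightarrow> real" where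
  "mixed n h g S x = (\<Prod>i<n. if i \<in> S then h (x i) else g (x i))"

lemma mixed_L2:
  assumes "h \<in> L2 lborel" "g \<in> L2 lborel"
  shows "mixed n h g S \<in> L2 (Rn n)"
proof -
  have "(\<lambda>x. \<Prod>i<n. (if i \<in> S then h else g) (x i)) \<in> L2 (Rn n)"
    by (rule Rn_prod_L2) (use assms in simp)
  also have "(\<lambda>x. \<Prod>i<n. (if i \<in> S then h else g) (x i)) = mixed n h g S"
    by (auto simp: mixed_def fun_eq_iff intro!: prod.cong)
  finally show ?thesis .
qed

lemma permutation_onto_subset:
  assumes "S \<subseteq> {..<n}"
  shows "\<exists>\<sigma>. \<sigma> permutes {..<n} \<and> (\<forall>i<n. \<sigma> i \<in> S \<longleftrightarrow> i < card S)"
proof -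
  have fS: "finite S" using assms finite_subset by blast
  have cS: "card S \<le> n" using card_mono[OF _ assms] by simp
  obtain f where f: "bij_betw f {..<card S} S"
    using finite_same_card_bij[of "{..<card S}" S] fS by auto
  have "card ({..<n} - S) = card {card S..<n}" using assms fS by (simp add: card_Diff_subset)
  then obtain g where g: "bij_betw g {card S..<n} ({..<n} - S)"
    using finite_same_card_bij[of "{card S..<n}" "{..<n} - S"] by auto
  define \<sigma> where "\<sigma> i = (if i < card S then f i else if i < n then g i else i)" for i
  have 1: "bij_betw \<sigma> {..<card S} S"
    using f by (rule bij_betw_cong[THEN iffD1, rotated]) (simp add: \<sigma>_def)
  have 2: "bij_betw \<sigma> {card S..<n} ({..<n} - S)"
    using g by (rule bij_betw_cong[THEN iffD1, rotated]) (simp add: \<sigma>_def)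
  have "bij_betw \<sigma> ({..<card S} \<union> {card S..<n}) (S \<union> ({..<n} - S))"
    by (rule bij_betw_combine[OF 1 2]) auto
  moreover have "{..<card S} \<union> {card S..<n} = {..<n}" "S \<union> ({..<n} - S) = {..<n}"
    using cS assms by auto
  ultimately have "bij_betw \<sigma> {..<n} {..<n}" by simp
  then have "\<sigma> permutes {..<n}"
    by (rule bij_imp_permutes) (use cS in \<open>simp add: \<sigma>_def\<close>)
  moreover have "\<sigma> i \<in> S \<longleftrightarrow> i < card S" if "i < n" for i
  proof (cases "i < card S")
    case True
    then show ?thesis using bij_betwE[OF 1] by simp
  next
    case False
    then have "\<sigma> i \<in> {..<n} - S" using bij_betwE[OF 2] that by simp
    then show ?thesis using False by simp
  qed
  ultimately show ?thesis by (intro exI[of _ \<sigma>] conjI allI impI)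
qed

lemma mixed_permute:
  assumes p: "\<sigma> permutes {..<n}" and s: "\<And>i. i < n \<Longrightarrow> \<sigma> i \<in> S \<longleftrightarrow> i < j"
  shows "mixed n h g {..<j} (x \<circ> \<sigma>) = mixed n h g S x"
proof -
  have "mixed n h g S x = (\<Prod>i<n. if \<sigma> i \<in> S then h (x (\<sigma> i)) else g (x (\<sigma> i)))"
    unfolding mixed_def
    using prod.permute[OF p, of "\<lambda>i. if i \<in> S then h (x i) else g (x i)"] by (simp only: o_def)
  also have "\<dots> = mixed n h g {..<j} (x \<circ> \<sigma>)"
    unfolding mixed_def by (intro prod.cong refl) (simp add: s)
  finally show ?thesis ..
qed

lemma prod_add_mixed:
  "(\<Prod>i<n. l * h (x i) + g (x i)) = (\<Sum>S\<in>Pow {..<n}. l ^ card S * mixed n h g S x)"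
proof -
  have "(\<Prod>i<n. l * h (x i) + g (x i)) =
      (\<Sum>S\<in>Pow {..<n}. (\<Prod>i\<in>S. l * h (x i)) * (\<Prod>i\<in>{..<n} - S. g (x i)))"
    by (rule prod_add) simp
  also have "\<dots> = (\<Sum>S\<in>Pow {..<n}. l ^ card S * mixed n h g S x)"
  proof (intro sum.cong refl)
    fix S assume S: "S \<in> Pow {..<n}"
    then have fS: "finite S" using finite_subset by auto
    have "mixed n h g S x = (\<Prod>i\<in>S. if i \<in> S then h (x i) else g (x i)) *
        (\<Prod>i\<in>{..<n} - S. if i \<in> S then h (x i) else g (x i))"
      unfolding mixed_def using S by (subst mult.commute) (intro prod.subset_diff, auto)
    also have "\<dots> = (\<Prod>i\<in>S. h (x i)) * (\<Prod>i\<in>{..<n} - S. g (x i))"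
      by (intro arg_cong2[where f="(*)"] prod.cong) auto
    finally show "(\<Prod>i\<in>S. l * h (x i)) * (\<Prod>i\<in>{..<n} - S. g (x i)) = l ^ card S * mixed n h g S x"
      by (simp add: prod.distrib mult.assoc)
  qed
  finally show ?thesis .
qed

lemma sum_Pow_card:
  fixes F :: "nat \<Rightarrow> real"
  shows "(\<Sum>S\<in>Pow {..<n}. F (card S)) = (\<Sum>i\<le>n. real (n choose i) * F i)"
proof -
  have "(\<Sum>S\<in>Pow {..<n}. F (card S)) = (\<Sum>i\<in>{..n}. \<Sum>S\<in>{S \<in> Pow {..<n}. card S = i}. F (card S))"
  proof (rule sum.group[symmetric])
    show "card ` Pow {..<n} \<subseteq> {..n}" using card_mono[of "{..<n}"] by fastforce
  qed auto
  also have "\<dots> = (\<Sum>i\<le>n. real (n choose i) * F i)"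
  proof (intro sum.cong refl)
    fix i
    have "{S \<in> Pow {..<n}. card S = i} = {S. S \<subseteq> {..<n} \<and> card S = i}" by auto
    then have "card {S \<in> Pow {..<n}. card S = i} = n choose i" using n_subsets[of "{..<n}" i] by simp
    then show "(\<Sum>S\<in>{S \<in> Pow {..<n}. card S = i}. F (card S)) = real (n choose i) * F i" by simp
  qed
  finally show ?thesis .
qed

text \<open>Polarisation: the tensor power of \<open>l * h + g\<close> is a polynomial in \<open>l\<close> whose coefficients are sums of permuted
  copies of the mixed products. Comparing with \<open>herm_polarisation\<close> at every natural number \<open>l\<close>
  identifies the integrals of the coefficients.\<close>

lemma (in brownian) is_integral_mixed:
  assumes h: "h \<in> L2 lborel" and g: "g \<in> L2 lborel"
    and h1: "(LINT u|lborel. (h u)\<^sup>2) = 1" and g1: "(LINT u|lborel. (g u)\<^sup>2) = 1"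
    and X: "is_integral 1 (\<lambda>x. h (x 0)) X" and Y: "is_integral 1 (\<lambda>x. g (x 0)) Y"
    and j: "j \<le> n"
  shows "is_integral n (mixed n h g {..<j})
    (\<lambda>\<omega>. fact j * fact (n - j) * herm2 j (n - j) (LINT u|lborel. h u * g u) (X \<omega>) (Y \<omega>))"
proof -
  define c where "c = (LINT u|lborel. h u * g u)"
  define J where "J i = multiple_integral M W n (mixed n h g {..<i})" for i
  have J: "is_integral n (mixed n h g {..<i}) (J i)" for i
    unfolding J_def by (rule is_integral_multiple_integral[OF mixed_L2[OF h g]])
  have JS: "is_integral n (mixed n h g S) (J (card S))" if "S \<in> Pow {..<n}" for S
  proof -
    obtain \<sigma> where "\<sigma> permutes {..<n} \<and> (\<forall>i<n. \<sigma> i \<in> S \<longleftrightarrow> i < card S)"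
      using permutation_onto_subset[of S n] \<open>S \<in> Pow {..<n}\<close> by auto
    then have p: "\<sigma> permutes {..<n}" and s: "\<And>i. i < n \<Longrightarrow> \<sigma> i \<in> S \<longleftrightarrow> i < card S" by simp_all
    have "(\<lambda>x. mixed n h g {..<card S} (x \<circ> \<sigma>)) = mixed n h g S"
      using mixed_permute[OF p s] by (intro ext)
    then show ?thesis using is_integral_permute[OF p J[of "card S"]] by simp
  qed
  have "AE \<omega> in M. (\<Sum>i\<le>n. (fact n * herm2 i (n - i) c (X \<omega>) (Y \<omega>) - real (n choose i) * J i \<omega>) * real l ^ i) = 0" for l :: nat
  proof -
    define u where "u v = real l * h v + g v" for v
    have uL: "u \<in> L2 lborel" unfolding u_def by (intro L2_add L2_cmult h g)
    have un: "(LINT v|lborel. (u v)\<^sup>2) = (real l)\<^sup>2 + 2 * (real l * c) + 1"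
    proof -
      have "(LINT v|lborel. (u v)\<^sup>2) =
          (LINT v|lborel. ((real l)\<^sup>2 * (h v)\<^sup>2 + (2 * real l) * (h v * g v)) + (g v)\<^sup>2)"
        unfolding u_def by (intro Bochner_Integration.integral_cong refl) (simp add: power2_eq_square algebra_simps)
      also have "\<dots> = (LINT v|lborel. (real l)\<^sup>2 * (h v)\<^sup>2 + (2 * real l) * (h v * g v)) + (LINT v|lborel. (g v)\<^sup>2)"
        by (intro Bochner_Integration.integral_add Bochner_Integration.integrable_add integrable_mult_right
            L2_square_integrable L2_mult_integrable h g)
      also have "(LINT v|lborel. (real l)\<^sup>2 * (h v)\<^sup>2 + (2 * real l) * (h v * g v)) =
          (LINT v|lborel. (real l)\<^sup>2 * (h v)\<^sup>2) + (LINT v|lborel. (2 * real l) * (h v * g v))"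
        by (intro Bochner_Integration.integral_add integrable_mult_right L2_square_integrable L2_mult_integrable h g)
      finally show ?thesis by (simp add: h1 g1 c_def)
    qed
    have uI: "is_integral 1 (\<lambda>x. u (x 0)) (\<lambda>\<omega>. real l * X \<omega> + Y \<omega>)"
      unfolding u_def by (intro is_integral_add is_integral_cmult X Y)
    have 1: "is_integral n (\<lambda>x. \<Prod>i<n. u (x i))
        (\<lambda>\<omega>. fact n * herm n ((real l)\<^sup>2 + 2 * (real l * c) + 1) (real l * X \<omega> + Y \<omega>))"
      using is_integral_tensor_power[OF uL uI, of n] unfolding un .
    have 2: "is_integral n (\<lambda>x. \<Prod>i<n. u (x i)) (\<lambda>\<omega>. \<Sum>S\<in>Pow {..<n}. real l ^ card S * J (card S) \<omega>)"
      unfolding u_def prod_add_mixed by (intro is_integral_sum is_integral_cmult JS)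
    show ?thesis
      using is_integral_unique[OF 1 2]
    proof eventually_elim
      case (elim \<omega>)
      have "(\<Sum>i\<le>n. fact n * (real l ^ i * herm2 i (n - i) c (X \<omega>) (Y \<omega>))) =
          (\<Sum>i\<le>n. real (n choose i) * (real l ^ i * J i \<omega>))"
        using elim unfolding herm_polarisation sum_Pow_card[of "\<lambda>i. real l ^ i * J i \<omega>"] sum_distrib_left .
      then have "(\<Sum>i\<le>n. fact n * (real l ^ i * herm2 i (n - i) c (X \<omega>) (Y \<omega>)) -
          real (n choose i) * (real l ^ i * J i \<omega>)) = 0"
        unfolding sum_subtractf by simp
      moreover have "fact n * (real l ^ i * herm2 i (n - i) c (X \<omega>) (Y \<omega>)) - real (n choose i) * (real l ^ i * J i \<omega>) =
          (fact n * herm2 i (n - i) c (X \<omega>) (Y \<omega>) - real (n choose i) * J i \<omega>) * real l ^ i" for i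
        by (simp add: algebra_simps)
      ultimately show ?case by simp
    qed
  qed
  then have "AE \<omega> in M. \<forall>l::nat. (\<Sum>i\<le>n. (fact n * herm2 i (n - i) c (X \<omega>) (Y \<omega>) - real (n choose i) * J i \<omega>) * real l ^ i) = 0"
    by (simp only: AE_all_countable) simp
  then have ae: "AE \<omega> in M. J j \<omega> = fact j * fact (n - j) * herm2 j (n - j) c (X \<omega>) (Y \<omega>)"
  proof eventually_elim
    case (elim \<omega>)
    define b where "b i = fact n * herm2 i (n - i) c (X \<omega>) (Y \<omega>) - real (n choose i) * J i \<omega>" for i
    have "real ` (UNIV :: nat set) \<subseteq> {z. (\<Sum>i\<le>n. b i * z ^ i) = 0}"
      using elim by (auto simp: b_def)
    moreover have "infinite (real ` (UNIV :: nat set))"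
      using finite_imageD[of real UNIV] by (auto simp: inj_on_def)
    ultimately have "infinite {z. (\<Sum>i\<le>n. b i * z ^ i) = 0}"
      using finite_subset by blast
    then have "b j = 0" using polyfun_finite_roots[of b n] j by auto
    then have "real (n choose j) * J j \<omega> = fact n * herm2 j (n - j) c (X \<omega>) (Y \<omega>)" by (simp add: b_def)
    moreover have "(fact n :: real) = real (n choose j) * (fact j * fact (n - j))"
      using binomial_fact_lemma[OF j] by (metis mult.commute of_nat_fact of_nat_mult)
    moreover have "real (n choose j) \<noteq> 0" using j by simp
    ultimately show ?case by simp
  qed
  have m: "(\<lambda>\<omega>. fact j * fact (n - j) * herm2 j (n - j) c (X \<omega>) (Y \<omega>)) \<in> borel_measurable M"
    unfolding herm2_def
    using measurable_compose[OF L2_measurable[OF is_integral_L2(2)[OF X]] herm_measurable]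
      measurable_compose[OF L2_measurable[OF is_integral_L2(2)[OF Y]] herm_measurable]
    by (intro borel_measurable_times borel_measurable_const borel_measurable_sum)
  have "is_integral n (mixed n h g {..<j})
      (\<lambda>\<omega>. fact j * fact (n - j) * herm2 j (n - j) c (X \<omega>) (Y \<omega>))"
    by (rule is_integral_cong_AE[OF J L2_measurable[OF mixed_L2[OF h g]] AE_I2[OF refl] m ae])
  then show ?thesis unfolding c_def .
qed

section \<open>Integration of square-integrable families\<close>

lemma (in finite_measure) L2_integrable:
  assumes "f \<in> L2 M"
  shows "integrable M f" and "(LINT x|M. f x)\<^sup>2 \<le> measure M (space M) * (LINT x|M. (f x)\<^sup>2)"
proof -
  have one: "(\<lambda>x. 1) \<in> L2 M" by (rule L2_I) simp_all
  show "integrable M f" using L2_mult_integrable[OF assms one] by simp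
  show "(LINT x|M. f x)\<^sup>2 \<le> measure M (space M) * (LINT x|M. (f x)\<^sup>2)"
    using L2_Cauchy_Schwarz[OF assms one] by (simp add: mult.commute)
qed

text \<open>Families indexed by a finite measure space with bounded norms: the square is integrable on the product
  space, so that Fubini's theorem applies to the family and to its products with fixed functions.\<close>

locale L2_family = finite_measure \<Theta> + N: sigma_finite_measure N
  for \<Theta> :: "'t measure" and N :: "'a measure" +
  fixes F :: "'t \<Rightarrow> 'a \<Rightarrow> real" and C :: real
  assumes meas: "(\<lambda>(\<theta>, x). F \<theta> x) \<in> borel_measurable (\<Theta> \<Otimes>\<^sub>M N)"
    and L2: "\<And>\<theta>. \<theta> \<in> space \<Theta> \<Longrightarrow> F \<theta> \<in> L2 N"
    and bound: "\<And>\<theta>. \<theta> \<in> space \<Theta> \<Longrightarrow> (LINT x|N. (F \<theta> x)\<^sup>2) \<le> C"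
begin

sublocale pair_sigma_finite \<Theta> N
  by (intro pair_sigma_finite.intro sigma_finite_measure_axioms N.sigma_finite_measure_axioms)

lemma square_measurable: "(\<lambda>(\<theta>, x). (F \<theta> x)\<^sup>2) \<in> borel_measurable (\<Theta> \<Otimes>\<^sub>M N)"
  using borel_measurable_power[OF meas, of 2] by (simp add: case_prod_unfold)

lemma joint_L2: "(\<lambda>(\<theta>, x). F \<theta> x) \<in> L2 (\<Theta> \<Otimes>\<^sub>M N)"
proof (rule L2_I[OF meas])
  have "integrable (\<Theta> \<Otimes>\<^sub>M N) (\<lambda>(\<theta>, x). (F \<theta> x)\<^sup>2)"
  proof (rule Fubini_integrable[OF square_measurable])
    show "integrable \<Theta> (\<lambda>\<theta>. LINT x|N. norm (case (\<theta>, x) of (\<theta>, x) \<Rightarrow> (F \<theta> x)\<^sup>2))"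
    proof (rule integrable_const_bound)
      show "AE \<theta> in \<Theta>. norm (LINT x|N. norm (case (\<theta>, x) of (\<theta>, x) \<Rightarrow> (F \<theta> x)\<^sup>2)) \<le> C"
        using bound by (intro AE_I2) simp
      have "(\<lambda>(\<theta>, x). norm ((F \<theta> x)\<^sup>2)) \<in> borel_measurable (\<Theta> \<Otimes>\<^sub>M N)"
        using square_measurable by simp
      from N.borel_measurable_lebesgue_integral[OF this]
      show "(\<lambda>\<theta>. LINT x|N. norm (case (\<theta>, x) of (\<theta>, x) \<Rightarrow> (F \<theta> x)\<^sup>2)) \<in> borel_measurable \<Theta>"
        by simp
    qed
    show "AE \<theta> in \<Theta>. integrable N (\<lambda>x. case (\<theta>, x) of (\<theta>, x) \<Rightarrow> (F \<theta> x)\<^sup>2)"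
      using L2 by (intro AE_I2) (simp add: L2_square_integrable)
  qed
  then show "integrable (\<Theta> \<Otimes>\<^sub>M N) (\<lambda>z. (case z of (\<theta>, x) \<Rightarrow> F \<theta> x)\<^sup>2)"
    by (simp add: case_prod_unfold)
qed

lemma AE_section_L2: "AE x in N. (\<lambda>\<theta>. F \<theta> x) \<in> L2 \<Theta>"
proof -
  have "integrable (\<Theta> \<Otimes>\<^sub>M N) (\<lambda>(\<theta>, x). (F \<theta> x)\<^sup>2)"
    using L2_square_integrable[OF joint_L2] by (simp add: case_prod_unfold)
  from AE_integrable_snd[OF this] show ?thesis
    using AE_space
  proof eventually_elim
    case (elim x)
    have "(\<lambda>\<theta>. (\<theta>, x)) \<in> measurable \<Theta> (\<Theta> \<Otimes>\<^sub>M N)" using elim(2) by measurable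
    from measurable_compose[OF this meas] have "(\<lambda>\<theta>. F \<theta> x) \<in> borel_measurable \<Theta>" by simp
    then show ?case using elim(1) by (intro L2_I)
  qed
qed

lemma average_measurable: "(\<lambda>x. LINT \<theta>|\<Theta>. F \<theta> x) \<in> borel_measurable N"
proof -
  have "sigma_finite_measure \<Theta>" by unfold_locales
  have "(\<lambda>z. (snd z, fst z)) \<in> measurable (N \<Otimes>\<^sub>M \<Theta>) (\<Theta> \<Otimes>\<^sub>M N)" by measurable
  from measurable_compose[OF this meas] have "(\<lambda>(x, \<theta>). F \<theta> x) \<in> borel_measurable (N \<Otimes>\<^sub>M \<Theta>)"
    by (simp add: case_prod_unfold)
  with \<open>sigma_finite_measure \<Theta>\<close> show ?thesis
    by (rule sigma_finite_measure.borel_measurable_lebesgue_integral[where f="\<lambda>x \<theta>. F \<theta> x"])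
qed

lemma average_L2: "(\<lambda>x. LINT \<theta>|\<Theta>. F \<theta> x) \<in> L2 N"
proof (rule L2_I[OF average_measurable])
  have sq: "integrable (\<Theta> \<Otimes>\<^sub>M N) (\<lambda>(\<theta>, x). (F \<theta> x)\<^sup>2)"
    using L2_square_integrable[OF joint_L2] by (simp add: case_prod_unfold)
  show "integrable N (\<lambda>x. (LINT \<theta>|\<Theta>. F \<theta> x)\<^sup>2)"
  proof (rule Bochner_Integration.integrable_bound)
    show "integrable N (\<lambda>x. measure \<Theta> (space \<Theta>) * (LINT \<theta>|\<Theta>. (F \<theta> x)\<^sup>2))"
      by (intro integrable_mult_right integrable_snd[OF sq])
    show "AE x in N. norm ((LINT \<theta>|\<Theta>. F \<theta> x)\<^sup>2) \<le> norm (measure \<Theta> (space \<Theta>) * (LINT \<theta>|\<Theta>. (F \<theta> x)\<^sup>2))"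
      using AE_section_L2
    proof eventually_elim
      case (elim x)
      then show ?case using L2_integrable(2)[OF elim] by simp
    qed
    show "(\<lambda>x. (LINT \<theta>|\<Theta>. F \<theta> x)\<^sup>2) \<in> borel_measurable N"
      by (intro borel_measurable_power average_measurable)
  qed
qed

lemma average_inner:
  assumes V: "V \<in> L2 N"
  shows "(LINT x|N. (LINT \<theta>|\<Theta>. F \<theta> x) * V x) = (LINT \<theta>|\<Theta>. LINT x|N. F \<theta> x * V x)"
proof -
  have Vm: "(\<lambda>(\<theta>, x). (V x)\<^sup>2) \<in> borel_measurable (\<Theta> \<Otimes>\<^sub>M N)"
    using measurable_compose[OF measurable_snd L2_measurable[OF V], of \<Theta>]
    by (simp add: case_prod_unfold)
  have VL: "(\<lambda>(\<theta>, x). V x) \<in> L2 (\<Theta> \<Otimes>\<^sub>M N)"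
  proof (rule L2_I)
    show "(\<lambda>(\<theta>, x). V x) \<in> borel_measurable (\<Theta> \<Otimes>\<^sub>M N)"
      using measurable_compose[OF measurable_snd L2_measurable[OF V], of \<Theta>] by (simp add: case_prod_unfold)
    have "integrable (\<Theta> \<Otimes>\<^sub>M N) (\<lambda>(\<theta>, x). (V x)\<^sup>2)"
      by (rule Fubini_integrable[OF Vm]) (simp_all add: L2_square_integrable[OF V])
    then show "integrable (\<Theta> \<Otimes>\<^sub>M N) (\<lambda>z. (case z of (\<theta>, x) \<Rightarrow> V x)\<^sup>2)"
      by (simp add: case_prod_unfold)
  qed
  have "integrable (\<Theta> \<Otimes>\<^sub>M N) (\<lambda>(\<theta>, x). F \<theta> x * V x)"
    using L2_mult_integrable[OF joint_L2 VL] by (simp add: case_prod_unfold)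
  from Fubini_integral[OF this] show ?thesis by simp
qed

end

text \<open>By Fubini's theorem and the isometry, the difference of the average of the \<open>Z \<theta>\<close> and the integral of the
  averaged kernel is orthogonal to every multiple integral of order \<open>n\<close>. It is thus orthogonal to each
  \<open>Z \<theta>\<close>, hence to their average, and finally to itself.\<close>

lemma (in brownian) is_integral_average:
  assumes "finite_measure \<Theta>"
    and I: "\<And>\<theta>. \<theta> \<in> space \<Theta> \<Longrightarrow> is_integral n (f \<theta>) (Z \<theta>)"
    and f: "(\<lambda>(\<theta>, x). f \<theta> x) \<in> borel_measurable (\<Theta> \<Otimes>\<^sub>M Rn n)"
    and Z: "(\<lambda>(\<theta>, \<omega>). Z \<theta> \<omega>) \<in> borel_measurable (\<Theta> \<Otimes>\<^sub>M M)"
    and C: "\<And>\<theta>. \<theta> \<in> space \<Theta> \<Longrightarrow> (LINT x|Rn n. (f \<theta> x)\<^sup>2) \<le> C"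
  shows "is_integral n (\<lambda>x. LINT \<theta>|\<Theta>. f \<theta> x) (\<lambda>\<omega>. LINT \<theta>|\<Theta>. Z \<theta> \<omega>)"
proof -
  interpret \<Theta>: finite_measure \<Theta> by fact
  interpret Rn: sigma_finite_measure "Rn n" by (rule sigma_finite_Rn)
  interpret f: L2_family \<Theta> "Rn n" f C
    by unfold_locales (use f is_integral_L2(1)[OF I] C in auto)
  interpret Z: L2_family \<Theta> M Z "fact n * C"
  proof unfold_locales
    show "expectation (\<lambda>\<omega>. (Z \<theta> \<omega>)\<^sup>2) \<le> fact n * C" if "\<theta> \<in> space \<Theta>" for \<theta>
    proof -
      have "fact n * (LINT x|Rn n. (f \<theta> x)\<^sup>2) \<le> fact n * C"
        by (rule mult_left_mono[OF C[OF that]]) simp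
      with is_integral_norm_le[OF I[OF that]] show ?thesis by (rule order_trans)
    qed
  qed (use Z is_integral_L2(2)[OF I] in auto)
  define fa where "fa x = (LINT \<theta>|\<Theta>. f \<theta> x)" for x
  define Za where "Za \<omega> = (LINT \<theta>|\<Theta>. Z \<theta> \<omega>)" for \<omega>
  have fL: "fa \<in> L2 (Rn n)" unfolding fa_def[abs_def] by (rule f.average_L2)
  have ZL: "Za \<in> L2 M" unfolding Za_def[abs_def] by (rule Z.average_L2)
  obtain U where U: "is_integral n fa U" using is_integral_exists[OF fL] ..
  note UL = is_integral_L2(2)[OF U]
  define R where "R \<omega> = Za \<omega> - U \<omega>" for \<omega>
  have RL: "R \<in> L2 M" unfolding R_def[abs_def] by (rule L2_diff[OF ZL UL])
  have orth: "expectation (\<lambda>\<omega>. V \<omega> * R \<omega>) = 0" if V: "is_integral n g V" for g V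
  proof -
    note VL = is_integral_L2(2)[OF V] and gL = is_integral_L2(1)[OF V]
    have s: "sym_inner n f' g = (LINT x|Rn n. f' x * (\<Sum>\<sigma> | \<sigma> permutes {..<n}. g (x \<circ> \<sigma>)))"
      if f': "f' \<in> L2 (Rn n)" for f'
      unfolding sym_inner_def sum_distrib_left
      by (rule Bochner_Integration.integral_sum[symmetric])
        (auto intro: L2_mult_integrable[OF f' L2_permute[OF _ gL]])
    have SL: "(\<lambda>x. \<Sum>\<sigma> | \<sigma> permutes {..<n}. g (x \<circ> \<sigma>)) \<in> L2 (Rn n)"
      by (intro L2_sum L2_permute gL) simp
    have "expectation (\<lambda>\<omega>. Za \<omega> * V \<omega>) = (LINT \<theta>|\<Theta>. expectation (\<lambda>\<omega>. Z \<theta> \<omega> * V \<omega>))"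
      unfolding Za_def by (rule Z.average_inner[OF VL])
    also have "\<dots> = (LINT \<theta>|\<Theta>. LINT x|Rn n. f \<theta> x * (\<Sum>\<sigma> | \<sigma> permutes {..<n}. g (x \<circ> \<sigma>)))"
      by (intro Bochner_Integration.integral_cong refl)
        (simp add: is_integral_isometry[OF I V] s[OF is_integral_L2(1)[OF I]])
    also have "\<dots> = (LINT x|Rn n. fa x * (\<Sum>\<sigma> | \<sigma> permutes {..<n}. g (x \<circ> \<sigma>)))"
      unfolding fa_def by (rule f.average_inner[OF SL, symmetric])
    also have "\<dots> = expectation (\<lambda>\<omega>. U \<omega> * V \<omega>)"
      using is_integral_isometry[OF U V] s[OF fL] by simp
    finally have eq: "expectation (\<lambda>\<omega>. Za \<omega> * V \<omega>) = expectation (\<lambda>\<omega>. U \<omega> * V \<omega>)" .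
    have "expectation (\<lambda>\<omega>. V \<omega> * R \<omega>) = expectation (\<lambda>\<omega>. Za \<omega> * V \<omega> - U \<omega> * V \<omega>)"
      by (intro Bochner_Integration.integral_cong refl) (simp add: R_def algebra_simps)
    also have "\<dots> = expectation (\<lambda>\<omega>. Za \<omega> * V \<omega>) - expectation (\<lambda>\<omega>. U \<omega> * V \<omega>)"
      by (intro Bochner_Integration.integral_diff L2_mult_integrable ZL UL VL)
    finally show ?thesis by (simp add: eq)
  qed
  have "expectation (\<lambda>\<omega>. Za \<omega> * R \<omega>) = (LINT \<theta>|\<Theta>. expectation (\<lambda>\<omega>. Z \<theta> \<omega> * R \<omega>))"
    unfolding Za_def by (rule Z.average_inner[OF RL])
  also have "\<dots> = (LINT \<theta>|\<Theta>. 0)"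
    by (intro Bochner_Integration.integral_cong refl orth[OF I])
  finally have ZR: "expectation (\<lambda>\<omega>. Za \<omega> * R \<omega>) = 0" by simp
  have "expectation (\<lambda>\<omega>. (R \<omega>)\<^sup>2) = expectation (\<lambda>\<omega>. Za \<omega> * R \<omega> - U \<omega> * R \<omega>)"
    by (intro Bochner_Integration.integral_cong refl) (simp add: R_def power2_eq_square algebra_simps)
  also have "\<dots> = expectation (\<lambda>\<omega>. Za \<omega> * R \<omega>) - expectation (\<lambda>\<omega>. U \<omega> * R \<omega>)"
    by (intro Bochner_Integration.integral_diff L2_mult_integrable ZL UL RL)
  finally have "expectation (\<lambda>\<omega>. (R \<omega>)\<^sup>2) = 0" by (simp add: ZR orth[OF U])
  then have "AE \<omega> in M. R \<omega> = 0" by (rule L2_zero_AE[OF RL])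
  then have ae: "AE \<omega> in M. U \<omega> = Za \<omega>" by eventually_elim (simp add: R_def)
  have "is_integral n fa Za"
    by (rule is_integral_cong_AE[OF U L2_measurable[OF fL] AE_I2[OF refl] L2_measurable[OF ZL] ae])
  then show ?thesis unfolding fa_def[abs_def] Za_def[abs_def] .
qed

section \<open>Segments of the time axis\<close>

text \<open>Lebesgue measure on an interval, as a finite measure on the whole line: measurability is then
  measurability on the line.\<close>

definition segment :: "real \<Rightarrow> real \<Rightarrow> real measure" where
  "segment a b = density lborel (indicator {a<..<b})"

lemma space_segment [simp]: "space (segment a b) = UNIV"
  by (simp add: segment_def)

lemma sets_segment [simp, measurable_cong]: "sets (segment a b) = sets borel"
  by (simp add: segment_def)

lemma finite_measure_segment: "finite_measure (segment a b)"
proof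
  have "emeasure (segment a b) (space (segment a b)) = emeasure lborel {a<..<b}"
    unfolding segment_def by (subst emeasure_density) (simp_all add: nn_integral_indicator[symmetric] del: nn_integral_indicator)
  also have "\<dots> < \<infinity>" by (intro emeasure_bounded_finite) simp
  finally show "emeasure (segment a b) (space (segment a b)) \<noteq> \<infinity>" by simp
qed

lemma integral_segment:
  fixes g :: "real \<Rightarrow> real"
  assumes "a \<le> b" "g \<in> borel_measurable borel"
  shows "(LBINT s=a..b. g s) = (LINT s|segment a b. g s)"
proof -
  have "(LINT s|segment a b. g s) = (LINT s|lborel. indicator {a<..<b} s *\<^sub>R g s)"
  proof -
    have "(indicator {a<..<b} :: real \<Rightarrow> ennreal) = (\<lambda>s. ennreal (indicator {a<..<b} s))"
      by (simp add: fun_eq_iff ennreal_indicator)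
    then show ?thesis
      unfolding segment_def
      using integral_density[of g lborel "indicator {a<..<b}"] assms(2) by (simp only: measurable_lborel1) simp
  qed
  then show ?thesis
    using assms(1) by (simp add: interval_lebesgue_integral_def set_lebesgue_integral_def)
qed

text \<open>Rounding the time down to a multiple of \<open>1 / Suc k\<close> leaves countably many times, and continuity of the
  paths recovers the process as \<open>k\<close> grows.\<close>

lemma continuous_process_measurable:
  fixes Y :: "real \<Rightarrow> 'w \<Rightarrow> real"
  assumes m: "\<And>t. Y t \<in> borel_measurable M"
    and c: "\<And>\<omega>. \<omega> \<in> space M \<Longrightarrow> continuous_on UNIV (\<lambda>t. Y t \<omega>)"
  shows "(\<lambda>(t, \<omega>). Y t \<omega>) \<in> borel_measurable (borel \<Otimes>\<^sub>M M)"
proof -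
  define q where "q k t = real_of_int \<lfloor>t * real (Suc k)\<rfloor> / real (Suc k)" for k t
  have mk: "(\<lambda>z. Y (q k (fst z)) (snd z)) \<in> borel_measurable (borel \<Otimes>\<^sub>M M)" for k
    unfolding q_def
  proof (rule measurable_compose_countable[where f="\<lambda>(i::int) z. Y (real_of_int i / real (Suc k)) (snd z)"])
    show "(\<lambda>z. Y (real_of_int i / real (Suc k)) (snd z)) \<in> borel_measurable (borel \<Otimes>\<^sub>M M)" for i
      by (rule measurable_compose[OF measurable_snd m])
    show "(\<lambda>z. \<lfloor>fst z * real (Suc k)\<rfloor>) \<in> measurable (borel \<Otimes>\<^sub>M M) (count_space UNIV)"
      by measurable
  qed
  have "(\<lambda>z. Y (fst z) (snd z)) \<in> borel_measurable (borel \<Otimes>\<^sub>M M)"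
  proof (rule borel_measurable_LIMSEQ_real[OF _ mk])
    fix z :: "real \<times> 'w" assume "z \<in> space (borel \<Otimes>\<^sub>M M)"
    then have w: "snd z \<in> space M" by (auto simp: space_pair_measure)
    have "(\<lambda>k. q k (fst z)) \<longlonglongrightarrow> fst z"
    proof (rule Lim_null_comparison[THEN LIM_zero_cancel])
      have "\<bar>q k t - t\<bar> \<le> inverse (real (Suc k))" for k t
      proof -
        have "real_of_int \<lfloor>t * real (Suc k)\<rfloor> \<le> t * real (Suc k)" "t * real (Suc k) < real_of_int \<lfloor>t * real (Suc k)\<rfloor> + 1"
          by linarith+
        then have "q k t \<le> t" "t < q k t + inverse (real (Suc k))"
          unfolding q_def by (simp_all add: field_simps del: of_nat_Suc)
        then show ?thesis by simp
      qed
      then show "\<forall>\<^sub>F k in sequentially. norm (q k (fst z) - fst z) \<le> inverse (real (Suc k))"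
        by (intro always_eventually allI) simp
    qed (rule LIMSEQ_inverse_real_of_nat)
    then show "(\<lambda>k. Y (q k (fst z)) (snd z)) \<longlonglongrightarrow> Y (fst z) (snd z)"
      using continuous_on_tendsto_compose[OF c[OF w]] by simp
  qed
  then show ?thesis by (simp add: case_prod_unfold)
qed

section \<open>Translates of a unit kernel\<close>

locale unit_kernel =
  fixes K :: "real \<Rightarrow> real"
  assumes K: "K \<in> L2 lborel" and K_norm: "(LINT u|lborel. (K u)\<^sup>2) = 1"
begin

definition rho :: "real \<Rightarrow> real \<Rightarrow> real" where
  "rho s t = (LINT u|lborel. shift s K u * shift t K u)"

lemma K_measurable [measurable]: "K \<in> borel_measurable borel"
  using L2_measurable[OF K] by simp

lemma shift_measurable: "shift t K \<in> borel_measurable borel"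
  unfolding shift_def[abs_def] by measurable

lemma shift_L2: "shift t K \<in> L2 lborel"
proof (rule L2_I)
  show "shift t K \<in> borel_measurable lborel" using shift_measurable by simp
  show "integrable lborel (\<lambda>u. (shift t K u)\<^sup>2)"
    using lborel_integrable_real_affine[OF L2_square_integrable[OF K], of 1 "- t"]
    by (simp add: shift_def)
qed

lemma shift_norm: "(LINT u|lborel. (shift t K u)\<^sup>2) = 1"
  using lborel_integral_real_affine[of 1 "\<lambda>u. (K u)\<^sup>2" "- t"] K_norm by (simp add: shift_def)

lemma rho_abs_le: "\<bar>rho s t\<bar> \<le> 1"
proof -
  have "(rho s t)\<^sup>2 \<le> 1"
    using L2_Cauchy_Schwarz[OF shift_L2 shift_L2, of s t] by (simp add: shift_norm rho_def)
  then show ?thesis by (simp add: abs_square_le_1)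
qed

lemma rho_measurable: "(\<lambda>(s, t). rho s t) \<in> borel_measurable (borel \<Otimes>\<^sub>M borel)"
proof -
  have "(\<lambda>(\<theta>, u). shift (fst \<theta>) K u * shift (snd \<theta>) K u) \<in> borel_measurable ((borel \<Otimes>\<^sub>M borel) \<Otimes>\<^sub>M lborel)"
    unfolding shift_def by measurable
  from lborel.borel_measurable_lebesgue_integral[OF this]
  show ?thesis by (simp add: rho_def case_prod_unfold)
qed

text \<open>For \<open>k = m - r\<close>, the \<open>r\<close>-th contraction of the \<open>m\<close>-th tensor powers of two translates of \<open>K\<close>: every
  contracted coordinate contributes a factor \<open>rho\<close>.\<close>

definition pair_kernel :: "nat \<Rightarrow> nat \<Rightarrow> real \<times> real \<Rightarrow> (nat \<Rightarrow> real) \<Rightarrow> real" where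
  "pair_kernel r k \<theta> z = rho (fst \<theta>) (snd \<theta>) ^ r *
     mixed (2 * k) (shift (fst \<theta>) K) (shift (snd \<theta>) K) {..<k} z"

lemma mixed_measurable:
  "(\<lambda>(\<theta>, z). mixed n (shift (fst \<theta>) K) (shift (snd \<theta>) K) S z) \<in> borel_measurable ((borel \<Otimes>\<^sub>M borel) \<Otimes>\<^sub>M Rn n)"
proof -
  have "(\<lambda>p. shift (f (fst p)) K (snd p i)) \<in> borel_measurable ((borel \<Otimes>\<^sub>M borel) \<Otimes>\<^sub>M Rn n)"
    if "i < n" and [measurable]: "f \<in> borel_measurable (borel \<Otimes>\<^sub>M borel)" for i and f :: "real \<times> real \<Rightarrow> real"
  proof -
    have [measurable]: "(\<lambda>p. snd p i) \<in> borel_measurable ((borel \<Otimes>\<^sub>M borel) \<Otimes>\<^sub>M Rn n)"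
      using measurable_compose[OF measurable_snd measurable_Rn_component[OF that(1)]] .
    show ?thesis unfolding shift_def by measurable
  qed
  note m = this[OF _ measurable_fst] this[OF _ measurable_snd]
  have "(\<lambda>p. \<Prod>i<n. if i \<in> S then shift (fst (fst p)) K (snd p i) else shift (snd (fst p)) K (snd p i))
      \<in> borel_measurable ((borel \<Otimes>\<^sub>M borel) \<Otimes>\<^sub>M Rn n)"
  proof (rule borel_measurable_prod)
    fix i assume "i \<in> {..<n}"
    then show "(\<lambda>p. if i \<in> S then shift (fst (fst p)) K (snd p i) else shift (snd (fst p)) K (snd p i))
      \<in> borel_measurable ((borel \<Otimes>\<^sub>M borel) \<Otimes>\<^sub>M Rn n)"
      using m[of i] by (cases "i \<in> S") simp_all
  qed
  then show ?thesis by (simp add: mixed_def case_prod_unfold)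
qed

lemma pair_kernel_measurable:
  "(\<lambda>(\<theta>, z). pair_kernel r k \<theta> z) \<in> borel_measurable ((borel \<Otimes>\<^sub>M borel) \<Otimes>\<^sub>M Rn (2 * k))"
proof -
  have "(\<lambda>p. rho (fst (fst p)) (snd (fst p))) \<in> borel_measurable ((borel \<Otimes>\<^sub>M borel) \<Otimes>\<^sub>M Rn (2 * k))"
    using measurable_compose[OF measurable_fst rho_measurable] by (simp add: case_prod_unfold)
  moreover have "(\<lambda>p. mixed (2 * k) (shift (fst (fst p)) K) (shift (snd (fst p)) K) {..<k} (snd p))
      \<in> borel_measurable ((borel \<Otimes>\<^sub>M borel) \<Otimes>\<^sub>M Rn (2 * k))"
    using mixed_measurable[of "2 * k" "{..<k}"] by (simp add: case_prod_unfold)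
  ultimately have "(\<lambda>p. rho (fst (fst p)) (snd (fst p)) ^ r *
      mixed (2 * k) (shift (fst (fst p)) K) (shift (snd (fst p)) K) {..<k} (snd p))
      \<in> borel_measurable ((borel \<Otimes>\<^sub>M borel) \<Otimes>\<^sub>M Rn (2 * k))"
    by (intro borel_measurable_times borel_measurable_power)
  then show ?thesis by (simp add: pair_kernel_def case_prod_unfold)
qed

lemma mixed_norm: "(LINT z|Rn n. (mixed n (shift s K) (shift t K) S z)\<^sup>2) = 1"
proof -
  have "(LINT z|Rn n. (\<Prod>i<n. (if i \<in> S then shift s K else shift t K) (z i)) *
      (\<Prod>i<n. (if i \<in> S then shift s K else shift t K) (z i))) =
      (\<Prod>i<n. LINT u|lborel. (if i \<in> S then shift s K else shift t K) u * (if i \<in> S then shift s K else shift t K) u)"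
    by (rule Rn_prod_inner) (simp_all add: shift_L2)
  also have "\<dots> = 1"
  proof (rule prod.neutral, rule ballI)
    fix i
    show "(LINT u|lborel. (if i \<in> S then shift s K else shift t K) u * (if i \<in> S then shift s K else shift t K) u) = 1"
      using shift_norm[of s] shift_norm[of t] by (cases "i \<in> S") (simp_all add: power2_eq_square)
  qed
  finally show ?thesis
    unfolding mixed_def power2_eq_square by (simp add: if_distrib[of "\<lambda>h. h _"])
qed

lemma pair_kernel_L2: "pair_kernel r k \<theta> \<in> L2 (Rn (2 * k))"
  unfolding pair_kernel_def[abs_def] by (intro L2_cmult mixed_L2 shift_L2)

lemma pair_kernel_norm_le: "(LINT z|Rn (2 * k). (pair_kernel r k \<theta> z)\<^sup>2) \<le> 1"
proof -
  have "(LINT z|Rn (2 * k). (pair_kernel r k \<theta> z)\<^sup>2) = (rho (fst \<theta>) (snd \<theta>) ^ r)\<^sup>2"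
    unfolding pair_kernel_def power_mult_distrib integral_mult_right_zero mixed_norm by simp
  also have "\<dots> \<le> 1"
    using power_le_one[OF abs_ge_zero rho_abs_le, of "fst \<theta>" "snd \<theta>" r]
    by (simp add: abs_square_le_1 power_abs)
  finally show ?thesis .
qed

abbreviation square :: "real \<Rightarrow> real \<Rightarrow> (real \<times> real) measure" where
  "square a b \<equiv> segment a b \<Otimes>\<^sub>M segment a b"

lemma sets_square: "sets (square a b) = sets (borel \<Otimes>\<^sub>M borel)"
  by (intro sets_pair_measure_cong sets_segment)

lemma pair_sigma_finite_segment: "pair_sigma_finite (segment a b) (segment c d)"
  by (intro pair_sigma_finite.intro finite_measure.sigma_finite_measure finite_measure_segment)

lemma finite_measure_square: "finite_measure (square a b)"
  by (rule finite_measure_pair_measure[OF finite_measure_segment finite_measure_segment])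

lemma square_family:
  "L2_family (square a b) (Rn (2 * k)) (pair_kernel r k) 1"
proof -
  interpret finite_measure "square a b" by (rule finite_measure_square)
  interpret Rn: sigma_finite_measure "Rn (2 * k)" by (rule sigma_finite_Rn)
  have s: "sets (square a b \<Otimes>\<^sub>M Rn (2 * k)) = sets ((borel \<Otimes>\<^sub>M borel) \<Otimes>\<^sub>M Rn (2 * k))"
    by (intro sets_pair_measure_cong sets_square refl)
  show ?thesis
  proof unfold_locales
    show "(\<lambda>(\<theta>, z). pair_kernel r k \<theta> z) \<in> borel_measurable (square a b \<Otimes>\<^sub>M Rn (2 * k))"
      using pair_kernel_measurable by (simp only: measurable_cong_sets[OF s refl])
  qed (rule pair_kernel_L2 pair_kernel_norm_le)+
qed

section \<open>The contractions of the averaged kernel\<close>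

lemma prod_lessThan_add:
  fixes F :: "nat \<Rightarrow> real"
  shows "(\<Prod>i<k + r. F i) = (\<Prod>i<k. F i) * (\<Prod>j<r. F (k + j))"
  by (induction r) (simp_all add: mult.assoc)

lemma tensor_measurable:
  "(\<lambda>(x, s). tensor_power m (shift s K) x) \<in> borel_measurable (Rn m \<Otimes>\<^sub>M borel)"
proof -
  have "(\<lambda>p. \<Prod>i<m. shift (snd p) K (fst p i)) \<in> borel_measurable (Rn m \<Otimes>\<^sub>M borel)"
  proof (rule borel_measurable_prod)
    fix i assume "i \<in> {..<m}"
    then have [measurable]: "(\<lambda>p. fst p i) \<in> borel_measurable (Rn m \<Otimes>\<^sub>M borel)"
      using measurable_compose[OF measurable_fst measurable_Rn_component[of i m]] by simp
    show "(\<lambda>p. shift (snd p) K (fst p i)) \<in> borel_measurable (Rn m \<Otimes>\<^sub>M borel)"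
      unfolding shift_def by measurable
  qed
  then show ?thesis by (simp add: tensor_power_def case_prod_unfold)
qed

lemma averaged_kernel_eq:
  assumes "a \<le> b"
  shows "averaged_kernel K m a b x = (LINT s|segment a b. tensor_power m (shift s K) x)"
  unfolding averaged_kernel_def
proof (rule integral_segment[OF assms])
  show "(\<lambda>s. tensor_power m (shift s K) x) \<in> borel_measurable borel"
    unfolding tensor_power_def shift_def by measurable
qed

lemma averaged_kernel_measurable:
  assumes "a \<le> b"
  shows "averaged_kernel K m a b \<in> borel_measurable (Rn m)"
proof -
  have s: "sets (Rn m \<Otimes>\<^sub>M segment a b) = sets (Rn m \<Otimes>\<^sub>M borel)"
    by (intro sets_pair_measure_cong sets_segment refl)
  have "(\<lambda>(x, s). tensor_power m (shift s K) x) \<in> borel_measurable (Rn m \<Otimes>\<^sub>M segment a b)"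
    using tensor_measurable by (simp only: measurable_cong_sets[OF s refl])
  from sigma_finite_measure.borel_measurable_lebesgue_integral[OF
      finite_measure.sigma_finite_measure[OF finite_measure_segment] this]
  show ?thesis by (simp only: averaged_kernel_eq[OF assms, abs_def])
qed

lemma contraction_measurable:
  assumes "a \<le> b" "r \<le> m"
  shows "contraction m m r (averaged_kernel K m a b) (averaged_kernel K m a b) \<in> borel_measurable (Rn (2 * (m - r)))"
proof -
  let ?N = "Rn (2 * (m - r)) \<Otimes>\<^sub>M Rn r"
  have join: "(\<lambda>p. \<lambda>i\<in>{..<m}. if i < m - r then fst p (o' + i) else snd p (i - (m - r))) \<in> measurable ?N (Rn m)"
    if "o' \<le> m - r" for o'
  proof (rule measurable_Rn_restrict)
    fix i assume i: "i < m"
    show "(\<lambda>p. if i < m - r then fst p (o' + i) else snd p (i - (m - r))) \<in> borel_measurable ?N"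
    proof (cases "i < m - r")
      case True
      then have "o' + i < 2 * (m - r)" using that by simp
      then show ?thesis using True measurable_compose[OF measurable_fst measurable_Rn_component] by simp
    next
      case False
      then have "i - (m - r) < r" using i assms(2) by simp
      then show ?thesis using False measurable_compose[OF measurable_snd measurable_Rn_component] by simp
    qed
  qed
  note avg = averaged_kernel_measurable[OF assms(1), of m]
  have "(\<lambda>(z, s). averaged_kernel K m a b (\<lambda>i\<in>{..<m}. if i < m - r then z i else s (i - (m - r))) *
      averaged_kernel K m a b (\<lambda>i\<in>{..<m}. if i < m - r then z (m - r + i) else s (i - (m - r))))
      \<in> borel_measurable ?N"
    unfolding case_prod_unfold
  proof (intro borel_measurable_times)
    have "(\<lambda>p. \<lambda>i\<in>{..<m}. if i < m - r then fst p i else snd p (i - (m - r))) \<in> measurable ?N (Rn m)"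
      using join[OF le0] unfolding add_0 .
    then show "(\<lambda>p. averaged_kernel K m a b (\<lambda>i\<in>{..<m}. if i < m - r then fst p i else snd p (i - (m - r))))
        \<in> borel_measurable ?N"
      by (rule measurable_compose[OF _ avg])
    show "(\<lambda>p. averaged_kernel K m a b (\<lambda>i\<in>{..<m}. if i < m - r then fst p (m - r + i) else snd p (i - (m - r))))
        \<in> borel_measurable ?N"
      by (rule measurable_compose[OF join[OF order_refl] avg])
  qed
  from sigma_finite_measure.borel_measurable_lebesgue_integral[OF sigma_finite_Rn this]
  show ?thesis by (simp only: contraction_def[abs_def])
qed

lemma tensor_split:
  assumes "r \<le> m"
  shows "tensor_power m (shift s K) (\<lambda>i\<in>{..<m}. if i < m - r then z i else w (i - (m - r))) =
    (\<Prod>i<m - r. shift s K (z i)) * (\<Prod>j<r. shift s K (w j))"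
proof -
  define F where "F i = shift s K (if i < m - r then z i else w (i - (m - r)))" for i
  have "tensor_power m (shift s K) (\<lambda>i\<in>{..<m}. if i < m - r then z i else w (i - (m - r))) = (\<Prod>i<m. F i)"
    unfolding tensor_power_def F_def by (intro prod.cong refl) simp
  also have "\<dots> = (\<Prod>i<(m - r) + r. F i)" using assms by simp
  also have "\<dots> = (\<Prod>i<m - r. F i) * (\<Prod>j<r. F (m - r + j))"
    by (rule prod_lessThan_add)
  also have "(\<Prod>i<m - r. F i) = (\<Prod>i<m - r. shift s K (z i))"
    unfolding F_def by (intro prod.cong refl) simp
  also have "(\<Prod>j<r. F (m - r + j)) = (\<Prod>j<r. shift s K (w j))"
    unfolding F_def by (intro prod.cong refl) simp
  finally show ?thesis .
qed

lemma mixed_split: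
  "mixed (2 * k) h g {..<k} z = (\<Prod>i<k. h (z i)) * (\<Prod>i<k. g (z (k + i)))"
proof -
  have "(\<Prod>i<k + k. if i \<in> {..<k} then h (z i) else g (z i)) =
      (\<Prod>i<k. if i \<in> {..<k} then h (z i) else g (z i)) *
      (\<Prod>j<k. if k + j \<in> {..<k} then h (z (k + j)) else g (z (k + j)))"
    by (rule prod_lessThan_add)
  then show ?thesis by (simp add: mixed_def mult_2)
qed

text \<open>Fubini's theorem, applied for almost every fixed \<open>z\<close> to the two times and the contracted variables. It
  applies because the contracted factors have norm one for all times, while the remaining factor is
  square-integrable over the square of times for almost every \<open>z\<close>.\<close>

lemma contraction_averaged_kernel:
  assumes ab: "a \<le> b" and r: "r \<le> m"
  shows "AE z in Rn (2 * (m - r)).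
    contraction m m r (averaged_kernel K m a b) (averaged_kernel K m a b) z =
    (LINT \<theta>|square a b. pair_kernel r (m - r) \<theta> z)"
proof -
  define k where "k = m - r"
  interpret sq: finite_measure "square a b" by (rule finite_measure_square)
  interpret fam: L2_family "square a b" "Rn (2 * k)" "pair_kernel 0 k" 1 by (rule square_family)
  interpret SS: pair_sigma_finite "segment a b" "segment a b" by (rule pair_sigma_finite_segment)
  interpret SR: pair_sigma_finite "square a b" "Rn r"
    by (intro pair_sigma_finite.intro sigma_finite_Rn sq.sigma_finite_measure_axioms)
  have "AE z in Rn (2 * k). contraction m m r (averaged_kernel K m a b) (averaged_kernel K m a b) z =
      (LINT \<theta>|square a b. pair_kernel r k \<theta> z)"
    using fam.AE_section_L2
  proof eventually_elim
    case (elim z)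
    define p where "p \<theta> = mixed (2 * k) (shift (fst \<theta>) K) (shift (snd \<theta>) K) {..<k} z" for \<theta>
    define Q where "Q s w = (\<Prod>j<r. shift s K (w j))" for s w
    have pL: "p \<in> L2 (square a b)" using elim by (simp add: p_def[abs_def] pair_kernel_def)
    have Q_L2: "Q s \<in> L2 (Rn r)" for s unfolding Q_def[abs_def] by (rule Rn_prod_L2) (rule shift_L2)
    have QQ: "(LINT w|Rn r. Q s w * Q t w) = rho s t ^ r" for s t
      unfolding Q_def rho_def by (rule tensor_power_inner[OF shift_L2 shift_L2])
    have Qn: "(LINT w|Rn r. (Q s w)\<^sup>2) = 1" for s
      using tensor_power_inner[OF shift_L2 shift_L2, of r s s] shift_norm[of s]
      by (simp add: Q_def power2_eq_square)
    have Qabs: "(LINT w|Rn r. \<bar>Q s w * Q t w\<bar>) \<le> 1" for s t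
    proof -
      have A: "(\<lambda>w. \<bar>Q s w\<bar>) \<in> L2 (Rn r)" for s
        by (rule L2_bound[OF Q_L2[of s]]) (use L2_measurable[OF Q_L2[of s]] in auto)
      have "(LINT w|Rn r. \<bar>Q s w\<bar> * \<bar>Q t w\<bar>)\<^sup>2 \<le> 1"
        using L2_Cauchy_Schwarz[OF A A, of s t] by (simp add: Qn)
      then show ?thesis by (simp add: abs_mult abs_square_le_1 abs_le_iff)
    qed
    define \<Phi> where "\<Phi> \<theta> w = p \<theta> * (Q (fst \<theta>) w * Q (snd \<theta>) w)" for \<theta> w
    have s: "sets (square a b \<Otimes>\<^sub>M Rn r) = sets ((borel \<Otimes>\<^sub>M borel) \<Otimes>\<^sub>M Rn r)"
      by (intro sets_pair_measure_cong sets_square refl)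
    have Qm: "(\<lambda>x. Q (f (fst x)) (snd x)) \<in> borel_measurable ((borel \<Otimes>\<^sub>M borel) \<Otimes>\<^sub>M Rn r)"
      if [measurable]: "f \<in> borel_measurable (borel \<Otimes>\<^sub>M borel)" for f :: "real \<times> real \<Rightarrow> real"
      unfolding Q_def
    proof (rule borel_measurable_prod)
      fix j assume "j \<in> {..<r}"
      then have [measurable]: "(\<lambda>x. snd x j) \<in> borel_measurable ((borel \<Otimes>\<^sub>M borel) \<Otimes>\<^sub>M Rn r)"
        using measurable_compose[OF measurable_snd measurable_Rn_component[of j r]] by simp
      show "(\<lambda>x. shift (f (fst x)) K (snd x j)) \<in> borel_measurable ((borel \<Otimes>\<^sub>M borel) \<Otimes>\<^sub>M Rn r)"
        unfolding shift_def by measurable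
    qed
    have pm: "p \<in> borel_measurable (borel \<Otimes>\<^sub>M borel)"
      using L2_measurable[OF pL] by (simp only: measurable_cong_sets[OF sets_square refl])
    have "(\<lambda>x. p (fst x) * (Q (fst (fst x)) (snd x) * Q (snd (fst x)) (snd x)))
        \<in> borel_measurable ((borel \<Otimes>\<^sub>M borel) \<Otimes>\<^sub>M Rn r)"
      by (intro borel_measurable_times measurable_compose[OF measurable_fst pm] Qm measurable_fst measurable_snd)
    then have \<Phi>m: "(\<lambda>(\<theta>, w). \<Phi> \<theta> w) \<in> borel_measurable (square a b \<Otimes>\<^sub>M Rn r)"
      unfolding measurable_cong_sets[OF s refl] by (simp add: \<Phi>_def case_prod_unfold)
    have \<Phi>i: "integrable (square a b \<Otimes>\<^sub>M Rn r) (\<lambda>(\<theta>, w). \<Phi> \<theta> w)"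
    proof (rule SR.Fubini_integrable[OF \<Phi>m])
      show "AE \<theta> in square a b. integrable (Rn r) (\<lambda>w. case (\<theta>, w) of (\<theta>, w) \<Rightarrow> \<Phi> \<theta> w)"
        by (intro AE_I2) (simp add: \<Phi>_def L2_mult_integrable[OF Q_L2 Q_L2])
      show "integrable (square a b) (\<lambda>\<theta>. LINT w|Rn r. norm (case (\<theta>, w) of (\<theta>, w) \<Rightarrow> \<Phi> \<theta> w))"
      proof (rule Bochner_Integration.integrable_bound)
        show "integrable (square a b) (\<lambda>\<theta>. \<bar>p \<theta>\<bar>)"
          by (intro integrable_abs sq.L2_integrable(1) pL)
        have "(\<lambda>(\<theta>, w). norm (\<Phi> \<theta> w)) \<in> borel_measurable (square a b \<Otimes>\<^sub>M Rn r)"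
          using borel_measurable_abs[OF \<Phi>m] by (simp add: case_prod_unfold)
        from sigma_finite_measure.borel_measurable_lebesgue_integral[OF sigma_finite_Rn this]
        show "(\<lambda>\<theta>. LINT w|Rn r. norm (case (\<theta>, w) of (\<theta>, w) \<Rightarrow> \<Phi> \<theta> w)) \<in> borel_measurable (square a b)"
          by simp
        show "AE \<theta> in square a b. norm (LINT w|Rn r. norm (case (\<theta>, w) of (\<theta>, w) \<Rightarrow> \<Phi> \<theta> w)) \<le> norm \<bar>p \<theta>\<bar>"
        proof (intro AE_I2)
          fix \<theta>
          have "(LINT w|Rn r. norm (\<Phi> \<theta> w)) = \<bar>p \<theta>\<bar> * (LINT w|Rn r. \<bar>Q (fst \<theta>) w * Q (snd \<theta>) w\<bar>)"
            unfolding \<Phi>_def by (simp add: abs_mult)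
          also have "\<dots> \<le> \<bar>p \<theta>\<bar> * 1" by (intro mult_left_mono Qabs) simp
          finally show "norm (LINT w|Rn r. norm (case (\<theta>, w) of (\<theta>, w) \<Rightarrow> \<Phi> \<theta> w)) \<le> norm \<bar>p \<theta>\<bar>"
            by simp
        qed
      qed
    qed
    have avg1: "averaged_kernel K m a b (\<lambda>i\<in>{..<m}. if i < m - r then z i else w (i - (m - r))) =
        (LINT s|segment a b. (\<Prod>i<k. shift s K (z i)) * Q s w)" for w
      unfolding averaged_kernel_eq[OF ab] tensor_split[OF r] k_def Q_def ..
    have avg2: "averaged_kernel K m a b (\<lambda>i\<in>{..<m}. if i < m - r then z (m - r + i) else w (i - (m - r))) =
        (LINT t|segment a b. (\<Prod>i<k. shift t K (z (k + i))) * Q t w)" for w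
      unfolding averaged_kernel_eq[OF ab] tensor_split[OF r, of _ "\<lambda>i. z (m - r + i)"] k_def Q_def ..
    have split: "\<Phi> (s, t) w = ((\<Prod>i<k. shift s K (z i)) * Q s w) * ((\<Prod>i<k. shift t K (z (k + i))) * Q t w)" for s t w
      by (simp add: \<Phi>_def p_def mixed_split)
    have "contraction m m r (averaged_kernel K m a b) (averaged_kernel K m a b) z =
        (LINT w|Rn r. (LINT s|segment a b. (\<Prod>i<k. shift s K (z i)) * Q s w) *
          (LINT t|segment a b. (\<Prod>i<k. shift t K (z (k + i))) * Q t w))"
      unfolding contraction_def avg1 avg2 ..
    also have "\<dots> = (LINT w|Rn r. LINT s|segment a b. LINT t|segment a b. \<Phi> (s, t) w)"
      unfolding split by simp
    also have "\<dots> = (LINT w|Rn r. LINT \<theta>|square a b. \<Phi> \<theta> w)"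
    proof (rule integral_cong_AE)
      have swap: "(\<lambda>x. (snd x, fst x)) \<in> measurable (Rn r \<Otimes>\<^sub>M square a b) (square a b \<Otimes>\<^sub>M Rn r)"
        by (intro measurable_Pair measurable_snd measurable_fst)
      have \<Phi>m': "(\<lambda>(w, \<theta>). \<Phi> \<theta> w) \<in> borel_measurable (Rn r \<Otimes>\<^sub>M square a b)"
        using measurable_compose[OF swap \<Phi>m] by (simp add: case_prod_unfold)
      show "(\<lambda>w. LINT \<theta>|square a b. \<Phi> \<theta> w) \<in> borel_measurable (Rn r)"
        by (rule sigma_finite_measure.borel_measurable_lebesgue_integral[OF sq.sigma_finite_measure_axioms \<Phi>m'])
      have sf: "sigma_finite_measure (segment a b)"
        by (intro finite_measure.sigma_finite_measure finite_measure_segment)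
      have "(\<lambda>x. (fst (fst x), (snd (fst x), snd x))) \<in> measurable ((Rn r \<Otimes>\<^sub>M segment a b) \<Otimes>\<^sub>M segment a b) (Rn r \<Otimes>\<^sub>M square a b)"
        by (intro measurable_Pair measurable_compose[OF measurable_fst] measurable_snd measurable_fst)
      from measurable_compose[OF this \<Phi>m']
      have "(\<lambda>(x, t). \<Phi> (snd x, t) (fst x)) \<in> borel_measurable ((Rn r \<Otimes>\<^sub>M segment a b) \<Otimes>\<^sub>M segment a b)"
        by (simp add: case_prod_unfold)
      from sigma_finite_measure.borel_measurable_lebesgue_integral[OF sf this]
      have "(\<lambda>(w, s). LINT t|segment a b. \<Phi> (s, t) w) \<in> borel_measurable (Rn r \<Otimes>\<^sub>M segment a b)"
        by (simp add: case_prod_unfold)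
      from sigma_finite_measure.borel_measurable_lebesgue_integral[OF sf this]
      show "(\<lambda>w. LINT s|segment a b. LINT t|segment a b. \<Phi> (s, t) w) \<in> borel_measurable (Rn r)" .
      show "AE w in Rn r. (LINT s|segment a b. LINT t|segment a b. \<Phi> (s, t) w) = (LINT \<theta>|square a b. \<Phi> \<theta> w)"
        using SR.AE_integrable_snd[OF \<Phi>i]
      proof eventually_elim
        case (elim w)
        show ?case using SS.integral_fst'[OF elim] .
      qed
    qed
    also have "\<dots> = (LINT \<theta>|square a b. LINT w|Rn r. \<Phi> \<theta> w)"
      by (rule SR.Fubini_integral[OF \<Phi>i])
    also have "\<dots> = (LINT \<theta>|square a b. pair_kernel r k \<theta> z)"
      unfolding \<Phi>_def integral_mult_right_zero QQ by (simp add: pair_kernel_def p_def mult.commute)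
    finally show ?case .
  qed
  then show ?thesis by (simp only: k_def)
qed

end

section \<open>The chaos expansion of squared increments\<close>

locale gaussian_process = brownian M W + unit_kernel K
  for M :: "'w measure" and W :: "real \<Rightarrow> 'w \<Rightarrow> real" and K :: "real \<Rightarrow> real" +
  fixes Y :: "real \<Rightarrow> 'w \<Rightarrow> real"
  assumes Y_measurable: "\<And>t. Y t \<in> borel_measurable M"
    and Y_continuous: "\<And>\<omega>. \<omega> \<in> space M \<Longrightarrow> continuous_on UNIV (\<lambda>t. Y t \<omega>)"
    and Y_integral: "\<And>t. is_integral 1 (\<lambda>x. shift t K (x 0)) (Y t)"
begin

text \<open>The integral of \<open>pair_kernel\<close>, by \<open>is_integral_mixed\<close>.\<close>

definition pair_variable :: "nat \<Rightarrow> nat \<Rightarrow> real \<times> real \<Rightarrow> 'w \<Rightarrow> real" where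
  "pair_variable r k \<theta> \<omega> = rho (fst \<theta>) (snd \<theta>) ^ r *
     (fact k * fact k * herm2 k k (rho (fst \<theta>) (snd \<theta>)) (Y (fst \<theta>) \<omega>) (Y (snd \<theta>) \<omega>))"

lemma pair_variable_integral: "is_integral (2 * k) (pair_kernel r k \<theta>) (pair_variable r k \<theta>)"
proof -
  have "is_integral (2 * k) (mixed (2 * k) (shift (fst \<theta>) K) (shift (snd \<theta>) K) {..<k})
    (\<lambda>\<omega>. fact k * fact (2 * k - k) * herm2 k (2 * k - k) (rho (fst \<theta>) (snd \<theta>)) (Y (fst \<theta>) \<omega>) (Y (snd \<theta>) \<omega>))"
    unfolding rho_def
    by (rule is_integral_mixed[OF shift_L2 shift_L2 shift_norm shift_norm Y_integral Y_integral]) simp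
  moreover have "2 * k - k = k" by simp
  ultimately have "is_integral (2 * k) (mixed (2 * k) (shift (fst \<theta>) K) (shift (snd \<theta>) K) {..<k})
    (\<lambda>\<omega>. fact k * fact k * herm2 k k (rho (fst \<theta>) (snd \<theta>)) (Y (fst \<theta>) \<omega>) (Y (snd \<theta>) \<omega>))" by (simp only:)
  then show ?thesis unfolding pair_kernel_def[abs_def] pair_variable_def[abs_def] by (rule is_integral_cmult)
qed

lemma pair_variable_measurable:
  "(\<lambda>(\<theta>, \<omega>). pair_variable r k \<theta> \<omega>) \<in> borel_measurable (square a b \<Otimes>\<^sub>M M)"
proof -
  let ?N = "(borel \<Otimes>\<^sub>M borel) \<Otimes>\<^sub>M M :: ((real \<times> real) \<times> 'w) measure"
  have s: "sets (square a b \<Otimes>\<^sub>M M) = sets ?N"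
    by (intro sets_pair_measure_cong sets_square refl)
  note YY = continuous_process_measurable[OF Y_measurable Y_continuous]
  have Ym: "(\<lambda>p. Y (f (fst p)) (snd p)) \<in> borel_measurable ?N"
    if "f \<in> borel_measurable (borel \<Otimes>\<^sub>M borel)" for f
  proof -
    have "(\<lambda>p. (f (fst p), snd p)) \<in> measurable ?N (borel \<Otimes>\<^sub>M M)"
      by (intro measurable_Pair measurable_compose[OF measurable_fst that] measurable_snd)
    from measurable_compose[OF this YY] show ?thesis by simp
  qed
  have rm: "(\<lambda>p. rho (fst (fst p)) (snd (fst p))) \<in> borel_measurable ?N"
    using measurable_compose[OF measurable_fst rho_measurable] by (simp add: case_prod_unfold)
  have rm': "(\<lambda>p. (- rho (fst (fst p)) (snd (fst p))) ^ i / fact i) \<in> borel_measurable ?N" for i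
    using rm by measurable
  have hm: "(\<lambda>p. herm i 1 (Y (f (fst p)) (snd p))) \<in> borel_measurable ?N"
    if "f \<in> borel_measurable (borel \<Otimes>\<^sub>M borel)" for f i
    by (rule measurable_compose[OF Ym[OF that] herm_measurable])
  have "(\<lambda>p. rho (fst (fst p)) (snd (fst p)) ^ r * (fact k * fact k *
      (\<Sum>i\<le>min k k. (- rho (fst (fst p)) (snd (fst p))) ^ i / fact i *
        herm (k - i) 1 (Y (fst (fst p)) (snd p)) * herm (k - i) 1 (Y (snd (fst p)) (snd p))))) \<in> borel_measurable ?N"
    by (intro borel_measurable_times borel_measurable_power borel_measurable_const borel_measurable_sum
        rm rm' hm measurable_fst measurable_snd)
  then show ?thesis
    unfolding measurable_cong_sets[OF s refl] by (simp only: pair_variable_def herm2_def case_prod_unfold)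
qed

lemma pair_variable_average_integral:
  "is_integral (2 * k) (\<lambda>z. LINT \<theta>|square a b. pair_kernel r k \<theta> z) (\<lambda>\<omega>. LINT \<theta>|square a b. pair_variable r k \<theta> \<omega>)"
proof (rule is_integral_average[OF finite_measure_square])
  show "is_integral (2 * k) (pair_kernel r k \<theta>) (pair_variable r k \<theta>)" for \<theta>
    by (rule pair_variable_integral)
  show "(\<lambda>(\<theta>, x). pair_kernel r k \<theta> x) \<in> borel_measurable (square a b \<Otimes>\<^sub>M Rn (2 * k))"
    by (rule L2_family.meas[OF square_family])
  show "(\<lambda>(\<theta>, \<omega>). pair_variable r k \<theta> \<omega>) \<in> borel_measurable (square a b \<Otimes>\<^sub>M M)"
    by (rule pair_variable_measurable)
  show "(LINT x|Rn (2 * k). (pair_kernel r k \<theta> x)\<^sup>2) \<le> 1" for \<theta>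
    by (rule pair_kernel_norm_le)
qed

lemma contraction_integral:
  assumes "a \<le> b" "r \<le> m"
  shows "is_integral (2 * (m - r)) (contraction m m r (averaged_kernel K m a b) (averaged_kernel K m a b))
    (\<lambda>\<omega>. LINT \<theta>|square a b. pair_variable r (m - r) \<theta> \<omega>)"
proof (rule is_integral_cong_AE[OF pair_variable_average_integral contraction_measurable[OF assms]])
  show "AE z in Rn (2 * (m - r)). (LINT \<theta>|square a b. pair_kernel r (m - r) \<theta> z) =
      contraction m m r (averaged_kernel K m a b) (averaged_kernel K m a b) z"
    using contraction_averaged_kernel[OF assms] by eventually_elim simp
  show "(\<lambda>\<omega>. LINT \<theta>|square a b. pair_variable r (m - r) \<theta> \<omega>) \<in> borel_measurable M"
    by (rule L2_measurable[OF is_integral_L2(2)[OF pair_variable_average_integral]])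
qed simp

text \<open>Equal to \<open>fact r * (m choose r)\<^sup>2\<close>, the coefficient in the product formula.\<close>

definition chaos_coeff :: "nat \<Rightarrow> nat \<Rightarrow> real" where
  "chaos_coeff m r = (fact m / (fact (m - r) * sqrt (fact r)))\<^sup>2"

lemma hermite_product_expansion:
  "hermite m (Y s \<omega>) * hermite m (Y t \<omega>) = (\<Sum>r\<le>m. chaos_coeff m r * pair_variable r (m - r) (s, t) \<omega>)"
proof -
  have "hermite m (Y s \<omega>) * hermite m (Y t \<omega>) = (fact m)\<^sup>2 * (herm m 1 (Y s \<omega>) * herm m 1 (Y t \<omega>))"
    by (simp add: hermite_eq_herm power2_eq_square)
  also have "\<dots> = (\<Sum>r\<le>m. (fact m)\<^sup>2 * (rho s t ^ r / fact r * herm2 (m - r) (m - r) (rho s t) (Y s \<omega>) (Y t \<omega>)))"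
    unfolding herm_mult_herm[of m "Y s \<omega>" "Y t \<omega>" "rho s t"] sum_distrib_left ..
  also have "\<dots> = (\<Sum>r\<le>m. chaos_coeff m r * pair_variable r (m - r) (s, t) \<omega>)"
  proof (intro sum.cong refl)
    fix r
    have "chaos_coeff m r = (fact m)\<^sup>2 / ((fact (m - r))\<^sup>2 * fact r)"
      by (simp add: chaos_coeff_def power_divide power_mult_distrib)
    then have "chaos_coeff m r * (fact (m - r) * fact (m - r)) = (fact m)\<^sup>2 / fact r"
      by (simp add: power2_eq_square)
    then have "(fact m)\<^sup>2 / fact r * (rho s t ^ r * herm2 (m - r) (m - r) (rho s t) (Y s \<omega>) (Y t \<omega>)) =
        chaos_coeff m r * (fact (m - r) * fact (m - r)) * (rho s t ^ r * herm2 (m - r) (m - r) (rho s t) (Y s \<omega>) (Y t \<omega>))"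
      by simp
    then show "(fact m)\<^sup>2 * (rho s t ^ r / fact r * herm2 (m - r) (m - r) (rho s t) (Y s \<omega>) (Y t \<omega>)) =
        chaos_coeff m r * pair_variable r (m - r) (s, t) \<omega>"
      by (simp add: pair_variable_def mult_ac)
  qed
  finally show ?thesis .
qed

text \<open>The square of a time average is the average over pairs of times, to which the product expansion applies.\<close>

lemma squared_average_expansion:
  "AE \<omega> in M. (LINT s|segment a b. hermite m (Y s \<omega>))\<^sup>2 =
    (\<Sum>r\<le>m. chaos_coeff m r * (LINT \<theta>|square a b. pair_variable r (m - r) \<theta> \<omega>))"
proof -
  interpret sq: finite_measure "square a b" by (rule finite_measure_square)
  interpret SS: pair_sigma_finite "segment a b" "segment a b" by (rule pair_sigma_finite_segment)
  have "AE \<omega> in M. integrable (square a b) (\<lambda>\<theta>. pair_variable r (m - r) \<theta> \<omega>)" for r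
  proof -
    interpret fam: L2_family "square a b" M "pair_variable r (m - r)" "fact (2 * (m - r))"
    proof unfold_locales
      show "(\<lambda>(\<theta>, \<omega>). pair_variable r (m - r) \<theta> \<omega>) \<in> borel_measurable (square a b \<Otimes>\<^sub>M M)"
        by (rule pair_variable_measurable)
      show "pair_variable r (m - r) \<theta> \<in> L2 M" for \<theta>
        by (rule is_integral_L2(2)[OF pair_variable_integral])
      show "expectation (\<lambda>\<omega>. (pair_variable r (m - r) \<theta> \<omega>)\<^sup>2) \<le> fact (2 * (m - r))" for \<theta>
      proof -
        have "fact (2 * (m - r)) * (LINT x|Rn (2 * (m - r)). (pair_kernel r (m - r) \<theta> x)\<^sup>2) \<le> fact (2 * (m - r)) * 1"
          by (intro mult_left_mono pair_kernel_norm_le) simp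
        then show ?thesis using order_trans[OF is_integral_norm_le[OF pair_variable_integral]] by simp
      qed
    qed
    show ?thesis using fam.AE_section_L2
    proof eventually_elim
      case (elim \<omega>)
      then show ?case by (rule sq.L2_integrable(1))
    qed
  qed
  then have "AE \<omega> in M. \<forall>r. integrable (square a b) (\<lambda>\<theta>. pair_variable r (m - r) \<theta> \<omega>)"
    by (simp add: AE_all_countable)
  then show ?thesis
  proof eventually_elim
    case (elim \<omega>)
    define g where "g s = hermite m (Y s \<omega>)" for s
    have eq: "(\<lambda>\<theta>. g (fst \<theta>) * g (snd \<theta>)) = (\<lambda>\<theta>. \<Sum>r\<le>m. chaos_coeff m r * pair_variable r (m - r) \<theta> \<omega>)"
      unfolding g_def by (rule ext) (simp only: hermite_product_expansion prod.collapse)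
    have "integrable (square a b) (\<lambda>\<theta>. g (fst \<theta>) * g (snd \<theta>))"
      unfolding eq by (intro Bochner_Integration.integrable_sum integrable_mult_right elim[rule_format])
    from SS.integral_fst'[OF this]
    have "(LINT s|segment a b. LINT t|segment a b. g s * g t) = (LINT \<theta>|square a b. g (fst \<theta>) * g (snd \<theta>))"
      by simp
    also have "\<dots> = (\<Sum>r\<le>m. LINT \<theta>|square a b. chaos_coeff m r * pair_variable r (m - r) \<theta> \<omega>)"
      unfolding eq by (rule Bochner_Integration.integral_sum) (intro integrable_mult_right elim[rule_format])
    also have "(LINT s|segment a b. LINT t|segment a b. g s * g t) = (LINT s|segment a b. g s)\<^sup>2"
      by (simp add: power2_eq_square)
    finally show ?case by (simp add: g_def)
  qed
qed

text \<open>For \<open>r = m\<close> the integrand is the deterministic function \<open>\<rho>\<^sup>m\<close>.\<close>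

lemma pair_variable_top: "pair_variable m 0 \<theta> \<omega> = rho (fst \<theta>) (snd \<theta>) ^ m"
  by (simp add: pair_variable_def herm2_def)

end

lemma hermite_continuous: "isCont (hermite m) x"
proof -
  have "isCont (\<lambda>x. fact m * herm m 1 x) x"
    unfolding isCont_def by (intro tendsto_mult_left herm_continuous tendsto_const tendsto_ident_at)
  moreover have "hermite m = (\<lambda>x. fact m * herm m 1 x)" by (rule ext) (rule hermite_eq_herm)
  ultimately show ?thesis by simp
qed

text \<open>Joint measurability in time and chance is obtained from continuity of every path; setting the
  exceptional paths to zero achieves this.\<close>

lemma continuous_modification:
  fixes Y :: "real \<Rightarrow> 'w \<Rightarrow> real"
  assumes m: "\<And>t. Y t \<in> borel_measurable M" and c: "AE \<omega> in M. continuous_on UNIV (\<lambda>t. Y t \<omega>)"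
  shows "\<exists>Y'. (\<forall>t. Y' t \<in> borel_measurable M) \<and> (\<forall>\<omega>\<in>space M. continuous_on UNIV (\<lambda>t. Y' t \<omega>)) \<and>
    (AE \<omega> in M. \<forall>t. Y' t \<omega> = Y t \<omega>)"
proof -
  obtain A where A: "{\<omega> \<in> space M. \<not> continuous_on UNIV (\<lambda>t. Y t \<omega>)} \<subseteq> A" "emeasure M A = 0" "A \<in> sets M"
    using AE_E[OF c] by blast
  define Y' where "Y' t \<omega> = (if \<omega> \<in> A then 0 else Y t \<omega>)" for t \<omega>
  have "Y' t \<in> borel_measurable M" for t
    unfolding Y'_def[abs_def] using A(3) m by (intro measurable_If_set) auto
  moreover have "continuous_on UNIV (\<lambda>t. Y' t \<omega>)" if "\<omega> \<in> space M" for \<omega>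
    using A(1) that by (cases "\<omega> \<in> A") (auto simp: Y'_def)
  moreover have "AE \<omega> in M. \<omega> \<notin> A"
    using A by (intro AE_not_in) auto
  then have "AE \<omega> in M. \<forall>t. Y' t \<omega> = Y t \<omega>"
    by eventually_elim (simp add: Y'_def)
  ultimately show ?thesis by (intro exI[of _ Y'] conjI allI ballI)
qed

theorem proposition5p1:
  fixes M :: "'w measure"
    and W B Y X :: "real \<Rightarrow> 'w \<Rightarrow> real"
    and K G :: "real \<Rightarrow> real"
    and H \<epsilon> \<delta> c :: real
    and m N :: nat
  assumes "prob_space M"
    and "two_sided_brownian_motion M W"
    and "0 < H" and "H < 1" and "m \<ge> 1" and "c \<noteq> 0" and "Hstar H m \<noteq> 1/2"
    and "\<epsilon> > 0" and "\<delta> > 0"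
    and "mvn_fractional_brownian_motion M W H B"
    and "stationary_fOU M H \<epsilon> B Y"
    and "K \<in> L2 lborel" and "(LINT s|lborel. (K s)\<^sup>2) = 1"
    and "\<forall>t. AE \<omega> in M. Y t \<omega> = wiener_integral M W (shift t K) \<omega>"
    and "G = (\<lambda>x. c * hermite m x)"
    and "\<forall>t\<ge>0. X t \<in> borel_measurable M"
    and "AE \<omega> in M. \<forall>t\<ge>0. X t \<omega> =
           X 0 \<omega> + alpha \<epsilon> (Hstar H m) * (LBINT s=0..t. G (Y s \<omega>))"
  defines "C \<equiv> quad_var_estimator (Hprime H m) N \<delta> X"
  shows "\<exists>T :: nat \<Rightarrow> 'w \<Rightarrow> real.
    (AE \<omega> in M. C \<omega> = c\<^sup>2 * T 0 \<omega> +
       (\<Sum>r<m. (c * fact m / (fact (m - r) * sqrt (fact r)))\<^sup>2 * T (2 * m - 2 * r) \<omega>)) \<and>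
    (\<forall>r<m. T (2 * m - 2 * r) = (\<lambda>\<omega>.
       real N powr (2 * Hprime H m - 1) * (alpha \<epsilon> (Hstar H m))\<^sup>2 *
       multiple_integral M W (2 * m - 2 * r)
         (\<lambda>z. \<Sum>k<N. contraction m m r
                (averaged_kernel K m (real k * \<delta>) (real (k + 1) * \<delta>))
                (averaged_kernel K m (real k * \<delta>) (real (k + 1) * \<delta>)) z) \<omega>)) \<and>
    integrable M C \<and>
    (\<forall>\<omega>. c\<^sup>2 * T 0 \<omega> = prob_space.expectation M C) \<and>
    (\<forall>r\<le>m. T (2 * m - 2 * r) \<in> wiener_chaos M W (2 * m - 2 * r)) \<and>
    (\<forall>r\<le>m. \<forall>r'\<le>m. r \<noteq> r' \<longrightarrow>
       (\<forall>U \<in> wiener_chaos M W (2 * m - 2 * r). \<forall>V \<in> wiener_chaos M W (2 * m - 2 * r').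
          integrable M (\<lambda>\<omega>. U \<omega> * V \<omega>) \<and> prob_space.expectation M (\<lambda>\<omega>. U \<omega> * V \<omega>) = 0))"
proof -
  interpret brownian M W
    by (intro brownian.intro brownian_axioms.intro assms(1,2))
  interpret unit_kernel K
    by (intro unit_kernel.intro assms(12,13))
  have Ym: "Y t \<in> borel_measurable M" for t
    using assms(11) unfolding stationary_fOU_def by simp
  have Yc: "AE \<omega> in M. continuous_on UNIV (\<lambda>t. Y t \<omega>)"
    using assms(11) unfolding stationary_fOU_def by simp
  obtain Y' where Y': "(\<forall>t. Y' t \<in> borel_measurable M) \<and> (\<forall>\<omega>\<in>space M. continuous_on UNIV (\<lambda>t. Y' t \<omega>)) \<and>
    (AE \<omega> in M. \<forall>t. Y' t \<omega> = Y t \<omega>)"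
    using continuous_modification[OF Ym Yc] ..
  then have Y'm: "Y' t \<in> borel_measurable M" and Y'c: "\<omega> \<in> space M \<Longrightarrow> continuous_on UNIV (\<lambda>t. Y' t \<omega>)" for t \<omega>
    by simp_all
  have Y'Y: "AE \<omega> in M. \<forall>t. Y' t \<omega> = Y t \<omega>" using Y' by simp
  have Y'I: "is_integral 1 (\<lambda>x. shift t K (x 0)) (Y' t)" for t
  proof -
    have L: "(\<lambda>x. shift t K (x 0)) \<in> L2 (Rn 1)"
      using tensor_power_L2[OF shift_L2[of t], where n=1] by simp
    have "AE \<omega> in M. Y t \<omega> = wiener_integral M W (shift t K) \<omega>" using assms(14) by simp
    with Y'Y have "AE \<omega> in M. multiple_integral M W 1 (\<lambda>x. shift t K (x 0)) \<omega> = Y' t \<omega>"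
      by eventually_elim (simp add: wiener_integral_def)
    then show ?thesis
      by (rule is_integral_cong_AE[OF is_integral_multiple_integral[OF L] L2_measurable[OF L] AE_I2[OF refl] Y'm])
  qed
  interpret gaussian_process M W K Y'
    by unfold_locales (rule Y'm Y'I | erule Y'c)+
  define \<alpha> where "\<alpha> = alpha \<epsilon> (Hstar H m)"
  define P where "P = real N powr (2 * Hprime H m - 1) * \<alpha>\<^sup>2"
  define a b where "a k = real k * \<delta>" and "b k = real (k + 1) * \<delta>" for k
  have ab: "a k \<le> b k" "0 \<le> a k" "0 \<le> b k" for k
    using \<open>\<delta> > 0\<close> by (simp_all add: a_def b_def)
  define J where "J r \<omega> = (\<Sum>k<N. LINT \<theta>|square (a k) (b k). pair_variable r (m - r) \<theta> \<omega>)" for r \<omega>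
  define f where "f r z = (\<Sum>k<N. contraction m m r (averaged_kernel K m (a k) (b k)) (averaged_kernel K m (a k) (b k)) z)" for r z
  have J: "is_integral (2 * (m - r)) (f r) (J r)" if "r \<le> m" for r
    unfolding f_def[abs_def] J_def[abs_def] by (intro is_integral_sum contraction_integral ab that)
  \<comment> \<open>The random variable \<open>J m\<close> is constant, so any argument gives its value.\<close>
  define D where "D = J m undefined"
  have JD: "J m \<omega> = D" for \<omega>
    unfolding D_def J_def by (simp add: pair_variable_top)
  have EJ: "expectation (J r) = 0" if "r < m" for r
    using is_integral_isometry[OF J is_integral_const[of 1], of r] that by simp
  have "J m = (\<lambda>\<omega>. D)" by (rule ext) (rule JD)
  then have EJm: "expectation (J m) = D" by (simp add: prob_space)
  have intJ: "integrable M (J r)" if "r \<le> m" for r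
    by (rule L2_integrable(1)[OF is_integral_L2(2)[OF J[OF that]]])
  have C_eq: "AE \<omega> in M. C \<omega> = P * c\<^sup>2 * (\<Sum>r\<le>m. chaos_coeff m r * J r \<omega>)"
  proof -
    have sq: "AE \<omega> in M. \<forall>k. (LINT s|segment (a k) (b k). hermite m (Y' s \<omega>))\<^sup>2 =
        (\<Sum>r\<le>m. chaos_coeff m r * (LINT \<theta>|square (a k) (b k). pair_variable r (m - r) \<theta> \<omega>))"
      using squared_average_expansion by (simp add: AE_all_countable)
    show ?thesis
      using assms(17) Y'Y sq AE_space
    proof eventually_elim
      case (elim \<omega>)
      have cont: "isCont (\<lambda>s. G (Y s \<omega>)) s" for s
      proof -
        have "isCont (\<lambda>s. Y' s \<omega>) s" using Y'c[OF elim(4)] by (simp add: continuous_on_eq_continuous_at)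
        then have "isCont (\<lambda>s. c * hermite m (Y' s \<omega>)) s"
          by (intro continuous_intros isCont_o2[OF _ hermite_continuous])
        then show ?thesis using elim(2) assms(15) by simp
      qed
      have inc: "X (b k) \<omega> - X (a k) \<omega> = \<alpha> * c * (LINT s|segment (a k) (b k). hermite m (Y' s \<omega>))" for k
      proof -
        have add: "(LBINT s=0..a k. G (Y s \<omega>)) + (LBINT s=a k..b k. G (Y s \<omega>)) = (LBINT s=0..b k. G (Y s \<omega>))"
        proof (rule interval_integral_sum)
          show "interval_lebesgue_integrable lborel (min 0 (min (ereal (a k)) (ereal (b k))))
              (max 0 (max (ereal (a k)) (ereal (b k)))) (\<lambda>s. G (Y s \<omega>))"
            unfolding zero_ereal_def ereal_min[symmetric] ereal_max[symmetric]
            by (rule interval_integrable_isCont) (rule cont)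
        qed
        have path: "X t \<omega> = X 0 \<omega> + \<alpha> * (LBINT s=0..t. G (Y s \<omega>))" if "0 \<le> t" for t
          using elim(1) that unfolding \<alpha>_def by blast
        have "(x + \<alpha> * (u + v)) - (x + \<alpha> * u) = \<alpha> * v" for x u v
          by (simp add: distrib_left)
        then have "X (b k) \<omega> - X (a k) \<omega> = \<alpha> * (LBINT s=a k..b k. G (Y s \<omega>))"
          unfolding path[OF ab(2)] path[OF ab(3)] add[symmetric] .
        also have "(LBINT s=a k..b k. G (Y s \<omega>)) = (LINT s|segment (a k) (b k). G (Y s \<omega>))"
          by (rule integral_segment[OF ab(1)]) (intro borel_measurable_continuous_onI continuous_at_imp_continuous_on ballI cont)
        also have "\<dots> = c * (LINT s|segment (a k) (b k). hermite m (Y' s \<omega>))"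
          using elim(2) assms(15) by simp
        finally show ?thesis by simp
      qed
      have "C \<omega> = real N powr (2 * Hprime H m - 1) * (\<Sum>k<N. (X (b k) \<omega> - X (a k) \<omega>)\<^sup>2)"
        by (simp add: C_def quad_var_estimator_def a_def b_def)
      also have "\<dots> = P * c\<^sup>2 * (\<Sum>k<N. (LINT s|segment (a k) (b k). hermite m (Y' s \<omega>))\<^sup>2)"
        unfolding inc power_mult_distrib sum_distrib_left[symmetric] by (simp add: P_def)
      also have "(\<Sum>k<N. (LINT s|segment (a k) (b k). hermite m (Y' s \<omega>))\<^sup>2) =
          (\<Sum>k<N. \<Sum>r\<le>m. chaos_coeff m r * (LINT \<theta>|square (a k) (b k). pair_variable r (m - r) \<theta> \<omega>))"
        using elim(3) by simp
      also have "\<dots> = (\<Sum>r\<le>m. chaos_coeff m r * J r \<omega>)"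
        unfolding J_def sum_distrib_left by (rule sum.swap)
      finally show ?case .
    qed
  qed
  have Cm: "C \<in> borel_measurable M"
  proof -
    have Xm: "X (a k) \<in> borel_measurable M" "X (b k) \<in> borel_measurable M" for k
      using assms(16) ab[of k] by simp_all
    have "(\<lambda>\<omega>. real N powr (2 * Hprime H m - 1) * (\<Sum>k<N. (X (b k) \<omega> - X (a k) \<omega>)\<^sup>2)) \<in> borel_measurable M"
      by (intro borel_measurable_times borel_measurable_const borel_measurable_sum borel_measurable_power
          borel_measurable_diff Xm)
    then show ?thesis by (simp only: C_def quad_var_estimator_def[abs_def] a_def b_def)
  qed
  have intR: "integrable M (\<lambda>\<omega>. P * c\<^sup>2 * (\<Sum>r\<le>m. chaos_coeff m r * J r \<omega>))"
    by (intro integrable_mult_right Bochner_Integration.integrable_sum intJ) simp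
  have intC: "integrable M C"
    using integrable_cong_AE[OF Cm borel_measurable_integrable[OF intR] C_eq] intR by simp
  have split: "(\<Sum>r\<le>m. chaos_coeff m r * F r) = (\<Sum>r<m. chaos_coeff m r * F r) + chaos_coeff m m * F m" for F
    unfolding lessThan_Suc_atMost[symmetric] by simp
  have EC: "expectation C = P * c\<^sup>2 * (chaos_coeff m m * D)"
  proof -
    have "expectation C = expectation (\<lambda>\<omega>. P * c\<^sup>2 * (\<Sum>r\<le>m. chaos_coeff m r * J r \<omega>))"
      by (rule integral_cong_AE[OF Cm borel_measurable_integrable[OF intR] C_eq])
    also have "\<dots> = P * c\<^sup>2 * (\<Sum>r\<le>m. expectation (\<lambda>\<omega>. chaos_coeff m r * J r \<omega>))"
      unfolding integral_mult_right_zero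
      by (subst Bochner_Integration.integral_sum) (simp_all add: intJ)
    also have "\<dots> = P * c\<^sup>2 * (chaos_coeff m m * D)"
      unfolding integral_mult_right_zero split by (simp add: EJ EJm)
    finally show ?thesis .
  qed
  \<comment> \<open>For \<open>n = 2 * m - 2 * r\<close> with \<open>r < m\<close>, the contraction order \<open>r\<close> is \<open>m - n div 2\<close>.\<close>
  define T where "T n = (if n = 0 then (\<lambda>\<omega>. expectation C / c\<^sup>2) else
    (\<lambda>\<omega>. P * multiple_integral M W n (f (m - n div 2)) \<omega>))" for n
  have Tr: "T (2 * m - 2 * r) = (\<lambda>\<omega>. P * multiple_integral M W (2 * m - 2 * r) (f r) \<omega>)" if "r < m" for r
  proof -
    have "m - (2 * m - 2 * r) div 2 = r" using that by simp
    then show ?thesis using that by (simp add: T_def)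
  qed
  have mm: "2 * m - 2 * r = 2 * (m - r)" for r by simp
  have JM: "AE \<omega> in M. \<forall>r<m. multiple_integral M W (2 * m - 2 * r) (f r) \<omega> = J r \<omega>"
  proof -
    have "AE \<omega> in M. r < m \<longrightarrow> multiple_integral M W (2 * m - 2 * r) (f r) \<omega> = J r \<omega>" for r
      using multiple_integral_AE[OF J[of r]] unfolding mm by (cases "r < m") auto
    then show ?thesis by (simp add: AE_all_countable)
  qed
  have dec: "AE \<omega> in M. C \<omega> = c\<^sup>2 * T 0 \<omega> +
       (\<Sum>r<m. (c * fact m / (fact (m - r) * sqrt (fact r)))\<^sup>2 * T (2 * m - 2 * r) \<omega>)"
    using C_eq JM
  proof eventually_elim
    case (elim \<omega>)
    have "(\<Sum>r<m. (c * fact m / (fact (m - r) * sqrt (fact r)))\<^sup>2 * T (2 * m - 2 * r) \<omega>) =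
        (\<Sum>r<m. P * c\<^sup>2 * (chaos_coeff m r * J r \<omega>))"
    proof (intro sum.cong refl)
      fix r assume "r \<in> {..<m}"
      then have r: "r < m" by simp
      have "(c * fact m / (fact (m - r) * sqrt (fact r)))\<^sup>2 = c\<^sup>2 * chaos_coeff m r"
        by (simp add: chaos_coeff_def power_divide power_mult_distrib)
      then show "(c * fact m / (fact (m - r) * sqrt (fact r)))\<^sup>2 * T (2 * m - 2 * r) \<omega> =
          P * c\<^sup>2 * (chaos_coeff m r * J r \<omega>)"
        unfolding Tr[OF r] using elim(2) r by simp
    qed
    moreover have "c\<^sup>2 * T 0 \<omega> = P * c\<^sup>2 * (chaos_coeff m m * D)"
      using \<open>c \<noteq> 0\<close> by (simp add: T_def EC)
    ultimately show ?case
      unfolding elim(1) split JD by (simp only: sum_distrib_left distrib_left add.commute)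
  qed
  have chaos: "T (2 * m - 2 * r) \<in> wiener_chaos M W (2 * m - 2 * r)" if "r \<le> m" for r
  proof (cases "r = m")
    case True
    then show ?thesis using wiener_chaosI[OF is_integral_const[of "expectation C / c\<^sup>2"]] by (simp add: T_def)
  next
    case False
    then have r: "r < m" using that by simp
    have "f r \<in> L2 (Rn (2 * m - 2 * r))"
      unfolding mm by (rule is_integral_L2(1)[OF J[OF that]])
    from wiener_chaosI[OF is_integral_cmult[OF is_integral_multiple_integral[OF this], of P]]
    show ?thesis unfolding Tr[OF r] .
  qed
  show ?thesis
  proof (intro exI[of _ T] conjI)
    show "\<forall>r<m. T (2 * m - 2 * r) = (\<lambda>\<omega>.
       real N powr (2 * Hprime H m - 1) * (alpha \<epsilon> (Hstar H m))\<^sup>2 *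
       multiple_integral M W (2 * m - 2 * r)
         (\<lambda>z. \<Sum>k<N. contraction m m r
                (averaged_kernel K m (real k * \<delta>) (real (k + 1) * \<delta>))
                (averaged_kernel K m (real k * \<delta>) (real (k + 1) * \<delta>)) z) \<omega>)"
      using Tr unfolding P_def \<alpha>_def f_def[abs_def] a_def b_def by blast
    show "\<forall>\<omega>. c\<^sup>2 * T 0 \<omega> = expectation C"
      using \<open>c \<noteq> 0\<close> by (simp add: T_def)
    show "\<forall>r\<le>m. T (2 * m - 2 * r) \<in> wiener_chaos M W (2 * m - 2 * r)"
      using chaos by simp
    show "\<forall>r\<le>m. \<forall>r'\<le>m. r \<noteq> r' \<longrightarrow>
       (\<forall>U \<in> wiener_chaos M W (2 * m - 2 * r). \<forall>V \<in> wiener_chaos M W (2 * m - 2 * r').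
          integrable M (\<lambda>\<omega>. U \<omega> * V \<omega>) \<and> expectation (\<lambda>\<omega>. U \<omega> * V \<omega>) = 0)"
    proof (intro allI impI ballI)
      fix r r' U V
      assume r: "r \<le> m" "r' \<le> m" "r \<noteq> r'" and U: "U \<in> wiener_chaos M W (2 * m - 2 * r)"
        and V: "V \<in> wiener_chaos M W (2 * m - 2 * r')"
      have "2 * m - 2 * r \<noteq> 2 * m - 2 * r'" using r by simp
      from wiener_chaos_orthogonal[OF U V this]
      show "integrable M (\<lambda>\<omega>. U \<omega> * V \<omega>) \<and> expectation (\<lambda>\<omega>. U \<omega> * V \<omega>) = 0" by (rule conjI)
    qed
  qed (fact dec, fact intC)
qed

end
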